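(* Let $1<p<\infty$ and let $\Omega\subset\mathbb{R}^N$ be an open and bounded (non-empty) convex set. Then \[ \left(\frac{2^{\frac{p-1}{p}}}{\mathrm{diam}(\Omega)}\right)^p\le \mu(\Omega;p). \]
   Context: For $1<p<\infty$ and $\Omega\subset\mathbb{R}^N$ open and bounded, the first non-trivial Neumann eigenvalue of the $p$-Laplacian is \[ \mu(\Omega;p):=\inf_{\phi\in \mathrm{W}^{1,p}(\Omega)\setminus\{0\}}\left\{\frac{\int_\Omega |\nabla \phi|^p\,dx}{\int_\Omega |\phi|^p\,dx}\,:\,\int_\Omega |\phi|^{p-2}\,\phi\,dx=0\right\}, \] where $\mathrm{W}^{1,p}(\Omega)=\{\phi\in L^p(\Omega):\nabla\phi\in L^p(\Omega;\mathbb{R}^N)\}$ is the usual Sobolev space of real-valued functions (with weak gradient), and $|\phi|^{p-2}\phi$ is $0$ where $\phi=0$. $\mathrm{diam}(\Omega)$ is the diameter of $\Omega$. *)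

theory Defs
  imports "HOL-Analysis.Analysis"
begin

fun C_k :: "nat \<Rightarrow> ('a::euclidean_space \<Rightarrow> real) \<Rightarrow> bool" where
  "C_k 0 f \<longleftrightarrow> continuous_on UNIV f"
| "C_k (Suc k) f \<longleftrightarrow>
     (\<forall>x. f differentiable (at x)) \<and> (\<forall>i\<in>Basis. C_k k (\<lambda>x. frechet_derivative f (at x) i))"

text \<open>The space of smooth functions with compact support in \<open>\<Omega>\<close>; its elements are
  functions on the whole space, that is, they are extended by zero outside \<open>\<Omega>\<close>.\<close>

definition test_functions :: "'a::euclidean_space set \<Rightarrow> ('a \<Rightarrow> real) set" where
  "test_functions \<Omega> = {\<psi>. (\<forall>k. C_k k \<psi>) \<and>
     compact (closure {x. \<psi> x \<noteq> 0}) \<and> closure {x. \<psi> x \<noteq> 0} \<subseteq> \<Omega>}"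

text \<open>Elements of \<open>Lp p \<Omega>\<close> are functions, not equivalence classes modulo null sets, and
  their values outside \<open>\<Omega>\<close> are irrelevant.\<close>

definition Lp :: "real \<Rightarrow> 'a::euclidean_space set \<Rightarrow> ('a \<Rightarrow> 'b::euclidean_space) set" where
  "Lp p \<Omega> = {f. f \<in> borel_measurable (lebesgue_on \<Omega>) \<and>
     integrable (lebesgue_on \<Omega>) (\<lambda>x. norm (f x) powr p)}"

definition locally_integrable_on ::
    "('a::euclidean_space \<Rightarrow> 'b::euclidean_space) \<Rightarrow> 'a set \<Rightarrow> bool"
    (infix "locally'_integrable'_on" 50) where
  "f locally_integrable_on \<Omega> \<longleftrightarrow> (\<forall>K. compact K \<and> K \<subseteq> \<Omega> \<longrightarrow> integrable (lebesgue_on K) f)"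

definition has_weak_gradient_on ::
    "('a::euclidean_space \<Rightarrow> real) \<Rightarrow> ('a \<Rightarrow> 'a) \<Rightarrow> 'a set \<Rightarrow> bool" where
  "has_weak_gradient_on u g \<Omega> \<longleftrightarrow>
     u locally_integrable_on \<Omega> \<and> g locally_integrable_on \<Omega> \<and>
     (\<forall>\<psi>\<in>test_functions \<Omega>. \<forall>i\<in>Basis.
        (LINT x|lebesgue_on \<Omega>. u x * frechet_derivative \<psi> (at x) i) =
        - (LINT x|lebesgue_on \<Omega>. (g x \<bullet> i) * \<psi> x))"

definition W1p :: "real \<Rightarrow> 'a::euclidean_space set \<Rightarrow> ('a \<Rightarrow> real) set" where
  "W1p p \<Omega> = {u \<in> Lp p \<Omega>. \<exists>g\<in>Lp p \<Omega>. has_weak_gradient_on u g \<Omega>}"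

text \<open>The weak gradient is only determined almost everywhere, so the infimum ranges over all its
  representatives \<open>g\<close>, which all give the same quotient. That \<open>\<phi>\<close> is not the zero element of the
  Sobolev space means that it does not vanish almost everywhere. Since \<open>0 powr a = 0\<close>, the
  function \<open>\<bar>\<phi>\<bar> powr (p - 2) * \<phi>\<close> vanishes where \<open>\<phi>\<close> does. The infimum is taken in the extended
  reals, where it always exists.\<close>

definition neumann_eigenvalue :: "'a::euclidean_space set \<Rightarrow> real \<Rightarrow> ereal" where
  "neumann_eigenvalue \<Omega> p = Inf {ereal
       ((LINT x|lebesgue_on \<Omega>. norm (g x) powr p) / (LINT x|lebesgue_on \<Omega>. \<bar>\<phi> x\<bar> powr p)) | \<phi> g.
     \<phi> \<in> W1p p \<Omega> \<and> g \<in> Lp p \<Omega> \<and> has_weak_gradient_on \<phi> g \<Omega> \<and>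
     \<not> (AE x in lebesgue_on \<Omega>. \<phi> x = 0) \<and>
     (LINT x|lebesgue_on \<Omega>. \<bar>\<phi> x\<bar> powr (p - 2) * \<phi> x) = 0}"

end

theory Submission imports Defs begin

text \<open>Put \<open>q = p / (p - 1)\<close> and let \<open>f\<close>, \<open>g\<close> be multiples of \<open>u\<^sub>+\<^sup>p\<^sup>-\<^sup>1\<close> and \<open>u\<^sub>-\<^sup>p\<^sup>-\<^sup>1\<close>, which
  have equal mass. Moving \<open>f\<close> to \<open>g\<close> along segments, of length at most \<open>diameter \<Omega>\<close>, bounds
  the integral of \<open>u (f - g)\<close> by the integral of \<open>\<bar>\<nabla>u\<bar>\<close> against the intermediate densities, and for
  a good transport plan the \<open>q\<close>-th moment of these densities is convex along the motion.
  Instead of an optimal transport map, step functions on boxes are used: two boxes are transported by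
  an affine map with diagonal linear part, for which the convexity is the arithmetic-geometric mean
  inequality, and several boxes are reduced to two by cutting both families in equal proportions with
  parallel coordinate hyperplanes, as in the Hadwiger--Ohmann proof of the Brunn--Minkowski inequality.
  The intermediate densities of the two halves do not overlap, so no constant depending on the
  dimension is lost. Mollification of \<open>u\<close> and density of step functions give the general case.\<close>

section \<open>Smooth mollifiers\<close>

text \<open>Young's inequality is used at each fixed time, before integrating along the motion. If
  the boxes do not overlap at that time, the gradient term is at most the full integral of its p-th
  power. The q-th moments of the two ends enter with the weights 1 - t and t, which average to 1/2.
  This half is the origin of the factor 2 in the estimate.

  Disjointness at every time has to be ensured without an optimal map. The induction therefore does
  not follow the moving pieces. Each family carries a containing box that is cut together with it,
  and the gradient is integrated over the interpolated containers. These are again boxes, split by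
  one moving hyperplane, so their integrals add up exactly. Containers may leave the convex set,
  hence the power of the gradient is replaced by a nonnegative majorant \<open>H\<close> on the
  whole space.

  Mollification is controlled only away from the boundary. The inequality is thus first proved for
  boxes in a compact convex subset of \<Omega>, with a bound that is free of the mollification
  radius.\<close>

definition flat_exp :: "real poly \<Rightarrow> real \<Rightarrow> real" where
  "flat_exp P s = (if 0 < s then poly P (1 / s) * exp (- 1 / s) else 0)"

lemma poly_times_exp_tendsto_0: "((\<lambda>y. poly P y * exp (- y)) \<longlongrightarrow> (0::real)) at_top"
proof -
  have "((\<lambda>y. \<Sum>i\<le>degree P. coeff P i * (y ^ i / exp y)) \<longlongrightarrow> (\<Sum>i\<le>degree P. coeff P i * 0)) at_top"
    by (intro tendsto_intros tendsto_power_div_exp_0)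
  then show ?thesis
    by (simp add: poly_altdef exp_minus sum_distrib_right divide_inverse mult.assoc)
qed

text \<open>With \<open>y = 1 / s\<close>, differentiating \<open>P y * exp (- y)\<close> gives
  \<open>y^2 * (P - P') y * exp (- y)\<close>, which is of the same form. Carrying the polynomial as
  a parameter thus makes the family closed under differentiation, and smoothness follows by
  induction in \<open>C_k_flat_exp\<close>.\<close>

lemma DERIV_flat_exp:
  "(flat_exp P has_field_derivative flat_exp ([:0, 0, 1:] * (P - pderiv P)) s) (at s)"
proof -
  consider "s < 0" | "0 < s" | "s = 0" by linarith
  then show ?thesis
  proof cases
    case 1
    have "((\<lambda>_. 0) has_field_derivative 0) (at s)" by simp
    then have "(flat_exp P has_field_derivative 0) (at s)"
      by (rule has_field_derivative_transform_within_open[of _ _ _ "{..<0}"])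
         (use 1 in \<open>auto simp: flat_exp_def\<close>)
    then show ?thesis using 1 by (simp add: flat_exp_def)
  next
    case 2
    have "((\<lambda>s. poly P (1 / s) * exp (- 1 / s)) has_field_derivative
        flat_exp ([:0, 0, 1:] * (P - pderiv P)) s) (at s)"
      using 2 by (auto intro!: derivative_eq_intros DERIV_chain2[OF poly_DERIV]
        simp: flat_exp_def field_simps power2_eq_square)
    then show ?thesis
      by (rule has_field_derivative_transform_within_open[of _ _ _ "{0<..}"])
         (use 2 in \<open>auto simp: flat_exp_def\<close>)
  next
    case 3
    \<comment> \<open>The difference quotient at 0 is \<open>y * P y * exp (- y)\<close> with
      \<open>y = 1 / h\<close>, and \<open>pCons 0 P\<close> is the polynomial
      \<open>y * P y\<close>.\<close>
    have "((\<lambda>h. poly (pCons 0 P) (inverse h) * exp (- inverse h)) \<longlongrightarrow> 0) (at_right 0)"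
      by (rule filterlim_compose[OF poly_times_exp_tendsto_0 filterlim_inverse_at_top_right])
    moreover have "\<forall>\<^sub>F h in at_right 0. poly (pCons 0 P) (inverse h) * exp (- inverse h) = flat_exp P h / h"
      by (auto simp: eventually_at_filter flat_exp_def divide_simps)
    ultimately have "((\<lambda>h. flat_exp P h / h) \<longlongrightarrow> 0) (at_right 0)"
      using tendsto_cong by force
    moreover have "((\<lambda>h. flat_exp P h / h) \<longlongrightarrow> 0) (at_left 0)"
      by (rule Lim_transform_eventually[OF tendsto_const])
         (auto simp: eventually_at_filter flat_exp_def)
    ultimately have "((\<lambda>h. flat_exp P h / h) \<longlongrightarrow> 0) (at 0)"
      by (rule filterlim_split_at[rotated])
    then show ?thesis
      using 3 by (simp add: DERIV_def flat_exp_def)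
  qed
qed

section \<open>Closure properties of the classes \<open>C_k\<close>\<close>

lemma frechet_derivative_eqI:
  "(f has_derivative f') (at x) \<Longrightarrow> frechet_derivative f (at x) v = f' v"
  using frechet_derivative_at by metis

lemma C_k_SucI:
  assumes "\<And>x. (f has_derivative f' x) (at x)" "\<And>i. i \<in> Basis \<Longrightarrow> C_k k (\<lambda>x. f' x i)"
  shows "C_k (Suc k) f"
proof -
  have "(\<lambda>x. frechet_derivative f (at x) i) = (\<lambda>x. f' x i)" for i
    using frechet_derivative_eqI[OF assms(1)] by blast
  then show ?thesis
    using assms by (auto simp: differentiable_def)
qed

lemma C_k_SucD:
  assumes "C_k (Suc k) f"
  shows "(f has_derivative frechet_derivative f (at x)) (at x)"
    and "i \<in> Basis \<Longrightarrow> C_k k (\<lambda>x. frechet_derivative f (at x) i)"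
  using assms by (auto simp: frechet_derivative_works)

lemma C_k_Suc_imp: "C_k (Suc k) f \<Longrightarrow> C_k k f"
proof (induction k arbitrary: f)
  case 0
  then show ?case
    by (auto intro!: differentiable_imp_continuous_on simp: differentiable_on_def differentiable_at_withinI)
next
  case (Suc k)
  then show ?case by (metis C_k.simps(2))
qed

lemma C_k_imp_continuous: "C_k k f \<Longrightarrow> continuous_on UNIV f"
proof (induction k)
  case (Suc k)
  then show ?case using C_k_Suc_imp by blast
qed simp

lemma C_k_const: "C_k k (\<lambda>_. c)"
proof (induction k arbitrary: c)
  case (Suc k)
  show ?case by (rule C_k_SucI[of _ "\<lambda>_ _. 0"]) (auto simp: Suc)
qed auto

lemma C_k_inner: "C_k k (\<lambda>x. x \<bullet> v)"
proof (cases k)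
  case (Suc n)
  show ?thesis unfolding Suc
    by (rule C_k_SucI[of _ "\<lambda>_ h. h \<bullet> v"]) (auto intro!: derivative_eq_intros simp: C_k_const)
qed (auto intro!: continuous_intros)

lemma C_k_add: "C_k k f \<Longrightarrow> C_k k g \<Longrightarrow> C_k k (\<lambda>x. f x + g x)"
proof (induction k arbitrary: f g)
  case (Suc k)
  note f = C_k_SucD[OF Suc.prems(1)] and g = C_k_SucD[OF Suc.prems(2)]
  show ?case
    by (rule C_k_SucI[OF has_derivative_add[OF f(1) g(1)]]) (intro Suc.IH f g)
qed (auto intro!: continuous_intros)

lemma C_k_mult: "C_k k f \<Longrightarrow> C_k k g \<Longrightarrow> C_k k (\<lambda>x. f x * g x)"
proof (induction k arbitrary: f g)
  case (Suc k)
  note f = C_k_SucD[OF Suc.prems(1)] and g = C_k_SucD[OF Suc.prems(2)]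
  show ?case
    by (rule C_k_SucI[OF has_derivative_mult[OF f(1) g(1)]])
       (intro C_k_add Suc.IH f g Suc.prems[THEN C_k_Suc_imp])
qed (auto intro!: continuous_intros)

lemma C_k_sum: "finite I \<Longrightarrow> (\<And>i. i \<in> I \<Longrightarrow> C_k k (f i)) \<Longrightarrow> C_k k (\<lambda>x. \<Sum>i\<in>I. f i x)"
  by (induction I rule: finite_induct) (auto simp: C_k_const C_k_add)

lemma C_k_flat_exp: "C_k k f \<Longrightarrow> C_k k (\<lambda>x. flat_exp P (f x))"
proof (induction k arbitrary: P)
  case 0
  have "continuous_on UNIV (flat_exp P)"
    using DERIV_flat_exp by (meson DERIV_isCont continuous_at_imp_continuous_on)
  with 0 show ?case by (auto intro: continuous_on_compose2)
next
  case (Suc k)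
  note f = C_k_SucD[OF Suc.prems]
  show ?case
  proof (rule C_k_SucI)
    show "((\<lambda>x. flat_exp P (f x)) has_derivative
        (\<lambda>h. flat_exp ([:0, 0, 1:] * (P - pderiv P)) (f x) * frechet_derivative f (at x) h)) (at x)" for x
      using has_derivative_compose[OF f(1) DERIV_flat_exp[unfolded has_field_derivative_def]] .
    show "C_k k (\<lambda>x. flat_exp ([:0, 0, 1:] * (P - pderiv P)) (f x) * frechet_derivative f (at x) i)"
      if "i \<in> Basis" for i
      by (intro C_k_mult Suc.IH C_k_Suc_imp[OF Suc.prems] f(2) that)
  qed
qed

text \<open>The standard bump \<open>exp (- 1 / (r^2 - |y|^2))\<close>, normalised. The last
  property concerns reflected translates because a convolution at \<open>x\<close> tests the weak
  gradient with \<open>z \<mapsto> \<eta> (x - z)\<close>.\<close>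

lemma mollifier_exists:
  fixes r :: real
  assumes r: "0 < r"
  obtains \<eta> :: "'a::euclidean_space \<Rightarrow> real" where
    "\<And>k. C_k k \<eta>" "\<And>y. 0 \<le> \<eta> y" "\<And>y. r \<le> norm y \<Longrightarrow> \<eta> y = 0"
    "integrable lborel \<eta>" "(LINT y|lborel. \<eta> y) = 1"
    "\<And>x \<Omega>. cball x r \<subseteq> \<Omega> \<Longrightarrow> (\<lambda>z. \<eta> (x - z)) \<in> test_functions \<Omega>"
proof -
  define b where "b y = flat_exp 1 (r\<^sup>2 - (norm y)\<^sup>2)" for y :: 'a
  have C: "C_k k (\<lambda>z. c * b (x - z))" for k x c
  proof -
    \<comment> \<open>The squared norm is a polynomial in the coordinates; differences are written
      with the factor -1 so that the rules for sums and products suffice.\<close>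
    have "C_k k (\<lambda>z. r\<^sup>2 + (-1) * (\<Sum>i\<in>Basis. (x \<bullet> i + (-1) * (z \<bullet> i)) * (x \<bullet> i + (-1) * (z \<bullet> i))))"
      by (intro C_k_add C_k_mult C_k_sum C_k_const C_k_inner) auto
    also have "(\<lambda>z. r\<^sup>2 + (-1) * (\<Sum>i\<in>Basis. (x \<bullet> i + (-1) * (z \<bullet> i)) * (x \<bullet> i + (-1) * (z \<bullet> i)))) =
      (\<lambda>z. r\<^sup>2 - (norm (x - z))\<^sup>2)"
      unfolding power2_norm_eq_inner by (subst euclidean_inner) (simp add: inner_diff_left)
    finally show ?thesis
      unfolding b_def by (intro C_k_mult C_k_const C_k_flat_exp)
  qed
  have b_pos: "b y > 0 \<longleftrightarrow> norm y < r" and b_nonneg: "b y \<ge> 0" for y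
    using r power_strict_mono[of "norm y" r 2] power2_less_imp_less[of "norm y" r]
    by (auto simp: b_def flat_exp_def)
  have b0: "b y = 0" if "r \<le> norm y" for y
    using b_pos[of y] b_nonneg[of y] that by auto
  have "continuous_on UNIV (\<lambda>z. 1 * b (0 - z))" using C_k_imp_continuous[OF C] .
  then have cont: "continuous_on UNIV b" by (simp add: b_def)
  have "integrable lborel (\<lambda>x. indicator (cball 0 r) x *\<^sub>R b x)"
    by (intro borel_integrable_compact continuous_on_subset[OF cont]) auto
  also have "(\<lambda>x. indicator (cball 0 r) x *\<^sub>R b x) = b"
    using b0 by (auto simp: indicator_def fun_eq_iff)
  finally have int: "integrable lborel b" .
  define \<kappa> where "\<kappa> = (LINT y|lborel. b y)"
  have "\<kappa> \<noteq> 0"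
  proof
    assume "\<kappa> = 0"
    then have "AE y in lborel. b y = 0"
      using integral_nonneg_eq_0_iff_AE[OF int] b_nonneg by (simp add: \<kappa>_def)
    then have "AE y in lborel. y \<notin> ball (0::'a) r"
      by (rule eventually_mono) (simp add: b_pos[symmetric])
    then have "emeasure lborel (ball 0 r :: 'a set) = 0"
      by (subst (asm) AE_iff_measurable[of "ball 0 r"]) auto
    then show False
      using content_ball_pos[OF r, of "0::'a"] by (simp add: measure_def)
  qed
  moreover have "\<kappa> \<ge> 0" unfolding \<kappa>_def using b_nonneg by simp
  ultimately have \<kappa>: "\<kappa> > 0" by simp
  define \<eta> where "\<eta> y = (1 / \<kappa>) * b y" for y
  show thesis
  proof
    show "C_k k \<eta>" for k
    proof -
      have "(\<lambda>z. (1 / \<kappa>) * b (0 - z)) = \<eta>" by (simp add: \<eta>_def b_def fun_eq_iff)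
      then show ?thesis using C[of k "1 / \<kappa>" 0] by simp
    qed
    show "0 \<le> \<eta> y" for y using \<kappa> b_nonneg by (simp add: \<eta>_def)
    show "\<eta> y = 0" if "r \<le> norm y" for y using b0[OF that] by (simp add: \<eta>_def)
    show "integrable lborel \<eta>" using int unfolding \<eta>_def by simp
    show "(LINT y|lborel. \<eta> y) = 1" unfolding \<eta>_def using \<kappa> by (simp add: \<kappa>_def)
    show "(\<lambda>z. \<eta> (x - z)) \<in> test_functions \<Omega>" if "cball x r \<subseteq> \<Omega>" for x \<Omega>
    proof -
      have "{z. \<eta> (x - z) \<noteq> 0} = ball x r"
        using b_pos b_nonneg \<kappa> by (auto simp: \<eta>_def dist_norm less_le)
      moreover have "C_k k (\<lambda>z. \<eta> (x - z))" for k
        using C[of k "1 / \<kappa>" x] unfolding \<eta>_def .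
      ultimately show ?thesis
        using that r unfolding test_functions_def by (simp add: closure_ball)
    qed
  qed
qed

section \<open>Transport between two boxes\<close>

text \<open>Two boxes parametrised over the same unit cube are matched by the diagonal affine map
  simply by keeping the parameter \<open>s\<close> fixed. The formula is a translation followed by a
  coordinatewise scaling.\<close>

lemma integral_cbox_eq_unit_cube:
  fixes f :: "'a::euclidean_space \<Rightarrow> real"
  assumes f: "continuous_on UNIV f" and ab: "\<And>i. i \<in> Basis \<Longrightarrow> a \<bullet> i < b \<bullet> i"
  shows "integral (cbox a b) f = measure lborel (cbox a b) *
    integral (cbox 0 One) (\<lambda>s. f (a + (\<Sum>i\<in>Basis. ((s \<bullet> i) * ((b - a) \<bullet> i)) *\<^sub>R i)))"
proof -
  let ?m = "\<lambda>k. (b - a) \<bullet> k"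
  have m: "?m k > 0" if "k \<in> Basis" for k
    using ab[OF that] by (simp add: inner_diff_left)
  then have m': "?m k \<noteq> 0" if "k \<in> Basis" for k
    using that by force
  have "(f has_integral integral (cbox a b) f) (cbox a b)"
    by (intro integrable_integral integrable_continuous continuous_on_subset[OF f]) auto
  from has_integral_shift_cbox[OF this, of a]
  have 1: "((\<lambda>x. f (x + a)) has_integral integral (cbox a b) f) (cbox 0 (b - a))"
    by simp
  have 2: "((\<lambda>x. f ((\<Sum>k\<in>Basis. (?m k * (x \<bullet> k)) *\<^sub>R k) + a)) has_integral
     (1 / \<bar>prod ?m Basis\<bar>) *\<^sub>R integral (cbox a b) f)
     ((\<lambda>x. \<Sum>k\<in>Basis. (1 / ?m k * (x \<bullet> k)) *\<^sub>R k) ` cbox 0 (b - a))"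
    by (rule has_integral_stretch[OF 1]) (use m in force)
  have 3: "(\<lambda>x. \<Sum>k\<in>Basis. (1 / ?m k * (x \<bullet> k)) *\<^sub>R k) ` cbox 0 (b - a) = cbox 0 One" (is "?T ` _ = _")
  proof (intro equalityI subsetI)
    fix y assume "y \<in> ?T ` cbox 0 (b - a)"
    then obtain x where x: "x \<in> cbox 0 (b - a)" "y = ?T x" by blast
    have "y \<bullet> k = x \<bullet> k / ?m k" if "k \<in> Basis" for k
      unfolding x(2) inner_sum_left_Basis[OF that] by simp
    moreover have "0 \<le> x \<bullet> k / ?m k \<and> x \<bullet> k / ?m k \<le> 1" if "k \<in> Basis" for k
      using m[OF that] x(1) that by (simp add: mem_box del: inner_diff_left)
    ultimately show "y \<in> cbox 0 One"
      by (simp add: mem_box)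
  next
    fix y :: 'a assume y: "y \<in> cbox 0 One"
    have "y = ?T (\<Sum>k\<in>Basis. (?m k * (y \<bullet> k)) *\<^sub>R k)"
    proof (rule euclidean_eqI)
      fix i :: 'a assume i: "i \<in> Basis"
      show "y \<bullet> i = ?T (\<Sum>k\<in>Basis. (?m k * (y \<bullet> k)) *\<^sub>R k) \<bullet> i"
        unfolding inner_sum_left_Basis[OF i] using m'[OF i] by (simp del: inner_diff_left)
    qed
    moreover have "(\<Sum>k\<in>Basis. (?m k * (y \<bullet> k)) *\<^sub>R k) \<in> cbox 0 (b - a)"
    proof -
      have "?m k * (y \<bullet> k) \<le> ?m k * 1" if "k \<in> Basis" for k
        using y m[OF that] that by (intro mult_left_mono) (auto simp: mem_box simp del: inner_diff_left)
      moreover have "0 \<le> ?m k * (y \<bullet> k)" if "k \<in> Basis" for k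
        using m[OF that] y that by (intro mult_nonneg_nonneg) (auto simp: mem_box simp del: inner_diff_left)
      ultimately show ?thesis
        unfolding mem_box by simp
    qed
    ultimately show "y \<in> ?T ` cbox 0 (b - a)"
      by blast
  qed
  have 4: "prod ?m Basis > 0"
    using m by (intro prod_pos) auto
  have 5: "measure lborel (cbox a b) = prod ?m Basis"
    using ab by (subst content_cbox) (auto simp: less_imp_le inner_diff_left intro!: prod.cong)
  show ?thesis
    using integral_unique[OF 2[unfolded 3]] 4 5 by (simp add: add.commute mult.commute)
qed

text \<open>Weighted arithmetic-geometric mean in each factor. For side lengths it says that the
  volume of the interpolated box is log-concave in \<open>t\<close>.\<close>

lemma prod_convex_ge:
  fixes v w :: "'b \<Rightarrow> real"
  assumes "\<And>i. i \<in> S \<Longrightarrow> 0 < v i" "\<And>i. i \<in> S \<Longrightarrow> 0 < w i" and t: "0 \<le> t" "t \<le> 1"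
  shows "prod v S powr (1 - t) * prod w S powr t \<le> (\<Prod>i\<in>S. (1 - t) * v i + t * w i)"
proof -
  have "prod v S powr (1 - t) * prod w S powr t = (\<Prod>i\<in>S. v i powr (1 - t) * w i powr t)"
    using assms by (simp add: prod_powr_distrib prod.distrib less_imp_le)
  also have "\<dots> \<le> (\<Prod>i\<in>S. (1 - t) * v i + t * w i)"
    using assms by (intro prod_mono conjI Youngs_inequality_0 mult_nonneg_nonneg) auto
  finally show ?thesis .
qed

text \<open>As \<open>q > 1\<close>, the exponent \<open>1 - q\<close> is negative and the lower
  bound on \<open>V\<close> becomes an upper bound; a second arithmetic-geometric mean inequality
  turns the geometric mean into a convex combination.\<close>

lemma powr_neg_le_convex:
  fixes V V0 V1 :: real
  assumes "V0 powr (1 - t) * V1 powr t \<le> V" "0 < V0" "0 < V1" "0 \<le> t" "t \<le> 1" "1 < q"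
  shows "V powr (1 - q) \<le> (1 - t) * V0 powr (1 - q) + t * V1 powr (1 - q)"
proof -
  have "V powr (1 - q) \<le> (V0 powr (1 - t) * V1 powr t) powr (1 - q)"
    using assms by (intro powr_mono2') auto
  also have "\<dots> = (V0 powr (1 - q)) powr (1 - t) * (V1 powr (1 - q)) powr t"
    using assms by (simp add: powr_mult powr_powr mult.commute)
  also have "\<dots> \<le> (1 - t) * V0 powr (1 - q) + t * V1 powr (1 - q)"
    using assms by (intro Youngs_inequality_0) auto
  finally show ?thesis .
qed

definition interp :: "real \<Rightarrow> 'a::real_vector \<Rightarrow> 'a \<Rightarrow> 'a" where
  "interp t x y = (1 - t) *\<^sub>R x + t *\<^sub>R y"

text \<open>The length of the segment is absorbed into \<open>h\<close>, so \<open>ug\<close>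
  integrates over the parameter \<open>t\<close> alone. \<open>H\<close> dominates
  \<open>h powr p\<close> only on \<open>K\<close>, but it lives on the whole space, because it is
  also integrated over containing boxes that reach outside \<open>K\<close>.\<close>

locale upper_gradient =
  fixes w h H :: "'a::euclidean_space \<Rightarrow> real" and K :: "'a set" and p q :: real
  assumes pq: "1 < p" "1 < q" "1 / p + 1 / q = 1"
    and w: "continuous_on UNIV w" and h: "continuous_on UNIV h" and h_nonneg: "\<And>x. 0 \<le> h x"
    and K: "convex K"
    and ug: "\<And>x y. x \<in> K \<Longrightarrow> y \<in> K \<Longrightarrow> w x - w y \<le> integral {0..1} (\<lambda>t. h (interp t x y))"
    and H: "H integrable_on UNIV" "\<And>x. 0 \<le> H x" "\<And>x. x \<in> K \<Longrightarrow> h x powr p \<le> H x"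
begin

lemma H_cbox: "H integrable_on cbox a b"
  using H(1) integrable_on_subcbox by blast

text \<open>Spread the common mass \<open>M\<close> uniformly over the unit cube of parameters,
  integrate \<open>ug\<close> along the paths and exchange the integrals. At time \<open>t\<close>
  this leaves the integral of \<open>h\<close> against the constant density \<open>M / V\<close> on
  the interpolated box of volume \<open>V\<close>, to which Young's inequality is applied. The bound
  is kept pointwise in \<open>t\<close> so that bounds for disjoint boxes can be added at each
  time.\<close>

lemma transport_box:
  assumes ab: "\<And>i. i \<in> Basis \<Longrightarrow> a \<bullet> i < b \<bullet> i" and cd: "\<And>i. i \<in> Basis \<Longrightarrow> c \<bullet> i < d \<bullet> i"
    and sub: "cbox a b \<subseteq> K" "cbox c d \<subseteq> K"
    and pos: "0 < \<alpha>" "0 < \<beta>" and mass: "\<alpha> * measure lborel (cbox a b) = \<beta> * measure lborel (cbox c d)"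
  shows "\<exists>R. R integrable_on {0..1} \<and>
     \<alpha> * integral (cbox a b) w - \<beta> * integral (cbox c d) w \<le> integral {0..1} R \<and>
     (\<forall>t\<in>{0..1}. R t \<le> integral (cbox (interp t a c) (interp t b d)) H / p +
        ((1 - t) * (\<alpha> powr q * measure lborel (cbox a b)) + t * (\<beta> powr q * measure lborel (cbox c d))) / q)"
proof -
  define X where "X t s = interp t a c +
    (\<Sum>i\<in>Basis. ((s \<bullet> i) * ((interp t b d - interp t a c) \<bullet> i)) *\<^sub>R i)" for t and s :: 'a
  let ?Q = "cbox 0 (One :: 'a)"
  define M where "M = \<alpha> * measure lborel (cbox a b)"
  define R where "R t = M * integral ?Q (\<lambda>s. h (X t s))" for t
  have less: "interp t a c \<bullet> i < interp t b d \<bullet> i" if "t \<in> {0..1}" "i \<in> Basis" for t i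
  proof -
    have "(1 - t) * (a \<bullet> i) + t * (c \<bullet> i) < (1 - t) * (b \<bullet> i) + t * (d \<bullet> i)"
    proof (cases "t = 0")
      case False
      then show ?thesis using ab cd that
        by (intro add_le_less_mono mult_left_mono mult_strict_left_mono) (auto simp: less_imp_le)
    qed (use ab that in auto)
    then show ?thesis by (simp add: interp_def inner_add_left)
  qed
  have contX: "continuous_on UNIV (\<lambda>(t, s). X t s)"
    unfolding X_def interp_def case_prod_unfold by (intro continuous_intros)
  have Xin: "X t s \<bullet> i = (1 - t) * (a \<bullet> i + s \<bullet> i * (b \<bullet> i - a \<bullet> i)) + t * (c \<bullet> i + s \<bullet> i * (d \<bullet> i - c \<bullet> i))"
    if "i \<in> Basis" for t s i
  proof -
    have "X t s \<bullet> i = interp t a c \<bullet> i + s \<bullet> i * (interp t b d \<bullet> i - interp t a c \<bullet> i)"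
      unfolding X_def inner_add_left inner_sum_left_Basis[OF that] inner_diff_left ..
    then show ?thesis
      by (simp add: interp_def inner_add_left algebra_simps)
  qed
  \<comment> \<open>Each parameter moves along a straight segment, and both ends lie in
    \<open>K\<close>, so \<open>ug\<close> applies to its path.\<close>
  have Xi: "X t s = interp t (X 0 s) (X 1 s)" for t s
    by (rule euclidean_eqI) (simp add: interp_def inner_add_left Xin)
  have V0: "measure lborel (cbox a b) > 0" "measure lborel (cbox c d) > 0"
    using ab cd by (auto simp: content_pos_lt_eq)
  have M: "M > 0" using V0 pos by (simp add: M_def)
  have X0: "X 0 s \<in> K" and X1: "X 1 s \<in> K" if "s \<in> ?Q" for s
  proof -
    have s: "0 \<le> s \<bullet> i \<and> s \<bullet> i \<le> 1" if "i \<in> Basis" for i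
      using \<open>s \<in> ?Q\<close> that by (simp add: mem_box)
    have in_box: "x + r * (y - x) \<le> y \<and> x \<le> x + r * (y - x)" if "x < y" "0 \<le> r \<and> r \<le> 1" for x y r :: real
    proof -
      have "0 \<le> r * (y - x)" "r * (y - x) \<le> 1 * (y - x)"
        using that by (auto intro!: mult_right_mono)
      moreover have "x + e \<le> y \<and> x \<le> x + e" if "0 \<le> e" "e \<le> 1 * (y - x)" for e
        using that by simp
      ultimately show ?thesis by blast
    qed
    have "X 0 s \<in> cbox a b"
      unfolding mem_box using in_box[OF ab s] by (simp add: Xin)
    moreover have "X 1 s \<in> cbox c d"
      unfolding mem_box using in_box[OF cd s] by (simp add: Xin)
    ultimately show "X 0 s \<in> K" "X 1 s \<in> K" using sub by auto
  qed
  have conthX: "continuous_on S (\<lambda>(s, t). h (X t s))" for S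
  proof -
    have "continuous_on UNIV ((\<lambda>(t, s). X t s) \<circ> prod.swap)"
      by (intro continuous_on_compose continuous_on_subset[OF contX] continuous_on_swap) auto
    then have "continuous_on UNIV (\<lambda>z. X (snd z) (fst z))"
      by (simp add: o_def case_prod_unfold prod.swap_def)
    then have "continuous_on S (\<lambda>z. X (snd z) (fst z))"
      by (rule continuous_on_subset) auto
    then show ?thesis
      by (auto simp: case_prod_unfold intro!: continuous_on_compose2[OF h])
  qed
  have contR: "continuous_on {0..1} R"
    unfolding R_def cbox_interval[symmetric]
    using continuous_on_compose2[OF h continuous_on_subset[OF contX]]
    by (intro continuous_intros integral_continuous_on_param) (auto simp: case_prod_unfold)
  have contXt: "continuous_on S (\<lambda>s. X t s)" for S t
    unfolding X_def by (intro continuous_intros)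
  have "\<alpha> * integral (cbox a b) w = M * integral ?Q (\<lambda>s. w (X 0 s))"
    using integral_cbox_eq_unit_cube[OF w ab] by (simp add: X_def M_def interp_def)
  moreover have "\<beta> * integral (cbox c d) w = M * integral ?Q (\<lambda>s. w (X 1 s))"
    using integral_cbox_eq_unit_cube[OF w cd] by (simp add: X_def M_def interp_def mass)
  moreover have intw: "(\<lambda>s. w (X t s)) integrable_on ?Q" for t
    by (intro integrable_continuous continuous_on_compose2[OF w contXt]) auto
  ultimately have "\<alpha> * integral (cbox a b) w - \<beta> * integral (cbox c d) w
    = M * integral ?Q (\<lambda>s. w (X 0 s) - w (X 1 s))"
    by (simp add: integral_diff right_diff_distrib)
  also have "\<dots> \<le> M * integral ?Q (\<lambda>s. integral {0..1} (\<lambda>t. h (X t s)))"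
  proof (intro mult_left_mono integral_le)
    show "(\<lambda>s. w (X 0 s) - w (X 1 s)) integrable_on ?Q"
      by (intro integrable_diff intw)
    show "(\<lambda>s. integral {0..1} (\<lambda>t. h (X t s))) integrable_on ?Q"
      unfolding cbox_interval[symmetric]
      using conthX
      by (intro integrable_continuous integral_continuous_on_param) auto
    fix s assume "s \<in> ?Q"
    then show "w (X 0 s) - w (X 1 s) \<le> integral {0..1} (\<lambda>t. h (X t s))"
      using ug[OF X0 X1, of s s] by (simp add: Xi[symmetric])
  qed (use M in auto)
  also have "\<dots> = integral {0..1} R"
    using integral_swap_continuous[of 0 0 One 1 "\<lambda>s t. h (X t s)", OF conthX] by (simp add: R_def[abs_def])
  finally have 1: "\<alpha> * integral (cbox a b) w - \<beta> * integral (cbox c d) w \<le> integral {0..1} R" .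
  have 2: "R t \<le> integral (cbox (interp t a c) (interp t b d)) H / p +
        ((1 - t) * (\<alpha> powr q * measure lborel (cbox a b)) + t * (\<beta> powr q * measure lborel (cbox c d))) / q"
    if t: "t \<in> {0..1}" for t
  proof -
    let ?C = "cbox (interp t a c) (interp t b d)"
    define V where "V = measure lborel ?C"
    define \<rho> where "\<rho> = M / V"
    have V: "V > 0" unfolding V_def using less[OF t] by (simp add: content_pos_lt_eq)
    have contC: "h integrable_on ?C"
      by (intro integrable_continuous continuous_on_subset[OF h]) auto
    \<comment> \<open>Every point of the intermediate box is \<open>X t s\<close> for a
      unique-coordinate parameter \<open>s\<close> of the cube, hence lies on a segment between two
      points of the convex set \<open>K\<close>.\<close>
    have inK: "?C \<subseteq> K"
    proof
      fix z assume z: "z \<in> ?C"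
      define s where "s = (\<Sum>i\<in>Basis. ((z \<bullet> i - interp t a c \<bullet> i) / (interp t b d \<bullet> i - interp t a c \<bullet> i)) *\<^sub>R i)"
      have "s \<in> ?Q"
        using z less[OF t] by (auto simp: s_def mem_box)
      moreover have "X t s = z"
      proof (rule euclidean_eqI)
        fix i :: 'a assume i: "i \<in> Basis"
        have "s \<bullet> i = (z \<bullet> i - interp t a c \<bullet> i) / (interp t b d \<bullet> i - interp t a c \<bullet> i)"
          unfolding s_def inner_sum_left_Basis[OF i] ..
        then show "X t s \<bullet> i = z \<bullet> i"
          unfolding X_def inner_add_left inner_sum_left_Basis[OF i] inner_diff_left
          using less[OF t i] by simp
      qed
      ultimately show "z \<in> K"
        using convexD_alt[OF K X0 X1, of s s t] t Xi[of t s] by (auto simp: interp_def)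
    qed
    have "integral ?C h = V * integral ?Q (\<lambda>s. h (X t s))"
      using integral_cbox_eq_unit_cube[OF h less[OF t]] by (simp add: X_def V_def)
    then have "R t = integral ?C (\<lambda>z. h z * \<rho>)"
      using V by (simp add: R_def \<rho>_def)
    also have "\<dots> \<le> integral ?C (\<lambda>z. H z / p + \<rho> powr q / q)"
    proof (intro integral_le)
      show "(\<lambda>z. h z * \<rho>) integrable_on ?C"
        using contC by (rule integrable_on_mult_left)
      show "(\<lambda>z. H z / p + \<rho> powr q / q) integrable_on ?C"
        by (intro integrable_add integrable_on_divide H_cbox) auto
      fix z assume "z \<in> ?C"
      then have "h z powr p / p \<le> H z / p" using inK H(3) pq by (auto intro!: divide_right_mono)
      moreover have "h z * \<rho> \<le> h z powr p / p + \<rho> powr q / q"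
        using pq h_nonneg M V by (intro Youngs_inequality) (auto simp: \<rho>_def)
      ultimately show "h z * \<rho> \<le> H z / p + \<rho> powr q / q" by simp
    qed
    also have "\<dots> = integral ?C H / p + V * (\<rho> powr q / q)"
      by (subst integral_add) (auto intro!: integrable_on_divide H_cbox simp: V_def)
    \<comment> \<open>The density is constant, so its q-th moment is a decreasing function of the
      volume alone.\<close>
    also have "V * (\<rho> powr q / q) = M powr q * V powr (1 - q) / q"
      using V M by (simp add: \<rho>_def powr_divide powr_diff)
    also have "\<dots> \<le> M powr q * ((1 - t) * measure lborel (cbox a b) powr (1 - q) + t * measure lborel (cbox c d) powr (1 - q)) / q"
    proof -
      have "measure lborel (cbox a b) powr (1 - t) * measure lborel (cbox c d) powr t \<le> V"
      proof -
        have vol: "measure lborel (cbox x y) = (\<Prod>i\<in>Basis. (y - x) \<bullet> i)"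
          if "\<And>i. i \<in> Basis \<Longrightarrow> x \<bullet> i < y \<bullet> i" for x y :: 'a
          using that by (subst content_cbox) (auto simp: less_imp_le inner_diff_left intro!: prod.cong)
        have "(interp t b d - interp t a c) \<bullet> i = (1 - t) * ((b - a) \<bullet> i) + t * ((d - c) \<bullet> i)" for i
          by (simp add: interp_def inner_add_left inner_diff_left algebra_simps)
        then have e: "measure lborel (cbox a b) = (\<Prod>i\<in>Basis. (b - a) \<bullet> i)"
          "measure lborel (cbox c d) = (\<Prod>i\<in>Basis. (d - c) \<bullet> i)"
          "V = (\<Prod>i\<in>Basis. (1 - t) * ((b - a) \<bullet> i) + t * ((d - c) \<bullet> i))"
          using vol[OF ab] vol[OF cd] vol[OF less[OF t]] unfolding V_def by auto
        show ?thesis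
          unfolding e using t ab cd by (intro prod_convex_ge) (auto simp: inner_diff_left)
      qed
      from powr_neg_le_convex[OF this V0] t pq
      show ?thesis by (auto intro!: divide_right_mono mult_left_mono)
    qed
    also have "M powr q * ((1 - t) * measure lborel (cbox a b) powr (1 - q) + t * measure lborel (cbox c d) powr (1 - q))
      = (1 - t) * (\<alpha> powr q * measure lborel (cbox a b)) + t * (\<beta> powr q * measure lborel (cbox c d))"
    proof -
      have "M powr q * measure lborel (cbox a b) powr (1 - q) = \<alpha> powr q * measure lborel (cbox a b)"
        using V0 pos by (simp add: M_def powr_mult powr_diff)
      moreover have "M powr q * measure lborel (cbox c d) powr (1 - q) = \<beta> powr q * measure lborel (cbox c d)"
        using V0 pos by (simp add: M_def mass powr_mult powr_diff)
      ultimately show ?thesis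
        by (simp add: algebra_simps)
    qed
    finally show ?thesis by simp
  qed
  show ?thesis
    using 1 2 integrable_continuous_interval[OF contR] by blast
qed

end

section \<open>Transport between families of boxes\<close>

text \<open>Positive volume provides the strict inequalities between corners that
  \<open>transport_box\<close> asks for. Only interiors are disjoint, since neighbouring grid cells
  share faces.\<close>

definition box_family :: "'k set \<Rightarrow> ('k \<Rightarrow> 'a::euclidean_space set) \<Rightarrow> bool" where
  "box_family I A \<longleftrightarrow> finite I \<and> (\<forall>k\<in>I. (\<exists>a b. A k = cbox a b) \<and> 0 < measure lborel (A k)) \<and>
     pairwise (\<lambda>k l. interior (A k) \<inter> interior (A l) = {}) I"

abbreviation lower_half :: "'a::euclidean_space \<Rightarrow> real \<Rightarrow> 'a set" where
  "lower_half i c \<equiv> {x. x \<bullet> i \<le> c}"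

abbreviation upper_half :: "'a::euclidean_space \<Rightarrow> real \<Rightarrow> 'a set" where
  "upper_half i c \<equiv> {x. c \<le> x \<bullet> i}"

text \<open>Pieces of measure zero are dropped. This keeps the volumes in \<open>box_family\<close>
  positive, and it is what makes the number of boxes decrease when a family is cut.\<close>

definition cut_index :: "'k set \<Rightarrow> ('k \<Rightarrow> 'a::euclidean_space set) \<Rightarrow> 'a set \<Rightarrow> 'k set" where
  "cut_index I A S = {k \<in> I. 0 < measure lborel (A k \<inter> S)}"

section \<open>Cutting a family by a coordinate hyperplane\<close>

lemma half_Int_cbox:
  assumes "i \<in> Basis" "S = lower_half i c \<or> S = upper_half i c"
  shows "\<exists>a' b'. cbox a b \<inter> S = cbox a' b'"
  using assms interval_split[of i a b c] by auto

lemma box_family_cut: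
  assumes "box_family I A" "i \<in> Basis" "S = lower_half i c \<or> S = upper_half i c"
  shows "box_family (cut_index I A S) (\<lambda>k. A k \<inter> S)"
proof -
  have "\<exists>a b. A k \<inter> S = cbox a b" if "k \<in> I" for k
    using assms that half_Int_cbox[OF assms(2,3)] unfolding box_family_def by metis
  moreover have "pairwise (\<lambda>k l. interior (A k \<inter> S) \<inter> interior (A l \<inter> S) = {}) I"
    using assms(1) by (simp add: box_family_def pairwise_def) blast
  ultimately show ?thesis
    using assms(1) unfolding box_family_def cut_index_def pairwise_def by auto
qed

lemma sum_cut_index:
  assumes A: "box_family I A" "i \<in> Basis" "S = lower_half i c \<or> S = upper_half i c"
    and null: "\<And>k a b. measure lborel (cbox a b) = 0 \<Longrightarrow> v k (cbox a b) = (0::real)"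
  shows "(\<Sum>k\<in>cut_index I A S. v k (A k \<inter> S)) = (\<Sum>k\<in>I. v k (A k \<inter> S))"
proof (rule sum.mono_neutral_left)
  show "finite I" "cut_index I A S \<subseteq> I"
    using A by (auto simp: box_family_def cut_index_def)
  show "\<forall>k\<in>I - cut_index I A S. v k (A k \<inter> S) = 0"
  proof
    fix k assume k: "k \<in> I - cut_index I A S"
    then obtain a b where ab: "A k \<inter> S = cbox a b"
      using A half_Int_cbox[OF A(2,3)] unfolding box_family_def by (metis Diff_iff)
    with k have "measure lborel (cbox a b) = 0"
      by (auto simp: cut_index_def not_less intro: antisym)
    then show "v k (A k \<inter> S) = 0" using null ab by simp
  qed
qed

text \<open>Stated for an arbitrary box functional \<open>v\<close>, additive under the cut and zero
  on null boxes, to cover masses, q-th moments and integrals of \<open>w\<close> alike.\<close>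

lemma sum_box_family_split:
  assumes A: "box_family I A" "i \<in> Basis"
    and null: "\<And>k a b. measure lborel (cbox a b) = 0 \<Longrightarrow> v k (cbox a b) = (0::real)"
    and split: "\<And>k a b. v k (cbox a b) = v k (cbox a b \<inter> lower_half i c) + v k (cbox a b \<inter> upper_half i c)"
  shows "(\<Sum>k\<in>I. v k (A k)) =
    (\<Sum>k\<in>cut_index I A (lower_half i c). v k (A k \<inter> lower_half i c)) +
    (\<Sum>k\<in>cut_index I A (upper_half i c). v k (A k \<inter> upper_half i c))"
proof -
  have "(\<Sum>k\<in>I. v k (A k)) = (\<Sum>k\<in>I. v k (A k \<inter> lower_half i c) + v k (A k \<inter> upper_half i c))"
    using A split by (intro sum.cong) (auto simp: box_family_def)
  moreover have "(\<Sum>k\<in>cut_index I A (lower_half i c). v k (A k \<inter> lower_half i c)) =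
      (\<Sum>k\<in>I. v k (A k \<inter> lower_half i c))"
    by (rule sum_cut_index[OF A]) (use null in auto)
  moreover have "(\<Sum>k\<in>cut_index I A (upper_half i c). v k (A k \<inter> upper_half i c)) =
      (\<Sum>k\<in>I. v k (A k \<inter> upper_half i c))"
    by (rule sum_cut_index[OF A]) (use null in auto)
  ultimately show ?thesis
    by (simp add: sum.distrib)
qed

lemma box_family_mass_split:
  assumes "box_family I A" and i: "i \<in> Basis"
  shows "(\<Sum>k\<in>I. \<gamma> k * measure lborel (A k)) =
    (\<Sum>k\<in>cut_index I A (lower_half i c). \<gamma> k * measure lborel (A k \<inter> lower_half i c)) +
    (\<Sum>k\<in>cut_index I A (upper_half i c). \<gamma> k * measure lborel (A k \<inter> upper_half i c))"
  by (rule sum_box_family_split[OF assms, of "\<lambda>k S. \<gamma> k * measure lborel S"])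
     (simp, subst content_split[OF i, of _ _ c], simp add: distrib_left)

text \<open>The explicit formula makes continuity in \<open>c\<close> visible, for use in the
  intermediate value theorem.\<close>

lemma measure_cbox_lower_half:
  fixes a b :: "'a::euclidean_space"
  assumes i: "i \<in> Basis" and ab: "\<forall>j\<in>Basis. a \<bullet> j < b \<bullet> j"
  shows "measure lborel (cbox a b \<inter> lower_half i c) =
    max 0 (min (b \<bullet> i) c - a \<bullet> i) * (\<Prod>j\<in>Basis - {i}. b \<bullet> j - a \<bullet> j)"
proof -
  define b' where "b' = (\<Sum>j\<in>Basis. (if j = i then min (b \<bullet> i) c else b \<bullet> j) *\<^sub>R j)"
  have b'i: "b' \<bullet> i = min (b \<bullet> i) c" and b'j: "\<And>j. j \<in> Basis - {i} \<Longrightarrow> b' \<bullet> j = b \<bullet> j"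
    using i by (auto simp: b'_def)
  have e: "cbox a b \<inter> lower_half i c = cbox a b'"
    using interval_split(1)[OF i] by (simp add: b'_def)
  show ?thesis
  proof (cases "a \<bullet> i \<le> min (b \<bullet> i) c")
    case True
    have "a \<bullet> j \<le> b' \<bullet> j" if "j \<in> Basis" for j
      using True b'i b'j[of j] bspec[OF ab that] that by (cases "j = i") auto
    then have "measure lborel (cbox a b') = (\<Prod>j\<in>Basis. b' \<bullet> j - a \<bullet> j)"
      by (subst content_cbox) auto
    also have "\<dots> = (b' \<bullet> i - a \<bullet> i) * (\<Prod>j\<in>Basis - {i}. b' \<bullet> j - a \<bullet> j)"
      using i by (simp add: prod.remove)
    also have "(\<Prod>j\<in>Basis - {i}. b' \<bullet> j - a \<bullet> j) = (\<Prod>j\<in>Basis - {i}. b \<bullet> j - a \<bullet> j)"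
      using b'j by (intro prod.cong) auto
    finally show ?thesis using True by (simp add: e b'i)
  next
    case False
    then have "cbox a b' = {}"
      using i b'i unfolding box_eq_empty by force
    moreover have "max 0 (min (b \<bullet> i) c - a \<bullet> i) = 0"
      using False by (auto simp: max_def min_def split: if_splits)
    ultimately show ?thesis by (simp add: e)
  qed
qed

section \<open>Choosing the hyperplanes\<close>

lemma box_family_cboxE:
  assumes "box_family I A" "k \<in> I"
  obtains a b where "A k = cbox a b" "\<forall>j\<in>Basis. a \<bullet> j < b \<bullet> j"
proof -
  obtain a b where ab: "A k = cbox a b" using assms by (auto simp: box_family_def)
  moreover have "0 < measure lborel (A k)" using assms by (auto simp: box_family_def)
  ultimately show thesis using that by (auto simp: content_pos_lt_eq)
qed

text \<open>Intermediate value theorem: the mass below the hyperplane grows continuously from 0 at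
  the lower face of the containing box to the total at its upper face. The bounds on
  \<open>c\<close> allow the containing box to be cut at the same level.\<close>

lemma obtain_mass_cut:
  fixes B :: "'l \<Rightarrow> 'a::euclidean_space set"
  assumes B: "box_family J B" and i: "i \<in> Basis" and sub: "\<And>l. l \<in> J \<Longrightarrow> B l \<subseteq> cbox Q0 Q1"
    and J: "J \<noteq> {}" and m: "0 \<le> m" "m \<le> (\<Sum>l\<in>J. \<beta> l * measure lborel (B l))"
  obtains c where "Q0 \<bullet> i \<le> c" "c \<le> Q1 \<bullet> i" "(\<Sum>l\<in>J. \<beta> l * measure lborel (B l \<inter> lower_half i c)) = m"
proof -
  let ?F = "\<lambda>c. \<Sum>l\<in>J. \<beta> l * measure lborel (B l \<inter> lower_half i c)"
  have le: "Q0 \<bullet> i \<le> a \<bullet> i \<and> a \<bullet> i \<le> b \<bullet> i \<and> b \<bullet> i \<le> Q1 \<bullet> i"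
    if "l \<in> J" "B l = cbox a b" "\<forall>j\<in>Basis. a \<bullet> j < b \<bullet> j" for l a b
  proof -
    have "a \<in> cbox a b" "b \<in> cbox a b" using that(3) by (auto simp: mem_box less_imp_le)
    then have "a \<in> cbox Q0 Q1" "b \<in> cbox Q0 Q1" using sub[OF that(1)] that(2) by auto
    then show ?thesis using i that(3) by (auto simp: mem_box)
  qed
  have "continuous_on UNIV (\<lambda>c. measure lborel (B l \<inter> lower_half i c))" if l: "l \<in> J" for l
  proof -
    obtain a b where ab: "B l = cbox a b" "\<forall>j\<in>Basis. a \<bullet> j < b \<bullet> j"
      using box_family_cboxE[OF B l] by blast
    show ?thesis
      unfolding ab(1) measure_cbox_lower_half[OF i ab(2)] by (intro continuous_intros)
  qed
  then have cont: "continuous_on UNIV ?F"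
    by (intro continuous_intros)
  have F0: "?F (Q0 \<bullet> i) = 0"
  proof (intro sum.neutral ballI)
    fix l assume l: "l \<in> J"
    obtain a b where ab: "B l = cbox a b" "\<forall>j\<in>Basis. a \<bullet> j < b \<bullet> j"
      using box_family_cboxE[OF B l] by blast
    show "\<beta> l * measure lborel (B l \<inter> lower_half i (Q0 \<bullet> i)) = 0"
      using le[OF l ab] unfolding ab(1) measure_cbox_lower_half[OF i ab(2)] by auto
  qed
  have F1: "?F (Q1 \<bullet> i) = (\<Sum>l\<in>J. \<beta> l * measure lborel (B l))"
  proof (intro sum.cong refl)
    fix l assume l: "l \<in> J"
    have "B l \<inter> lower_half i (Q1 \<bullet> i) = B l"
      using sub[OF l] i by (auto simp: mem_box)
    then show "\<beta> l * measure lborel (B l \<inter> lower_half i (Q1 \<bullet> i)) = \<beta> l * measure lborel (B l)" by simp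
  qed
  obtain l where l: "l \<in> J" using J by auto
  obtain a b where "B l = cbox a b" "\<forall>j\<in>Basis. a \<bullet> j < b \<bullet> j"
    using box_family_cboxE[OF B l] by blast
  from le[OF l this] have "Q0 \<bullet> i \<le> Q1 \<bullet> i" by simp
  from IVT'[of ?F "Q0 \<bullet> i" m "Q1 \<bullet> i", OF _ _ this continuous_on_subset[OF cont]] m F0 F1 that
  show ?thesis by auto
qed

text \<open>Two boxes with disjoint interiors are separated by a coordinate hyperplane through a
  face of one of them. Each half then loses at least one of the two boxes.\<close>

lemma obtain_separation:
  fixes A :: "'k \<Rightarrow> 'a::euclidean_space set"
  assumes A: "box_family I A" and two: "2 \<le> card I" and sub: "\<And>k. k \<in> I \<Longrightarrow> A k \<subseteq> cbox P0 P1"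
  obtains i c where "i \<in> Basis" "P0 \<bullet> i \<le> c" "c \<le> P1 \<bullet> i"
    "card (cut_index I A (lower_half i c)) < card I" "card (cut_index I A (upper_half i c)) < card I"
proof -
  note separated = that
  obtain k l where kl: "k \<in> I" "l \<in> I" "k \<noteq> l"
    using two by (metis card_le_Suc0_iff_eq card.infinite not_less_eq_eq numeral_2_eq_2 zero_le)
  obtain a b where ab: "A k = cbox a b" "\<forall>j\<in>Basis. a \<bullet> j < b \<bullet> j"
    using box_family_cboxE[OF A kl(1)] by blast
  obtain c d where cd: "A l = cbox c d" "\<forall>j\<in>Basis. c \<bullet> j < d \<bullet> j"
    using box_family_cboxE[OF A kl(2)] by blast
  have "box a b \<inter> box c d = {}"
    using A kl ab cd unfolding box_family_def pairwise_def by (metis interior_cbox)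
  then obtain i where i: "i \<in> Basis" "b \<bullet> i \<le> c \<bullet> i \<or> d \<bullet> i \<le> a \<bullet> i"
    unfolding disjoint_interval using ab(2) cd(2) by (meson not_less)
  \<comment> \<open>The cut is at the upper face of the box \<open>k\<close> that lies below: box
    \<open>l\<close> has no volume under it and box \<open>k\<close> has none above it.\<close>
  have main: thesis if kl: "k \<in> I" "l \<in> I" and ab: "A k = cbox a b" "\<forall>j\<in>Basis. a \<bullet> j < b \<bullet> j"
    and cd: "A l = cbox c d" "\<forall>j\<in>Basis. c \<bullet> j < d \<bullet> j" and le: "b \<bullet> i \<le> c \<bullet> i" for k l a b c d
  proof -
    have "b \<in> cbox a b" using ab(2) by (auto simp: mem_box less_imp_le)
    then have "b \<in> cbox P0 P1" using sub[OF kl(1)] ab(1) by auto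
    then have b: "P0 \<bullet> i \<le> b \<bullet> i" "b \<bullet> i \<le> P1 \<bullet> i" using i by (auto simp: mem_box)
    have "measure lborel (A l \<inter> lower_half i (b \<bullet> i)) = 0"
      using le unfolding cd(1) measure_cbox_lower_half[OF i(1) cd(2)] by auto
    then have l: "cut_index I A (lower_half i (b \<bullet> i)) \<subset> I"
      using kl(2) unfolding cut_index_def by force
    have "A k \<inter> lower_half i (b \<bullet> i) = A k"
      using ab(1) i by (auto simp: mem_box)
    then have "measure lborel (A k \<inter> upper_half i (b \<bullet> i)) = 0"
      using content_split[OF i(1), of a b "b \<bullet> i"] ab(1) by simp
    then have "cut_index I A (upper_half i (b \<bullet> i)) \<subset> I"
      using kl(1) unfolding cut_index_def by force
    then show thesis
      using separated[OF i(1) b] l A psubset_card_mono unfolding box_family_def by blast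
  qed
  show thesis
    using main[OF kl(1,2) ab cd] main[OF kl(2,1) cd ab] i(2) by blast
qed

section \<open>Cutting the containing boxes\<close>

definition set_coord :: "'a::euclidean_space \<Rightarrow> real \<Rightarrow> 'a \<Rightarrow> 'a" where
  "set_coord i c x = (\<Sum>j\<in>Basis. (if j = i then c else x \<bullet> j) *\<^sub>R j)"

lemma set_coord_inner: "j \<in> Basis \<Longrightarrow> set_coord i c x \<bullet> j = (if j = i then c else x \<bullet> j)"
  by (simp add: set_coord_def)

lemma cbox_set_coord:
  assumes "i \<in> Basis"
  shows "c \<le> b \<bullet> i \<Longrightarrow> cbox a (set_coord i c b) = cbox a b \<inter> lower_half i c"
    and "a \<bullet> i \<le> c \<Longrightarrow> cbox (set_coord i c a) b = cbox a b \<inter> upper_half i c"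
  using assms by (auto simp: mem_box set_coord_inner split: if_splits) (metis order_trans)+

lemma interp_inner: "interp t x y \<bullet> i = (1 - t) * (x \<bullet> i) + t * (y \<bullet> i)"
  by (simp add: interp_def inner_add_left)

text \<open>Cutting the two containers at levels \<open>c\<close> and \<open>c'\<close> cuts the
  interpolated container at the level \<open>(1 - t) * c + t * c'\<close>. The two halves of the
  motion therefore stay on opposite sides of one moving hyperplane.\<close>

lemma interp_set_coord:
  "interp t (set_coord i c x) (set_coord i c' y) = set_coord i ((1 - t) * c + t * c') (interp t x y)"
  by (rule euclidean_eqI) (simp add: interp_inner set_coord_inner)

context upper_gradient
begin

text \<open>\<open>cbox P0 P1\<close> and \<open>cbox Q0 Q1\<close> are meant as boxes around the
  two families. Measuring \<open>H\<close> on the interpolated container, instead of the union of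
  the moving pieces, gives a bound that is exactly additive under cuts.\<close>

definition transports where
  "transports I A \<alpha> J B \<beta> P0 P1 Q0 Q1 \<longleftrightarrow> (\<exists>R. R integrable_on {0..1} \<and>
     (\<Sum>k\<in>I. \<alpha> k * integral (A k) w) - (\<Sum>l\<in>J. \<beta> l * integral (B l) w) \<le> integral {0..1} R \<and>
     (\<forall>t\<in>{0..1}. R t \<le> integral (cbox (interp t P0 Q0) (interp t P1 Q1)) H / p +
        ((1 - t) * (\<Sum>k\<in>I. \<alpha> k powr q * measure lborel (A k)) +
          t * (\<Sum>l\<in>J. \<beta> l powr q * measure lborel (B l))) / q))"

lemma integral_w_split:
  assumes "i \<in> Basis"
  shows "integral (cbox a b) w = integral (cbox a b \<inter> lower_half i c) w + integral (cbox a b \<inter> upper_half i c) w"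
  using assms by (intro integral_split integrable_continuous continuous_on_subset[OF w]) auto

text \<open>The rates of the two halves are added. Masses, q-th moments and integrals of
  \<open>w\<close> split with the families, and the integrals of \<open>H\<close> split because the
  two interpolated half containers fill the interpolated container and meet only in a
  hyperplane.\<close>

lemma transports_cut:
  assumes A: "box_family I A" and B: "box_family J B" and i: "i \<in> Basis"
    and c: "P0 \<bullet> i \<le> c" "c \<le> P1 \<bullet> i" and d: "Q0 \<bullet> i \<le> d" "d \<le> Q1 \<bullet> i"
    and low: "transports (cut_index I A (lower_half i c)) (\<lambda>k. A k \<inter> lower_half i c) \<alpha>
        (cut_index J B (lower_half i d)) (\<lambda>k. B k \<inter> lower_half i d) \<beta>
        P0 (set_coord i c P1) Q0 (set_coord i d Q1)"
    and up: "transports (cut_index I A (upper_half i c)) (\<lambda>k. A k \<inter> upper_half i c) \<alpha>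
        (cut_index J B (upper_half i d)) (\<lambda>k. B k \<inter> upper_half i d) \<beta>
        (set_coord i c P0) P1 (set_coord i d Q0) Q1"
  shows "transports I A \<alpha> J B \<beta> P0 P1 Q0 Q1"
proof -
  have wsplit: "(\<Sum>k\<in>I. \<alpha> k * integral (A k) w) =
    (\<Sum>k\<in>cut_index I A (lower_half i c). \<alpha> k * integral (A k \<inter> lower_half i c) w) +
    (\<Sum>k\<in>cut_index I A (upper_half i c). \<alpha> k * integral (A k \<inter> upper_half i c) w)"
    if "box_family I A" for I :: "'z set" and A \<alpha> c
    by (rule sum_box_family_split[OF that i, of "\<lambda>k S. \<alpha> k * integral S w"])
       (simp add: integral_null, subst integral_w_split[OF i, of _ _ c], simp add: distrib_left)
  obtain R1 where R1: "R1 integrable_on {0..1}"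
    "(\<Sum>k\<in>cut_index I A (lower_half i c). \<alpha> k * integral (A k \<inter> lower_half i c) w) -
     (\<Sum>k\<in>cut_index J B (lower_half i d). \<beta> k * integral (B k \<inter> lower_half i d) w) \<le> integral {0..1} R1"
    "\<And>t. t \<in> {0..1} \<Longrightarrow> R1 t \<le> integral (cbox (interp t P0 Q0) (interp t (set_coord i c P1) (set_coord i d Q1))) H / p +
        ((1 - t) * (\<Sum>k\<in>cut_index I A (lower_half i c). \<alpha> k powr q * measure lborel (A k \<inter> lower_half i c)) +
          t * (\<Sum>k\<in>cut_index J B (lower_half i d). \<beta> k powr q * measure lborel (B k \<inter> lower_half i d))) / q"
    using low unfolding transports_def by auto
  obtain R2 where R2: "R2 integrable_on {0..1}"
    "(\<Sum>k\<in>cut_index I A (upper_half i c). \<alpha> k * integral (A k \<inter> upper_half i c) w) -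
     (\<Sum>k\<in>cut_index J B (upper_half i d). \<beta> k * integral (B k \<inter> upper_half i d) w) \<le> integral {0..1} R2"
    "\<And>t. t \<in> {0..1} \<Longrightarrow> R2 t \<le> integral (cbox (interp t (set_coord i c P0) (set_coord i d Q0)) (interp t P1 Q1)) H / p +
        ((1 - t) * (\<Sum>k\<in>cut_index I A (upper_half i c). \<alpha> k powr q * measure lborel (A k \<inter> upper_half i c)) +
          t * (\<Sum>k\<in>cut_index J B (upper_half i d). \<beta> k powr q * measure lborel (B k \<inter> upper_half i d))) / q"
    using up unfolding transports_def by auto
  have "R1 t + R2 t \<le> integral (cbox (interp t P0 Q0) (interp t P1 Q1)) H / p +
        ((1 - t) * (\<Sum>k\<in>I. \<alpha> k powr q * measure lborel (A k)) +
          t * (\<Sum>l\<in>J. \<beta> l powr q * measure lborel (B l))) / q" if t: "t \<in> {0..1}" for t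
  proof -
    let ?e = "(1 - t) * c + t * d"
    have e1: "?e \<le> interp t P1 Q1 \<bullet> i"
      unfolding interp_inner using t c d by (intro add_mono mult_left_mono) auto
    have e0: "interp t P0 Q0 \<bullet> i \<le> ?e"
      unfolding interp_inner using t c d by (intro add_mono mult_left_mono) auto
    have "integral (cbox (interp t P0 Q0) (interp t P1 Q1)) H =
      integral (cbox (interp t P0 Q0) (interp t (set_coord i c P1) (set_coord i d Q1))) H +
      integral (cbox (interp t (set_coord i c P0) (set_coord i d Q0)) (interp t P1 Q1)) H"
      unfolding interp_set_coord cbox_set_coord(1)[OF i e1] cbox_set_coord(2)[OF i e0]
      by (rule integral_split[OF H_cbox i])
    then show ?thesis
      using R1(3)[OF t] R2(3)[OF t] unfolding box_family_mass_split[OF A i, of _ c] box_family_mass_split[OF B i, of _ d]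
      by (simp add: add_divide_distrib distrib_left)
  qed
  moreover have "(\<Sum>k\<in>I. \<alpha> k * integral (A k) w) - (\<Sum>l\<in>J. \<beta> l * integral (B l) w)
    \<le> integral {0..1} (\<lambda>t. R1 t + R2 t)"
    using R1 R2 unfolding wsplit[OF A, of _ c] wsplit[OF B, of _ d] by (simp add: integral_add)
  ultimately show ?thesis
    unfolding transports_def using integrable_add[OF R1(1) R2(1)] by blast
qed

text \<open>Induction on the total number of boxes. A hyperplane separating two boxes of one family
  makes that family smaller in both halves; the parallel hyperplane through the other family is
  placed so that equal masses face each other, and it cannot increase the number of boxes in either
  half. What remains is one box against one box.\<close>

lemma transports_box_family:
  assumes "box_family I A" "box_family J B"
    and "\<And>k. k \<in> I \<Longrightarrow> 0 < \<alpha> k" "\<And>l. l \<in> J \<Longrightarrow> 0 < \<beta> l"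
    and "\<And>k. k \<in> I \<Longrightarrow> A k \<subseteq> K \<inter> cbox P0 P1" "\<And>l. l \<in> J \<Longrightarrow> B l \<subseteq> K \<inter> cbox Q0 Q1"
    and "(\<Sum>k\<in>I. \<alpha> k * measure lborel (A k)) = (\<Sum>l\<in>J. \<beta> l * measure lborel (B l))"
  shows "transports I A \<alpha> J B \<beta> P0 P1 Q0 Q1"
  using assms
proof (induction "card I + card J" arbitrary: I A J B P0 P1 Q0 Q1 rule: less_induct)
  case less
  note A = less.prems(1) and B = less.prems(2) and \<alpha> = less.prems(3) and \<beta> = less.prems(4)
    and subA = less.prems(5) and subB = less.prems(6) and mass = less.prems(7)
  have fin: "finite I" "finite J" using A B by (auto simp: box_family_def)
  have le: "card (cut_index I A S) \<le> card I" "card (cut_index J B S) \<le> card J" for S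
    using fin by (auto simp: cut_index_def intro!: card_mono)
  have step: ?case
    if i: "i \<in> Basis" and c: "P0 \<bullet> i \<le> c" "c \<le> P1 \<bullet> i" and d: "Q0 \<bullet> i \<le> d" "d \<le> Q1 \<bullet> i"
      and eq: "(\<Sum>k\<in>I. \<alpha> k * measure lborel (A k \<inter> lower_half i c)) =
        (\<Sum>l\<in>J. \<beta> l * measure lborel (B l \<inter> lower_half i d))"
      and lt: "card (cut_index I A (lower_half i c)) + card (cut_index J B (lower_half i d)) < card I + card J"
        "card (cut_index I A (upper_half i c)) + card (cut_index J B (upper_half i d)) < card I + card J"
    for i c d
  proof (rule transports_cut[OF A B i c d])
    have eqL: "(\<Sum>k\<in>cut_index I A (lower_half i c). \<alpha> k * measure lborel (A k \<inter> lower_half i c)) =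
      (\<Sum>k\<in>cut_index J B (lower_half i d). \<beta> k * measure lborel (B k \<inter> lower_half i d))"
      using eq sum_cut_index[OF A i, of "lower_half i c" c "\<lambda>k S. \<alpha> k * measure lborel S"]
        sum_cut_index[OF B i, of "lower_half i d" d "\<lambda>k S. \<beta> k * measure lborel S"] by simp
    then have eqU: "(\<Sum>k\<in>cut_index I A (upper_half i c). \<alpha> k * measure lborel (A k \<inter> upper_half i c)) =
      (\<Sum>k\<in>cut_index J B (upper_half i d). \<beta> k * measure lborel (B k \<inter> upper_half i d))"
      using mass box_family_mass_split[OF A i, of \<alpha> c] box_family_mass_split[OF B i, of \<beta> d] by simp
    show "transports (cut_index I A (lower_half i c)) (\<lambda>k. A k \<inter> lower_half i c) \<alpha>
        (cut_index J B (lower_half i d)) (\<lambda>k. B k \<inter> lower_half i d) \<beta>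
        P0 (set_coord i c P1) Q0 (set_coord i d Q1)"
    proof (intro less.hyps lt(1) box_family_cut[OF A i] box_family_cut[OF B i] eqL disjI1 refl)
      show "A k \<inter> lower_half i c \<subseteq> K \<inter> cbox P0 (set_coord i c P1)" if "k \<in> cut_index I A (lower_half i c)" for k
        using subA[of k] that unfolding cbox_set_coord(1)[OF i c(2)] cut_index_def by blast
      show "B l \<inter> lower_half i d \<subseteq> K \<inter> cbox Q0 (set_coord i d Q1)" if "l \<in> cut_index J B (lower_half i d)" for l
        using subB[of l] that unfolding cbox_set_coord(1)[OF i d(2)] cut_index_def by blast
    qed (use \<alpha> \<beta> in \<open>auto simp: cut_index_def\<close>)
    show "transports (cut_index I A (upper_half i c)) (\<lambda>k. A k \<inter> upper_half i c) \<alpha>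
        (cut_index J B (upper_half i d)) (\<lambda>k. B k \<inter> upper_half i d) \<beta>
        (set_coord i c P0) P1 (set_coord i d Q0) Q1"
    proof (intro less.hyps lt(2) box_family_cut[OF A i] box_family_cut[OF B i] eqU disjI2 refl)
      show "A k \<inter> upper_half i c \<subseteq> K \<inter> cbox (set_coord i c P0) P1" if "k \<in> cut_index I A (upper_half i c)" for k
        using subA[of k] that unfolding cbox_set_coord(2)[OF i c(1)] cut_index_def by blast
      show "B l \<inter> upper_half i d \<subseteq> K \<inter> cbox (set_coord i d Q0) Q1" if "l \<in> cut_index J B (upper_half i d)" for l
        using subB[of l] that unfolding cbox_set_coord(2)[OF i d(1)] cut_index_def by blast
    qed (use \<alpha> \<beta> in \<open>auto simp: cut_index_def\<close>)
  qed
  have subA': "\<And>k. k \<in> I \<Longrightarrow> A k \<subseteq> cbox P0 P1" and subB': "\<And>l. l \<in> J \<Longrightarrow> B l \<subseteq> cbox Q0 Q1"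
    using subA subB by auto
  \<comment> \<open>Positive densities on boxes of positive volume have positive mass, so a nonempty
    family cannot face an empty one.\<close>
  have ne: "I = {} \<longleftrightarrow> J = {}"
  proof -
    have posI: "I \<noteq> {} \<Longrightarrow> 0 < (\<Sum>k\<in>I. \<alpha> k * measure lborel (A k))"
      using A \<alpha> fin by (intro sum_pos) (auto simp: box_family_def)
    have posJ: "J \<noteq> {} \<Longrightarrow> 0 < (\<Sum>k\<in>J. \<beta> k * measure lborel (B k))"
      using B \<beta> fin by (intro sum_pos) (auto simp: box_family_def)
    show ?thesis
      using posI posJ mass by (metis less_irrefl sum.empty)
  qed
  have part: "0 \<le> (\<Sum>k\<in>I. \<gamma> k * measure lborel (A k \<inter> lower_half i c)) \<and>
     (\<Sum>k\<in>I. \<gamma> k * measure lborel (A k \<inter> lower_half i c)) \<le> (\<Sum>k\<in>I. \<gamma> k * measure lborel (A k))"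
    if "box_family I A" "\<And>k. k \<in> I \<Longrightarrow> 0 < \<gamma> k" "i \<in> Basis" for I :: "'z set" and A \<gamma> i c
  proof
    show "0 \<le> (\<Sum>k\<in>I. \<gamma> k * measure lborel (A k \<inter> lower_half i c))"
      using that by (intro sum_nonneg mult_nonneg_nonneg) (auto simp: less_imp_le)
    have "measure lborel (A k \<inter> lower_half i c) \<le> measure lborel (A k)" if "k \<in> I" for k
    proof -
      obtain a b where "A k = cbox a b" using \<open>box_family I A\<close> \<open>k \<in> I\<close> by (auto simp: box_family_def)
      then show ?thesis using content_split[OF \<open>i \<in> Basis\<close>, of a b c] by simp
    qed
    then show "(\<Sum>k\<in>I. \<gamma> k * measure lborel (A k \<inter> lower_half i c)) \<le> (\<Sum>k\<in>I. \<gamma> k * measure lborel (A k))"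
      using that by (intro sum_mono mult_left_mono) (auto simp: less_imp_le)
  qed
  consider "I = {}" "J = {}" | "2 \<le> card I" "J \<noteq> {}" | "2 \<le> card J" "I \<noteq> {}" | "card I = 1" "card J = 1"
  proof -
    have "card I = 0 \<or> card I = 1 \<or> 2 \<le> card I" "card J = 0 \<or> card J = 1 \<or> 2 \<le> card J" by auto
    then show thesis using that ne fin by fastforce
  qed
  then show ?case
  proof cases
    case 1
    then show ?thesis
      unfolding transports_def using H pq
      by (intro exI[of _ "\<lambda>_. 0"]) (auto intro!: divide_nonneg_nonneg integral_nonneg H_cbox)
  next
    case 2
    obtain i c where ic: "i \<in> Basis" "P0 \<bullet> i \<le> c" "c \<le> P1 \<bullet> i"
      "card (cut_index I A (lower_half i c)) < card I" "card (cut_index I A (upper_half i c)) < card I"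
      using obtain_separation[OF A 2(1) subA'] by blast
    obtain d where d: "Q0 \<bullet> i \<le> d" "d \<le> Q1 \<bullet> i"
      "(\<Sum>l\<in>J. \<beta> l * measure lborel (B l \<inter> lower_half i d)) = (\<Sum>k\<in>I. \<alpha> k * measure lborel (A k \<inter> lower_half i c))"
    proof (rule obtain_mass_cut[OF B ic(1) subB' 2(2)])
      show "0 \<le> (\<Sum>k\<in>I. \<alpha> k * measure lborel (A k \<inter> lower_half i c))"
        "(\<Sum>k\<in>I. \<alpha> k * measure lborel (A k \<inter> lower_half i c)) \<le> (\<Sum>l\<in>J. \<beta> l * measure lborel (B l))"
        unfolding mass[symmetric] using part[of I A \<alpha> i c] A \<alpha> ic(1) by auto
    qed
    show ?thesis
      using step[OF ic(1-3) d(1,2) d(3)[symmetric]] ic(4,5) le by (meson add_less_le_mono)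
  next
    case 3
    obtain i d where id: "i \<in> Basis" "Q0 \<bullet> i \<le> d" "d \<le> Q1 \<bullet> i"
      "card (cut_index J B (lower_half i d)) < card J" "card (cut_index J B (upper_half i d)) < card J"
      using obtain_separation[OF B 3(1) subB'] by blast
    obtain c where c: "P0 \<bullet> i \<le> c" "c \<le> P1 \<bullet> i"
      "(\<Sum>k\<in>I. \<alpha> k * measure lborel (A k \<inter> lower_half i c)) = (\<Sum>l\<in>J. \<beta> l * measure lborel (B l \<inter> lower_half i d))"
    proof (rule obtain_mass_cut[OF A id(1) subA' 3(2)])
      show "0 \<le> (\<Sum>l\<in>J. \<beta> l * measure lborel (B l \<inter> lower_half i d))"
        "(\<Sum>l\<in>J. \<beta> l * measure lborel (B l \<inter> lower_half i d)) \<le> (\<Sum>k\<in>I. \<alpha> k * measure lborel (A k))"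
        unfolding mass using part[of J B \<beta> i d] B \<beta> id(1) by auto
    qed
    show ?thesis
      using step[OF id(1) c(1,2) id(2,3) c(3)] id(4,5) le by (meson add_le_less_mono)
  next
    case 4
    then obtain k l where kl: "I = {k}" "J = {l}" by (auto simp: card_1_singleton_iff)
    then have kl': "k \<in> I" "l \<in> J" by auto
    obtain a b where ab: "A k = cbox a b" "\<forall>j\<in>Basis. a \<bullet> j < b \<bullet> j"
      using box_family_cboxE[OF A kl'(1)] by blast
    obtain c d where cd: "B l = cbox c d" "\<forall>j\<in>Basis. c \<bullet> j < d \<bullet> j"
      using box_family_cboxE[OF B kl'(2)] by blast
    have mem: "a \<in> cbox P0 P1" "b \<in> cbox P0 P1" "c \<in> cbox Q0 Q1" "d \<in> cbox Q0 Q1"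
      using subA'[OF kl'(1)] subB'[OF kl'(2)] ab cd by (auto simp: subset_eq mem_box less_imp_le)
    obtain R where R: "R integrable_on {0..1}"
      "\<alpha> k * integral (cbox a b) w - \<beta> l * integral (cbox c d) w \<le> integral {0..1} R"
      "\<And>t. t \<in> {0..1} \<Longrightarrow> R t \<le> integral (cbox (interp t a c) (interp t b d)) H / p +
        ((1 - t) * (\<alpha> k powr q * measure lborel (cbox a b)) + t * (\<beta> l powr q * measure lborel (cbox c d))) / q"
    proof -
      have "cbox a b \<subseteq> K" "cbox c d \<subseteq> K"
        using subA[OF kl'(1)] subB[OF kl'(2)] ab(1) cd(1) by auto
      moreover have "\<alpha> k * measure lborel (cbox a b) = \<beta> l * measure lborel (cbox c d)"
        using mass by (simp add: kl ab(1) cd(1))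
      ultimately show thesis
        using transport_box[OF bspec[OF ab(2)] bspec[OF cd(2)], of "\<alpha> k" "\<beta> l"] \<alpha>[OF kl'(1)] \<beta>[OF kl'(2)] that by blast
    qed
    \<comment> \<open>The boxes may be smaller than their containers; since \<open>H\<close> is
      nonnegative, enlarging the domain keeps the bound.\<close>
    have "integral (cbox (interp t a c) (interp t b d)) H / p \<le>
      integral (cbox (interp t P0 Q0) (interp t P1 Q1)) H / p" if "t \<in> {0..1}" for t
    proof -
      have "cbox (interp t a c) (interp t b d) \<subseteq> cbox (interp t P0 Q0) (interp t P1 Q1)"
        using mem that unfolding subset_box interp_inner
        by (auto simp: mem_box intro!: add_mono mult_left_mono)
      then show ?thesis
        using H pq by (intro divide_right_mono integral_subset_le H_cbox) auto
    qed
    then have "\<forall>t\<in>{0..1}. R t \<le> integral (cbox (interp t P0 Q0) (interp t P1 Q1)) H / p +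
        ((1 - t) * (\<alpha> k powr q * measure lborel (cbox a b)) + t * (\<beta> l powr q * measure lborel (cbox c d))) / q"
      using R(3) by (meson add_right_mono order_trans)
    then show ?thesis
      unfolding transports_def kl using R(1,2) ab(1) cd(1) by auto
  qed
qed

text \<open>Integrating the rate over time, the weights \<open>1 - t\<close> and \<open>t\<close>
  both contribute 1/2, whence the denominator \<open>2 * q\<close>; the integral of \<open>H\<close>
  over any intermediate container is at most that over the whole space.\<close>

lemma transport_inequality:
  assumes A: "box_family I A" and B: "box_family J B"
    and pos: "\<And>k. k \<in> I \<Longrightarrow> 0 < \<alpha> k" "\<And>l. l \<in> J \<Longrightarrow> 0 < \<beta> l"
    and sub: "\<And>k. k \<in> I \<Longrightarrow> A k \<subseteq> K" "\<And>l. l \<in> J \<Longrightarrow> B l \<subseteq> K"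
    and mass: "(\<Sum>k\<in>I. \<alpha> k * measure lborel (A k)) = (\<Sum>l\<in>J. \<beta> l * measure lborel (B l))"
  shows "(\<Sum>k\<in>I. \<alpha> k * integral (A k) w) - (\<Sum>l\<in>J. \<beta> l * integral (B l) w) \<le>
    integral UNIV H / p +
    ((\<Sum>k\<in>I. \<alpha> k powr q * measure lborel (A k)) + (\<Sum>l\<in>J. \<beta> l powr q * measure lborel (B l))) / (2 * q)"
proof -
  have bdd: "bounded (\<Union>k\<in>I. A k)" if "box_family I A" for I :: "'z set" and A :: "'z \<Rightarrow> 'a set"
    using that by (intro bounded_Union) (auto simp: box_family_def)
  obtain P where P: "(\<Union>k\<in>I. A k) \<subseteq> cbox (- P) P"
    using bounded_subset_cbox_symmetric[OF bdd[OF A]] by auto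
  obtain Q where Q: "(\<Union>k\<in>J. B k) \<subseteq> cbox (- Q) Q"
    using bounded_subset_cbox_symmetric[OF bdd[OF B]] by auto
  define SA where "SA = (\<Sum>k\<in>I. \<alpha> k powr q * measure lborel (A k))"
  define SB where "SB = (\<Sum>l\<in>J. \<beta> l powr q * measure lborel (B l))"
  have "transports I A \<alpha> J B \<beta> (- P) P (- Q) Q"
    using P Q sub by (intro transports_box_family A B pos mass) auto
  then obtain R where R: "R integrable_on {0..1}"
     "(\<Sum>k\<in>I. \<alpha> k * integral (A k) w) - (\<Sum>l\<in>J. \<beta> l * integral (B l) w) \<le> integral {0..1} R"
     "\<And>t. t \<in> {0..1} \<Longrightarrow> R t \<le> integral (cbox (interp t (- P) (- Q)) (interp t P Q)) H / p +
        ((1 - t) * SA + t * SB) / q"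
    unfolding transports_def SA_def SB_def by blast
  note R(2)
  also have "integral {0..1} R \<le> integral {0..1} (\<lambda>t. integral UNIV H / p + ((1 - t) * SA + t * SB) / q)"
  proof (intro integral_le R(1))
    show "(\<lambda>t. integral UNIV H / p + ((1 - t) * SA + t * SB) / q) integrable_on {0..1}"
      using pq by (intro integrable_continuous_interval continuous_intros) auto
    fix t :: real assume t: "t \<in> {0..1}"
    have "integral (cbox (interp t (- P) (- Q)) (interp t P Q)) H / p \<le> integral UNIV H / p"
      using H pq by (intro divide_right_mono integral_subset_le H_cbox) auto
    then show "R t \<le> integral UNIV H / p + ((1 - t) * SA + t * SB) / q"
      using R(3)[OF t] by simp
  qed
  also have "\<dots> = integral UNIV H / p + (SA + SB) / (2 * q)"
  proof -
    let ?F = "\<lambda>t. t * (integral UNIV H / p) + ((t - t\<^sup>2 / 2) * SA + t\<^sup>2 / 2 * SB) / q"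
    have "((\<lambda>t. integral UNIV H / p + ((1 - t) * SA + t * SB) / q) has_integral ?F 1 - ?F 0) {0..1}"
      using pq by (intro fundamental_theorem_of_calculus)
        (auto intro!: derivative_eq_intros simp flip: has_real_derivative_iff_has_vector_derivative)
    then show ?thesis
      by (simp add: integral_unique field_simps)
  qed
  finally show ?thesis by (simp add: SA_def SB_def)
qed

end

section \<open>Mollified Sobolev functions\<close>

lemma integrable_prod_bound:
  fixes f :: "'a::euclidean_space \<Rightarrow> real" and g :: "'b::euclidean_space \<Rightarrow> real"
    and F :: "'a \<times> 'b \<Rightarrow> real"
  assumes f: "integrable lborel f" and g: "integrable lborel g"
    and F: "F \<in> borel_measurable (lborel \<Otimes>\<^sub>M lborel)" and le: "\<And>x y. \<bar>F (x, y)\<bar> \<le> \<bar>f x * g y\<bar>"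
  shows "integrable (lborel \<Otimes>\<^sub>M lborel) F"
proof (rule Bochner_Integration.integrable_bound[OF _ F])
  have [measurable]: "f \<in> borel_measurable lborel" "g \<in> borel_measurable lborel"
    using f g by auto
  have "integrable lborel (\<lambda>x. \<bar>f x\<bar> * (LINT y|lborel. \<bar>g y\<bar>))"
    using f by auto
  then have "integrable lborel (\<lambda>x. LINT y|lborel. norm (f x * g y))"
    by (simp add: abs_mult)
  then show "integrable (lborel \<Otimes>\<^sub>M lborel) (\<lambda>(x, y). f x * g y)"
    using g by (intro lborel_pair.Fubini_integrable) (auto simp: case_prod_unfold)
  show "AE z in lborel \<Otimes>\<^sub>M lborel. norm (F z) \<le> norm ((\<lambda>(x, y). f x * g y) z)"
    using le by auto
qed

text \<open>Jensen's inequality for the probability density \<open>e\<close>. With \<open>c\<close>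
  the mean of the norm and \<open>m\<close> the right-hand side, Young's inequality against the
  constant \<open>c powr (p - 1)\<close> gives \<open>c powr p \<le> m / p + c powr p / q\<close>,
  and \<open>1 - 1 / q = 1 / p\<close>.\<close>

lemma norm_integral_scaleR_powr_le:
  fixes G :: "'a \<Rightarrow> 'b::euclidean_space"
  assumes pq: "1 < p" "1 < q" "1 / p + 1 / q = 1"
    and e: "integrable M e" "\<And>z. 0 \<le> e z" "(LINT z|M. e z) = 1"
    and G1: "integrable M (\<lambda>z. e z *\<^sub>R G z)" and Gp: "integrable M (\<lambda>z. e z * norm (G z) powr p)"
  shows "norm (LINT z|M. e z *\<^sub>R G z) powr p \<le> (LINT z|M. e z * norm (G z) powr p)"
proof -
  define c where "c = (LINT z|M. e z * norm (G z))"
  have G1n: "integrable M (\<lambda>z. e z * norm (G z))"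
    using integrable_norm[OF G1] e(2) by simp
  have c0: "c \<ge> 0" unfolding c_def using e(2) by simp
  have pq': "(p - 1) * q = p" using pq by (simp add: field_simps)
  have "norm (LINT z|M. e z *\<^sub>R G z) \<le> c"
    unfolding c_def using integral_norm_bound[of M "\<lambda>z. e z *\<^sub>R G z"] e(2) by simp
  then have "norm (LINT z|M. e z *\<^sub>R G z) powr p \<le> c powr p"
    using pq by (intro powr_mono2) auto
  also have "c powr p \<le> (LINT z|M. e z * norm (G z) powr p)"
  proof -
    have "c * c powr (p - 1) = (LINT z|M. e z * norm (G z) * c powr (p - 1))"
      unfolding c_def by simp
    also have "\<dots> \<le> (LINT z|M. e z * norm (G z) powr p / p + e z * (c powr p / q))"
    proof (rule integral_mono)
      show "integrable M (\<lambda>z. e z * norm (G z) * c powr (p - 1))" using G1n by auto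
      show "integrable M (\<lambda>z. e z * norm (G z) powr p / p + e z * (c powr p / q))" using Gp e by auto
      fix z
      have "norm (G z) * c powr (p - 1) \<le> norm (G z) powr p / p + (c powr (p - 1)) powr q / q"
        using pq by (intro Youngs_inequality) auto
      from mult_left_mono[OF this e(2)[of z]]
      show "e z * norm (G z) * c powr (p - 1) \<le> e z * norm (G z) powr p / p + e z * (c powr p / q)"
        by (simp add: powr_powr pq' distrib_left mult.assoc)
    qed
    also have "\<dots> = (LINT z|M. e z * norm (G z) powr p) / p + c powr p / q"
      using Gp e by simp
    finally have "c * c powr (p - 1) - c powr p / q \<le> (LINT z|M. e z * norm (G z) powr p) / p"
      by simp
    moreover have "c * c powr (p - 1) = c powr p"
      using c0 by (cases "c = 0") (auto simp: powr_diff)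
    moreover have "c powr p - c powr p / q = c powr p / p"
    proof -
      have "1 / p = 1 - 1 / q" using pq by simp
      then have "c powr p * (1 / p) = c powr p * (1 - 1 / q)" by simp
      then show ?thesis by (simp add: right_diff_distrib)
    qed
    ultimately show ?thesis using pq by (simp add: divide_le_cancel)
  qed
  finally show ?thesis .
qed

lemma continuous_on_convolution:
  fixes u :: "'a::euclidean_space \<Rightarrow> 'b::euclidean_space" and e :: "'a \<Rightarrow> real"
  assumes u: "integrable lborel u" and e: "continuous_on UNIV e" "\<And>y. \<bar>e y\<bar> \<le> C"
  shows "continuous_on UNIV (\<lambda>x. LINT z|lborel. e (x - z) *\<^sub>R u z)"
    and "integrable lborel (\<lambda>z. e (x - z) *\<^sub>R u z)"
proof -
  have [measurable]: "e \<in> borel_measurable borel" "u \<in> borel_measurable borel"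
    using e(1) u by (auto simp: borel_measurable_continuous_onI)
  have bnd: "norm (e (x - z) *\<^sub>R u z) \<le> norm (C * norm (u z))" for x z
    using e(2)[of "x - z"] by (simp add: abs_mult mult_right_mono)
  have C: "integrable lborel (\<lambda>z. C * norm (u z))" using u by simp
  show "integrable lborel (\<lambda>z. e (x - z) *\<^sub>R u z)" for x
    by (rule Bochner_Integration.integrable_bound[OF C]) (use bnd in auto)
  show "continuous_on UNIV (\<lambda>x. LINT z|lborel. e (x - z) *\<^sub>R u z)"
  proof (rule continuous_on_sequentiallyI)
    fix X x assume X: "X \<longlonglongrightarrow> (x::'a)"
    show "(\<lambda>n. LINT z|lborel. e (X n - z) *\<^sub>R u z) \<longlonglongrightarrow> (LINT z|lborel. e (x - z) *\<^sub>R u z)"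
    proof (rule integral_dominated_convergence[where w = "\<lambda>z. C * norm (u z)"])
      have "isCont e y" for y using e(1) by (simp add: continuous_on_eq_continuous_at)
      then have "(\<lambda>n. e (X n - z) *\<^sub>R u z) \<longlonglongrightarrow> e (x - z) *\<^sub>R u z" for z
        by (intro tendsto_intros isCont_tendsto_compose[where g = e] X) auto
      then show "AE z in lborel. (\<lambda>n. e (X n - z) *\<^sub>R u z) \<longlonglongrightarrow> e (x - z) *\<^sub>R u z" by simp
      show "AE z in lborel. norm (e (X n - z) *\<^sub>R u z) \<le> C * norm (u z)" for n
        using bnd[of "X n"] e(2)[of "X n - _"] by (simp add: mult_right_mono)
    qed (use C in auto)
  qed
qed

text \<open>Fubini moves the mollifier from \<open>v\<close> onto the indicator of \<open>S\<close>.
  It serves for boxes with \<open>v = u\<close> and for the compact set \<open>K\<close> with the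
  p-th power of the gradient.\<close>

lemma integral_indicator_convolution:
  fixes e v :: "'a::euclidean_space \<Rightarrow> real"
  assumes v: "integrable lborel v" and e: "continuous_on UNIV e" "\<And>y. \<bar>e y\<bar> \<le> C"
    and S: "S \<in> sets borel" "emeasure lborel S < \<infinity>"
  shows "(LINT x|lborel. indicator S x * (LINT z|lborel. e (x - z) * v z)) =
    (LINT z|lborel. (LINT x|lborel. indicator S x * e (x - z)) * v z)"
    and "integrable lborel (\<lambda>x. indicator S x * (LINT z|lborel. e (x - z) * v z))"
    and "integrable lborel (\<lambda>z. (LINT x|lborel. indicator S x * e (x - z)) * v z)"
proof -
  have [measurable]: "e \<in> borel_measurable borel" "v \<in> borel_measurable borel" "S \<in> sets borel"
    using e(1) v S by (auto simp: borel_measurable_continuous_onI)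
  let ?F = "\<lambda>x z. indicator S x * e (x - z) * v z"
  have int: "integrable (lborel \<Otimes>\<^sub>M lborel) (\<lambda>(x, z). ?F x z)"
  proof (rule integrable_prod_bound)
    show "integrable lborel (\<lambda>x. C * indicator S x)"
      using S by auto
    show "integrable lborel v" by (rule v)
    show "(\<lambda>(x, z). ?F x z) \<in> borel_measurable (lborel \<Otimes>\<^sub>M lborel)" by measurable
    show "\<bar>(\<lambda>(x, z). ?F x z) (x, z)\<bar> \<le> \<bar>C * indicator S x * v z\<bar>" for x z
      using e(2)[of "x - z"] by (auto simp: abs_mult indicator_def intro!: mult_right_mono)
  qed
  have e1: "(LINT z|lborel. ?F x z) = indicator S x * (LINT z|lborel. e (x - z) * v z)" for x
    by (simp add: mult.assoc)
  have e2: "(LINT x|lborel. ?F x z) = (LINT x|lborel. indicator S x * e (x - z)) * v z" for z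
    by simp
  show "(LINT x|lborel. indicator S x * (LINT z|lborel. e (x - z) * v z)) =
    (LINT z|lborel. (LINT x|lborel. indicator S x * e (x - z)) * v z)"
    using lborel_pair.Fubini_integral[OF int] by (simp add: e1 e2)
  show "integrable lborel (\<lambda>x. indicator S x * (LINT z|lborel. e (x - z) * v z))"
    using lborel_pair.integrable_fst'[OF int] by (simp add: e1)
  show "integrable lborel (\<lambda>z. (LINT x|lborel. indicator S x * e (x - z)) * v z)"
    using lborel_pair.integrable_fst'[OF lborel_pair.integrable_product_swap[OF int]]
    by (simp add: e2)
qed

lemma integral_reflect_translate:
  fixes e :: "'a::euclidean_space \<Rightarrow> real"
  assumes [measurable]: "e \<in> borel_measurable borel" and c: "\<bar>c\<bar> = 1"
  shows "(LINT z|lborel. e (x + c *\<^sub>R z)) = (LINT y|lborel. e y)"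
proof -
  have "c \<noteq> 0" using c by auto
  from lborel_affine[OF this, of x]
  have "(LINT y|lborel. e y) = (LINT y|density (distr lborel borel (\<lambda>z. x + c *\<^sub>R z)) (\<lambda>_. 1). e y)"
    using c by simp
  also have "\<dots> = (LINT z|lborel. e (x + c *\<^sub>R z))"
    by (simp add: density_1 integral_distr)
  finally show ?thesis ..
qed

lemma bounded_of_continuous_zero_outside:
  fixes f :: "'a::euclidean_space \<Rightarrow> real"
  assumes cont: "continuous_on UNIV f" and zero: "\<And>y. r < norm y \<Longrightarrow> f y = 0"
  shows "\<exists>C. \<forall>y. \<bar>f y\<bar> \<le> C"
proof -
  have "compact (f ` cball 0 r)"
    by (intro compact_continuous_image continuous_on_subset[OF cont]) auto
  then have "bounded (f ` cball 0 r)" by (rule compact_imp_bounded)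
  then obtain C where C: "\<And>y. y \<in> cball 0 r \<Longrightarrow> \<bar>f y\<bar> \<le> C"
    unfolding bounded_iff by (metis imageI real_norm_def)
  have "\<bar>f y\<bar> \<le> max C 0" for y
    using C[of y] zero[of y] by (cases "norm y \<le> r") auto
  then show ?thesis by blast
qed

lemma frechet_derivative_bounded:
  fixes e :: "'a::euclidean_space \<Rightarrow> real"
  assumes C1: "C_k 1 e" and supp: "\<And>y. r \<le> norm y \<Longrightarrow> e y = 0" and i: "i \<in> Basis"
  shows "\<exists>C. \<forall>y. \<bar>frechet_derivative e (at y) i\<bar> \<le> C"
proof -
  let ?d = "\<lambda>y. frechet_derivative e (at y) i"
  have d0: "?d y = 0" if "norm y > r" for y
  proof -
    have "(e has_derivative (\<lambda>_. 0)) (at y)"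
    proof (rule has_derivative_transform_within_open[of "\<lambda>_. 0" _ _ _ "- cball 0 r"])
      show "0 = e x" if "x \<in> - cball 0 r" for x using that supp[of x] by auto
    qed (use that in auto)
    then show ?thesis by (rule frechet_derivative_eqI)
  qed
  show ?thesis
    by (rule bounded_of_continuous_zero_outside[OF _ d0]) (use C1 i in auto)
qed

lemma integral_indicator_mollifier:
  fixes e :: "'a::euclidean_space \<Rightarrow> real"
  assumes e: "continuous_on UNIV e" "\<And>y. 0 \<le> e y" "(LINT y|lborel. e y) = 1" and S: "S \<in> sets borel"
  shows "(LINT x|lborel. indicator S x * e (x - z)) \<in> {0..1}"
    and "(\<And>x. e (x - z) \<noteq> 0 \<Longrightarrow> x \<in> S) \<Longrightarrow> (LINT x|lborel. indicator S x * e (x - z)) = 1"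
    and "(\<And>x. e (x - z) \<noteq> 0 \<Longrightarrow> x \<notin> S) \<Longrightarrow> (LINT x|lborel. indicator S x * e (x - z)) = 0"
proof -
  have [measurable]: "e \<in> borel_measurable borel" "S \<in> sets borel"
    using e(1) S by (auto simp: borel_measurable_continuous_onI)
  have 1: "(LINT x|lborel. e (x - z)) = 1"
    using integral_reflect_translate[of e 1 "- z"] e(3) by simp
  \<comment> \<open>A Bochner integral that does not exist has the value 0, so the value 1 already
    implies integrability.\<close>
  then have 2: "integrable lborel (\<lambda>x. e (x - z))"
    using not_integrable_integral_eq by fastforce
  have "(LINT x|lborel. indicator S x * e (x - z)) \<le> (LINT x|lborel. e (x - z))"
    using e(2) by (intro integral_mono Bochner_Integration.integrable_bound[OF 2] 2) (auto simp: indicator_def)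
  then show "(LINT x|lborel. indicator S x * e (x - z)) \<in> {0..1}"
    using 1 by (auto intro!: Bochner_Integration.integral_nonneg mult_nonneg_nonneg e(2))
  show "(LINT x|lborel. indicator S x * e (x - z)) = 1" if "\<And>x. e (x - z) \<noteq> 0 \<Longrightarrow> x \<in> S"
  proof -
    have "indicator S x * e (x - z) = e (x - z)" for x
      using that[of x] by (auto simp: indicator_def)
    then show ?thesis using 1 by (simp only:)
  qed
  show "(LINT x|lborel. indicator S x * e (x - z)) = 0" if "\<And>x. e (x - z) \<noteq> 0 \<Longrightarrow> x \<notin> S"
  proof -
    have "indicator S x * e (x - z) = 0" for x
      using that[of x] by (auto simp: indicator_def)
    then show ?thesis by (simp only: Bochner_Integration.integral_zero)
  qed
qed

lemma AE_lborel_box_or_not_cbox: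
  "AE z in lborel. z \<in> box a b \<or> z \<notin> cbox a (b::'a::euclidean_space)"
proof -
  have "cbox a b - box a b \<in> null_sets lborel"
    using negligible_frontier_interval[of a b]
    unfolding negligible_iff_null_sets by (subst (asm) null_sets_completion_iff) auto
  then show ?thesis
    by (rule AE_I') auto
qed

text \<open>After Fubini the box is mollified instead of \<open>u\<close>. Its mollified indicator
  has values between 0 and 1 and converges off the frontier of the box, so dominated convergence
  with majorant \<open>\<bar>u\<bar>\<close> is enough.\<close>

lemma integral_cbox_mollified_tendsto:
  fixes e :: "nat \<Rightarrow> 'a::euclidean_space \<Rightarrow> real"
  assumes u: "integrable lborel u" and e: "\<And>n. continuous_on UNIV (e n)" "\<And>n y. 0 \<le> e n y"
      "\<And>n. (LINT y|lborel. e n y) = 1" "\<And>n y. r n \<le> norm y \<Longrightarrow> e n y = 0"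
    and bnd: "\<And>n y. \<bar>e n y\<bar> \<le> C n" and r: "r \<longlonglongrightarrow> 0"
  shows "(\<lambda>n. integral (cbox a b) (\<lambda>x. LINT z|lborel. e n (x - z) * u z))
    \<longlonglongrightarrow> (LINT x|lborel. indicator (cbox a b) x * u x)"
proof -
  let ?A = "cbox a b"
  let ?c = "\<lambda>n z. LINT x|lborel. indicator ?A x * e n (x - z)"
  have [measurable]: "u \<in> borel_measurable lborel" using u by auto
  have A: "?A \<in> sets borel" "emeasure lborel ?A < \<infinity>"
    using emeasure_bounded_finite[of ?A] by auto
  have eq: "integral ?A (\<lambda>x. LINT z|lborel. e n (x - z) * u z) = (LINT z|lborel. ?c n z * u z)" for n
  proof -
    have "continuous_on UNIV (\<lambda>x. LINT z|lborel. e n (x - z) * u z)"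
      using continuous_on_convolution(1)[OF u e(1)[of n] bnd[of n]] by simp
    then have "continuous_on ?A (\<lambda>x. LINT z|lborel. e n (x - z) * u z)"
      by (rule continuous_on_subset) auto
    then have "set_integrable lborel ?A (\<lambda>x. LINT z|lborel. e n (x - z) * u z)"
      unfolding set_integrable_def by (intro borel_integrable_compact) auto
    from set_borel_integral_eq_integral(2)[OF this]
    show ?thesis
      using integral_indicator_convolution(1)[OF u e(1)[of n] bnd[of n] A] by (simp add: set_lebesgue_integral_def)
  qed
  show ?thesis unfolding eq
  proof (rule integral_dominated_convergence[where w = "\<lambda>z. \<bar>u z\<bar>"])
    show "integrable lborel (\<lambda>z. \<bar>u z\<bar>)" using u by auto
    show "(\<lambda>x. indicator ?A x * u x) \<in> borel_measurable lborel" by measurable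
    show "(\<lambda>z. ?c n z * u z) \<in> borel_measurable lborel" for n
      using integral_indicator_convolution(3)[OF u e(1)[of n] bnd[of n] A] by auto
    show "AE z in lborel. norm (?c n z * u z) \<le> \<bar>u z\<bar>" for n
    proof (intro always_eventually allI)
      fix z
      have "?c n z \<in> {0..1}" by (rule integral_indicator_mollifier(1)[OF e(1,2,3) A(1)])
      then show "norm (?c n z * u z) \<le> \<bar>u z\<bar>"
        by (auto simp: abs_mult intro!: mult_left_le_one_le)
    qed
    show "AE z in lborel. (\<lambda>n. ?c n z * u z) \<longlonglongrightarrow> indicator ?A z * u z"
      using AE_lborel_box_or_not_cbox[of a b]
    proof (rule eventually_mono)
      fix z assume z: "z \<in> box a b \<or> z \<notin> ?A"
      \<comment> \<open>Off the frontier, a ball around \<open>z\<close> lies entirely inside or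
        entirely outside the box; once \<open>r n < d\<close>, the mollified indicator at
        \<open>z\<close> is exactly 1 or 0.\<close>
      have "\<exists>d>0. ball z d \<subseteq> (if z \<in> box a b then ?A else - ?A)"
        using z open_contains_ball[of "box a b"] open_contains_ball[of "- ?A"] box_subset_cbox[of a b]
        by (auto simp: open_Compl) (meson order_trans)
      then obtain d where d: "0 < d" "ball z d \<subseteq> (if z \<in> box a b then ?A else - ?A)" by auto
      have "\<forall>\<^sub>F n in sequentially. r n < d"
        using r d(1) by (rule order_tendstoD)
      then have "\<forall>\<^sub>F n in sequentially. indicator ?A z = ?c n z"
      proof (rule eventually_mono)
        fix n assume n: "r n < d"
        have x: "x \<in> (if z \<in> box a b then ?A else - ?A)" if "e n (x - z) \<noteq> 0" for x
          using e(4)[of n "x - z"] that n d(2) by (force simp: dist_norm norm_minus_commute)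
        show "indicator ?A z = ?c n z"
        proof (cases "z \<in> box a b")
          case True
          then have "?c n z = 1"
            using x by (intro integral_indicator_mollifier(2)[OF e(1,2,3) A(1)]) auto
          then show ?thesis using True box_subset_cbox[of a b] by (auto simp: indicator_def)
        next
          case False
          then have "?c n z = 0"
            using x by (intro integral_indicator_mollifier(3)[OF e(1,2,3) A(1)]) auto
          then show ?thesis using False z by (auto simp: indicator_def)
        qed
      qed
      then have "(\<lambda>n. ?c n z) \<longlonglongrightarrow> indicator ?A z"
        by (rule Lim_transform_eventually[OF tendsto_const])
      then show "(\<lambda>n. ?c n z * u z) \<longlonglongrightarrow> indicator ?A z * u z"
        by (intro tendsto_intros)
    qed
  qed
qed

text \<open>\<open>u\<close> and \<open>G\<close> are to be thought of as extended by zero, which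
  defines their convolutions everywhere. The extension need not have a weak gradient across the
  boundary: \<open>weak\<close> speaks only of test functions supported in \<Omega>.\<close>

locale lborel_weak_gradient =
  fixes \<Omega> :: "'a::euclidean_space set" and u :: "'a \<Rightarrow> real" and G :: "'a \<Rightarrow> 'a" and p q :: real
  assumes \<Omega>: "open \<Omega>" "bounded \<Omega>" "convex \<Omega>"
    and pq: "1 < p" "1 < q" "1 / p + 1 / q = 1"
    and u: "integrable lborel u" and G: "integrable lborel G"
    and Gp: "integrable lborel (\<lambda>x. norm (G x) powr p)"
    and weak: "\<And>\<psi> i. \<psi> \<in> test_functions \<Omega> \<Longrightarrow> i \<in> Basis \<Longrightarrow>
      (LINT x|lborel. u x * frechet_derivative \<psi> (at x) i) = - (LINT x|lborel. (G x \<bullet> i) * \<psi> x)"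
begin

text \<open>The convolution is not differentiated. Instead \<open>e (y - z) - e (x - z)\<close> is
  written as the integral of a directional derivative of \<open>e\<close> along the segment, Fubini
  is applied, and at each point of the segment the weak gradient is tested with a reflected
  translate of \<open>e\<close>.\<close>

lemma mollified_upper_gradient:
  assumes e: "\<And>k. C_k k e" "\<And>y. r \<le> norm y \<Longrightarrow> e y = 0"
    and test: "\<And>t. t \<in> {0..1} \<Longrightarrow> (\<lambda>z. e (interp t x y - z)) \<in> test_functions \<Omega>"
    and xy: "x \<in> \<Omega>" "y \<in> \<Omega>" and bnd: "\<And>y. \<bar>e y\<bar> \<le> C"
  shows "(LINT z|lborel. e (x - z) * u z) - (LINT z|lborel. e (y - z) * u z) \<le>
    integral {0..1} (\<lambda>t. diameter \<Omega> * norm (LINT z|lborel. e (interp t x y - z) *\<^sub>R G z))"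
proof -
  define d where "d i = (\<lambda>y. frechet_derivative e (at y) i)" for i
  define f where "f t z = (\<Sum>i\<in>Basis. ((y - x) \<bullet> i) * d i (interp t x y - z))" for t z
  have deriv: "(e has_derivative frechet_derivative e (at y)) (at y)" for y
    by (rule C_k_SucD(1)[OF e(1)])
  have contd: "continuous_on UNIV (d i)" if "i \<in> Basis" for i
    using C_k_SucD(2)[OF e(1)[of "Suc 0"] that] by (simp add: d_def)
  have "\<exists>C. \<forall>y. \<bar>d i y\<bar> \<le> C" if "i \<in> Basis" for i
    using frechet_derivative_bounded[OF e(1,2) that] unfolding d_def by blast
  then obtain Cd where Cd: "\<And>i y. i \<in> Basis \<Longrightarrow> \<bar>d i y\<bar> \<le> Cd i" by metis
  have contf: "continuous_on UNIV (\<lambda>(t, z). f t z)"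
    unfolding f_def case_prod_unfold interp_def
    by (intro continuous_intros continuous_on_compose2[OF contd]) auto
  have contft: "continuous_on S (\<lambda>t. f t z)" for z S
    unfolding f_def interp_def
    by (intro continuous_intros continuous_on_compose2[OF contd]) auto
  have ftc: "((\<lambda>t. f t z) has_integral e (y - z) - e (x - z)) {0..1}" for z
  proof -
    have "((\<lambda>t. e (interp t x y - z)) has_vector_derivative f t z) (at t within {0..1})" for t
    proof -
      have "((\<lambda>t. interp t x y - z) has_derivative (\<lambda>s. s *\<^sub>R (y - x))) (at t within {0..1})"
        unfolding interp_def by (auto intro!: derivative_eq_intros simp: algebra_simps)
      from has_derivative_compose[OF this deriv]
      have "((\<lambda>t. e (interp t x y - z)) has_derivative
         (\<lambda>s. frechet_derivative e (at (interp t x y - z)) (s *\<^sub>R (y - x)))) (at t within {0..1})" .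
      moreover have "frechet_derivative e (at v) (s *\<^sub>R (y - x)) = s * (\<Sum>i\<in>Basis. ((y - x) \<bullet> i) * d i v)" for v s
      proof -
        interpret bounded_linear "frechet_derivative e (at v)"
          by (rule has_derivative_bounded_linear[OF deriv])
        have "frechet_derivative e (at v) (y - x) = frechet_derivative e (at v) (\<Sum>i\<in>Basis. ((y - x) \<bullet> i) *\<^sub>R i)"
          by (simp only: euclidean_representation)
        also have "\<dots> = (\<Sum>i\<in>Basis. ((y - x) \<bullet> i) * d i v)"
          unfolding sum scaleR d_def by simp
        finally show ?thesis by (simp add: scaleR)
      qed
      ultimately show ?thesis by (simp add: has_vector_derivative_def f_def)
    qed
    from fundamental_theorem_of_calculus[of 0 1 "\<lambda>t. e (interp t x y - z)" "\<lambda>t. f t z", OF _ this]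
    show ?thesis by (simp add: interp_def)
  qed
  have ftc': "(LINT t|lborel. indicator {0..1} t * f t z) = e (y - z) - e (x - z)" for z
  proof -
    have "set_integrable lborel {0..1} (\<lambda>t. f t z)"
      by (intro borel_integrable_atLeastAtMost' contft)
    from set_borel_integral_eq_integral(2)[OF this] show ?thesis
      using integral_unique[OF ftc] by (simp add: set_lebesgue_integral_def)
  qed
  have [measurable]: "(\<lambda>(t, z). f t z) \<in> borel_measurable (lborel \<Otimes>\<^sub>M lborel)"
    using borel_measurable_continuous_onI[OF contf] by (simp add: lborel_prod)
  have [measurable]: "u \<in> borel_measurable lborel" using u by auto
  let ?F = "\<lambda>t z. indicator {0..1} t * f t z * u z"
  have int: "integrable (lborel \<Otimes>\<^sub>M lborel) (\<lambda>(t, z). ?F t z)"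
  proof (rule integrable_prod_bound)
    let ?B = "\<Sum>i\<in>Basis. \<bar>(y - x) \<bullet> i\<bar> * Cd i"
    show "integrable lborel (\<lambda>t::real. ?B * indicator {0..1} t)" by auto
    show "integrable lborel u" by (rule u)
    show "(\<lambda>(t, z). ?F t z) \<in> borel_measurable (lborel \<Otimes>\<^sub>M lborel)" by measurable
    show "\<bar>(\<lambda>(t, z). ?F t z) (t, z)\<bar> \<le> \<bar>?B * indicator {0..1} t * u z\<bar>" for t z
    proof -
      have "\<bar>f t z\<bar> \<le> ?B"
        unfolding f_def by (intro order_trans[OF sum_abs] sum_mono) (auto simp: abs_mult intro!: mult_left_mono Cd)
      then show ?thesis
        by (auto simp: abs_mult indicator_def intro!: mult_right_mono)
    qed
  qed
  let ?G = "\<lambda>x. LINT z|lborel. e (x - z) *\<^sub>R G z"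
  have econt: "continuous_on UNIV e" using C_k_imp_continuous[OF e(1)] .
  have inte: "integrable lborel (\<lambda>z. e (x - z) * u z)" for x
    using continuous_on_convolution(2)[OF u econt bnd] by simp
  have intG: "integrable lborel (\<lambda>z. e (x - z) *\<^sub>R G z)" for x
    using continuous_on_convolution(2)[OF G econt bnd] .
  have Gc: "continuous_on UNIV ?G"
    using continuous_on_convolution(1)[OF G econt bnd] .
  have slice: "(LINT z|lborel. f t z * u z) = (y - x) \<bullet> ?G (interp t x y)" if t: "t \<in> {0..1}" for t
  proof -
    let ?\<xi> = "interp t x y"
    have intd: "integrable lborel (\<lambda>z. d i (?\<xi> - z) * u z)" if "i \<in> Basis" for i
      using continuous_on_convolution(2)[OF u contd[OF that] Cd[OF that]] by simp
    have one: "(LINT z|lborel. d i (?\<xi> - z) * u z) = ?G ?\<xi> \<bullet> i" if i: "i \<in> Basis" for i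
    proof -
      \<comment> \<open>The reflection produces a minus sign that cancels the one in the definition
        of the weak gradient.\<close>
      have fd: "frechet_derivative (\<lambda>z. e (?\<xi> - z)) (at z) i = - d i (?\<xi> - z)" for z
      proof -
        have "((\<lambda>z. ?\<xi> - z) has_derivative (\<lambda>h. - h)) (at z)"
          by (auto intro!: derivative_eq_intros)
        from has_derivative_compose[OF this deriv]
        have "frechet_derivative (\<lambda>z. e (?\<xi> - z)) (at z) i = frechet_derivative e (at (?\<xi> - z)) (- i)"
          by (rule frechet_derivative_eqI)
        then show ?thesis
          using linear_neg[OF has_derivative_linear[OF deriv]] by (simp add: d_def)
      qed
      have "(LINT z|lborel. d i (?\<xi> - z) * u z) = (LINT z|lborel. (G z \<bullet> i) * e (?\<xi> - z))"
        using weak[OF test[OF t] i] by (simp add: fd mult.commute)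
      also have "\<dots> = (LINT z|lborel. (e (?\<xi> - z) *\<^sub>R G z) \<bullet> i)"
        by (simp add: mult.commute)
      also have "\<dots> = ?G ?\<xi> \<bullet> i"
        using intG i by (intro integral_inner_left) auto
      finally show ?thesis .
    qed
    have "(LINT z|lborel. f t z * u z) = (LINT z|lborel. (\<Sum>i\<in>Basis. ((y - x) \<bullet> i) * (d i (?\<xi> - z) * u z)))"
      by (simp add: f_def sum_distrib_right mult.assoc)
    also have "\<dots> = (\<Sum>i\<in>Basis. ((y - x) \<bullet> i) * (?G ?\<xi> \<bullet> i))"
      by (subst Bochner_Integration.integral_sum) (auto intro!: integrable_mult_right intd simp: one simp del: inner_diff_left)
    also have "\<dots> = (y - x) \<bullet> ?G ?\<xi>"
      by (rule euclidean_inner[symmetric])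
    finally show ?thesis .
  qed
  have "(LINT z|lborel. e (y - z) * u z) - (LINT z|lborel. e (x - z) * u z) =
    (LINT z|lborel. (e (y - z) - e (x - z)) * u z)"
    using inte by (simp add: left_diff_distrib)
  also have "\<dots> = (LINT z|lborel. LINT t|lborel. ?F t z)"
    by (simp add: ftc'[symmetric])
  also have "\<dots> = (LINT t|lborel. LINT z|lborel. ?F t z)"
    by (rule lborel_pair.Fubini_integral[OF int])
  also have "\<dots> = (LINT t|lborel. indicator {0..1} t * ((y - x) \<bullet> ?G (interp t x y)))"
    by (intro Bochner_Integration.integral_cong refl) (auto simp: slice mult.assoc indicator_def)
  also have "\<dots> = integral {0..1} (\<lambda>t. (y - x) \<bullet> ?G (interp t x y))"
  proof -
    have "set_integrable lborel {0..1} (\<lambda>t. (y - x) \<bullet> ?G (interp t x y))"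
      unfolding interp_def
      by (intro borel_integrable_atLeastAtMost' continuous_intros continuous_on_compose2[OF Gc]) auto
    from set_borel_integral_eq_integral(2)[OF this] show ?thesis
      by (simp add: set_lebesgue_integral_def)
  qed
  finally have eq: "(LINT z|lborel. e (x - z) * u z) - (LINT z|lborel. e (y - z) * u z) =
    - integral {0..1} (\<lambda>t. (y - x) \<bullet> ?G (interp t x y))"
    by simp
  also have "\<dots> = integral {0..1} (\<lambda>t. - ((y - x) \<bullet> ?G (interp t x y)))"
    by simp
  also have "\<dots> = integral {0..1} (\<lambda>t. (x - y) \<bullet> ?G (interp t x y))"
    by (simp add: inner_diff_left)
  finally have eq: "(LINT z|lborel. e (x - z) * u z) - (LINT z|lborel. e (y - z) * u z) =
    integral {0..1} (\<lambda>t. (x - y) \<bullet> ?G (interp t x y))" .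
  have c1: "continuous_on {0..1} (\<lambda>t. ?G (interp t x y))"
    unfolding interp_def by (intro continuous_on_compose2[OF Gc] continuous_intros) auto
  show ?thesis unfolding eq
  proof (rule integral_le)
    show "(\<lambda>t. (x - y) \<bullet> ?G (interp t x y)) integrable_on {0..1}"
      by (intro integrable_continuous_interval continuous_intros c1)
    show "(\<lambda>t. diameter \<Omega> * norm (?G (interp t x y))) integrable_on {0..1}"
      by (intro integrable_continuous_interval continuous_intros c1)
    fix t :: real
    have "(x - y) \<bullet> ?G (interp t x y) \<le> norm (x - y) * norm (?G (interp t x y))"
      by (rule norm_cauchy_schwarz)
    also have "\<dots> \<le> diameter \<Omega> * norm (?G (interp t x y))"
      using diameter_bounded_bound[OF \<Omega>(2) xy] by (intro mult_right_mono) (auto simp: dist_norm)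
    finally show "(x - y) \<bullet> ?G (interp t x y) \<le> diameter \<Omega> * norm (?G (interp t x y))" .
  qed
qed

text \<open>Take \<open>h\<close> as the diameter times the norm of the mollified gradient, and
  \<open>H\<close> as \<open>h powr p\<close> cut off outside \<open>K\<close>. Jensen bounds the
  p-th power of the mollified gradient by the mollified p-th power; moving the mollifier onto the
  indicator of \<open>K\<close>, which stays at most 1, gives a bound by \<open>G\<close> itself,
  free of the radius.\<close>

lemma mollified_transport_inequality:
  assumes e: "\<And>k. C_k k e" "\<And>y. 0 \<le> e y" "\<And>y. r \<le> norm y \<Longrightarrow> e y = 0"
      "integrable lborel e" "(LINT y|lborel. e y) = 1"
      "\<And>x. cball x r \<subseteq> \<Omega> \<Longrightarrow> (\<lambda>z. e (x - z)) \<in> test_functions \<Omega>"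
    and r: "0 < r" and bnd: "\<And>y. \<bar>e y\<bar> \<le> C"
    and K: "compact K" "convex K" "\<And>x. x \<in> K \<Longrightarrow> cball x r \<subseteq> \<Omega>"
    and A: "box_family I A" and B: "box_family J B"
    and pos: "\<And>k. k \<in> I \<Longrightarrow> 0 < \<alpha> k" "\<And>l. l \<in> J \<Longrightarrow> 0 < \<beta> l"
    and sub: "\<And>k. k \<in> I \<Longrightarrow> A k \<subseteq> K" "\<And>l. l \<in> J \<Longrightarrow> B l \<subseteq> K"
    and mass: "(\<Sum>k\<in>I. \<alpha> k * measure lborel (A k)) = (\<Sum>l\<in>J. \<beta> l * measure lborel (B l))"
  shows "(\<Sum>k\<in>I. \<alpha> k * integral (A k) (\<lambda>x. LINT z|lborel. e (x - z) * u z)) -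
      (\<Sum>l\<in>J. \<beta> l * integral (B l) (\<lambda>x. LINT z|lborel. e (x - z) * u z)) \<le>
    diameter \<Omega> powr p * (LINT x|lborel. norm (G x) powr p) / p +
    ((\<Sum>k\<in>I. \<alpha> k powr q * measure lborel (A k)) + (\<Sum>l\<in>J. \<beta> l powr q * measure lborel (B l))) / (2 * q)"
proof -
  let ?G = "\<lambda>x. LINT z|lborel. e (x - z) *\<^sub>R G z"
  define w where "w = (\<lambda>x. LINT z|lborel. e (x - z) * u z)"
  define h where "h = (\<lambda>x. diameter \<Omega> * norm (?G x))"
  define H where "H = (\<lambda>x. indicator K x * h x powr p)"
  have D: "0 \<le> diameter \<Omega>" by (rule diameter_ge_0[OF \<Omega>(2)])
  have econt: "continuous_on UNIV e" using C_k_imp_continuous[OF e(1)] .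
  have w: "continuous_on UNIV w"
    using continuous_on_convolution(1)[OF u econt bnd] by (simp add: w_def)
  have h: "continuous_on UNIV h"
    unfolding h_def by (intro continuous_intros continuous_on_convolution(1)[OF G econt bnd])
  have h0: "0 \<le> h x" for x using D by (simp add: h_def)
  have "continuous_on K (\<lambda>x. h x powr p)"
    using pq h0 by (intro continuous_on_powr' continuous_on_subset[OF h] continuous_intros) auto
  from borel_integrable_compact[OF K(1) this] have Hint: "integrable lborel H"
    by (simp add: H_def)
  have Kb: "K \<in> sets borel" "emeasure lborel K < \<infinity>"
    using emeasure_bounded_finite[OF compact_imp_bounded[OF K(1)]] K(1)
    by (auto simp: compact_imp_closed borel_closed)
  have "integral UNIV H = (LINT x|lborel. H x)"
    using has_integral_integral_lborel[OF Hint] by (rule integral_unique)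
  also have "\<dots> \<le> (LINT x|lborel. diameter \<Omega> powr p *
      (indicator K x * (LINT z|lborel. e (x - z) * norm (G z) powr p)))"
  proof (rule integral_mono[OF Hint])
    show "integrable lborel (\<lambda>x. diameter \<Omega> powr p *
      (indicator K x * (LINT z|lborel. e (x - z) * norm (G z) powr p)))"
      by (intro integrable_mult_right integral_indicator_convolution(2)[OF Gp econt bnd Kb])
    fix x
    have [measurable]: "e \<in> borel_measurable borel"
      using econt by (simp add: borel_measurable_continuous_onI)
    have "norm (?G x) powr p \<le> (LINT z|lborel. e (x - z) * norm (G z) powr p)"
    proof (rule norm_integral_scaleR_powr_le[OF pq])
      show "(LINT z|lborel. e (x - z)) = 1"
        using integral_reflect_translate[of e "-1" x] e(5) by simp
      then show "integrable lborel (\<lambda>z. e (x - z))"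
        using not_integrable_integral_eq by fastforce
      show "integrable lborel (\<lambda>z. e (x - z) *\<^sub>R G z)"
        by (rule continuous_on_convolution(2)[OF G econt bnd])
      show "integrable lborel (\<lambda>z. e (x - z) * norm (G z) powr p)"
        using continuous_on_convolution(2)[OF Gp econt bnd] by simp
    qed (rule e)
    then show "H x \<le> diameter \<Omega> powr p * (indicator K x * (LINT z|lborel. e (x - z) * norm (G z) powr p))"
      using D by (auto simp: H_def h_def indicator_def powr_mult intro!: mult_left_mono)
  qed
  also have "\<dots> = diameter \<Omega> powr p * (LINT z|lborel. (LINT x|lborel. indicator K x * e (x - z)) * norm (G z) powr p)"
    by (simp add: integral_indicator_convolution(1)[OF Gp econt bnd Kb])
  also have "\<dots> \<le> diameter \<Omega> powr p * (LINT z|lborel. norm (G z) powr p)"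
  proof (intro mult_left_mono integral_mono Gp integral_indicator_convolution(3)[OF Gp econt bnd Kb])
    fix z
    have "(LINT x|lborel. indicator K x * e (x - z)) \<in> {0..1}"
      by (rule integral_indicator_mollifier(1)[OF econt e(2,5) Kb(1)])
    then show "(LINT x|lborel. indicator K x * e (x - z)) * norm (G z) powr p \<le> norm (G z) powr p"
      by (intro mult_left_le_one_le) auto
  qed simp
  finally have HG: "integral UNIV H \<le> diameter \<Omega> powr p * (LINT z|lborel. norm (G z) powr p)" .
  interpret upper_gradient w h H K p q
  proof
    fix x y assume xy: "x \<in> K" "y \<in> K"
    have "interp t x y \<in> K" if "t \<in> {0..1}" for t
      using convexD_alt[OF K(2) xy] that by (simp add: interp_def)
    moreover have "x \<in> \<Omega>" "y \<in> \<Omega>"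
      using K(3)[OF xy(1)] K(3)[OF xy(2)] r centre_in_cball[of x r] centre_in_cball[of y r] by auto
    ultimately show "w x - w y \<le> integral {0..1} (\<lambda>t. h (interp t x y))"
      unfolding w_def h_def using K(3) xy r
      by (intro mollified_upper_gradient[OF e(1) e(3) e(6) _ _ bnd]) auto
  next
    show "H integrable_on UNIV"
      using has_integral_integral_lborel[OF Hint] by blast
  qed (use pq w h h0 K in \<open>auto simp: H_def\<close>)
  have "(\<Sum>k\<in>I. \<alpha> k * integral (A k) w) - (\<Sum>l\<in>J. \<beta> l * integral (B l) w) \<le> integral UNIV H / p +
    ((\<Sum>k\<in>I. \<alpha> k powr q * measure lborel (A k)) + (\<Sum>l\<in>J. \<beta> l powr q * measure lborel (B l))) / (2 * q)"
    by (rule transport_inequality[OF A B pos sub mass])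
  also have "integral UNIV H / p \<le> diameter \<Omega> powr p * (LINT x|lborel. norm (G x) powr p) / p"
    using HG pq by (intro divide_right_mono) auto
  finally show ?thesis by (simp add: w_def)
qed

text \<open>The bound for mollified functions does not depend on the radius, so the radius tends to
  0 in the left-hand side only.\<close>

lemma box_transport_inequality:
  assumes A: "box_family I A" and B: "box_family J B"
    and pos: "\<And>k. k \<in> I \<Longrightarrow> 0 < \<alpha> k" "\<And>l. l \<in> J \<Longrightarrow> 0 < \<beta> l"
    and sub: "\<And>k. k \<in> I \<Longrightarrow> A k \<subseteq> \<Omega>" "\<And>l. l \<in> J \<Longrightarrow> B l \<subseteq> \<Omega>"
    and mass: "(\<Sum>k\<in>I. \<alpha> k * measure lborel (A k)) = (\<Sum>l\<in>J. \<beta> l * measure lborel (B l))"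
  shows "(\<Sum>k\<in>I. \<alpha> k * (LINT x|lborel. indicator (A k) x * u x)) -
      (\<Sum>l\<in>J. \<beta> l * (LINT x|lborel. indicator (B l) x * u x)) \<le>
    diameter \<Omega> powr p * (LINT x|lborel. norm (G x) powr p) / p +
    ((\<Sum>k\<in>I. \<alpha> k powr q * measure lborel (A k)) + (\<Sum>l\<in>J. \<beta> l powr q * measure lborel (B l))) / (2 * q)"
proof -
  \<comment> \<open>The hull is convex, as the paths require, and being compact in \<Omega> it
    leaves room of a fixed width \<epsilon> for the mollifiers.\<close>
  define K where "K = convex hull ((\<Union>k\<in>I. A k) \<union> (\<Union>l\<in>J. B l))"
  have cU: "compact (\<Union>k\<in>I. A k)" if "box_family I A" for I :: "'z set" and A :: "'z \<Rightarrow> 'a set"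
    using that by (intro compact_UN) (auto simp: box_family_def)
  have K: "compact K" "convex K"
    using cU[OF A] cU[OF B] by (auto simp: K_def intro!: compact_convex_hull compact_Un)
  have "K \<subseteq> \<Omega>"
    unfolding K_def using sub \<Omega>(3) by (intro hull_minimal) auto
  then obtain \<epsilon> where \<epsilon>: "0 < \<epsilon>" "(\<Union>x\<in>K. cball x \<epsilon>) \<subseteq> \<Omega>"
    using compact_subset_open_imp_cball_epsilon_subset[OF K(1) \<Omega>(1)] by metis
  define r where "r n = \<epsilon> / real (Suc n)" for n
  have r: "0 < r n" "r n \<le> \<epsilon>" for n
    using \<epsilon>(1) by (auto simp: r_def field_simps)
  have r0: "r \<longlonglongrightarrow> 0"
    unfolding r_def by (intro LIMSEQ_Suc lim_const_over_n)
  \<comment> \<open>All properties of the mollifier are bundled so that a single choice yields the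
    sequence.\<close>
  define good where "good n e \<longleftrightarrow> (\<forall>k. C_k k e) \<and> (\<forall>y. 0 \<le> e y) \<and> (\<forall>y. r n \<le> norm y \<longrightarrow> e y = 0) \<and>
    integrable lborel e \<and> (LINT y|lborel. e y) = 1 \<and>
    (\<forall>x. cball x (r n) \<subseteq> \<Omega> \<longrightarrow> (\<lambda>z. e (x - z)) \<in> test_functions \<Omega>)" for n and e :: "'a \<Rightarrow> real"
  have "\<exists>e. good n e" for n
  proof (rule mollifier_exists[OF r(1)[of n], where 'a = 'a], goal_cases)
    case (1 e)
    then have "good n e" by (simp add: good_def)
    show ?case by (rule exI[of _ e]) (rule \<open>good n e\<close>)
  qed
  then obtain e where "\<And>n. good n (e n)" by metis
  then have e: "\<And>n k. C_k k (e n)" "\<And>n y. 0 \<le> e n y" "\<And>n y. r n \<le> norm y \<Longrightarrow> e n y = 0"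
    "\<And>n. integrable lborel (e n)" "\<And>n. (LINT y|lborel. e n y) = 1"
    "\<And>n x. cball x (r n) \<subseteq> \<Omega> \<Longrightarrow> (\<lambda>z. e n (x - z)) \<in> test_functions \<Omega>"
    by (auto simp: good_def)
  have econt: "continuous_on UNIV (e n)" for n using C_k_imp_continuous[OF e(1)] .
  have "\<exists>C. \<forall>y. \<bar>e n y\<bar> \<le> C" for n
    using bounded_of_continuous_zero_outside[OF econt, of "r n" n] e(3)[of n] by auto
  then obtain C where C: "\<And>n y. \<bar>e n y\<bar> \<le> C n" by metis
  let ?w = "\<lambda>n x. LINT z|lborel. e n (x - z) * u z"
  have lim: "(\<lambda>n. integral S (?w n)) \<longlonglongrightarrow> (LINT x|lborel. indicator S x * u x)"
    if "\<exists>a b. S = cbox a b" for S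
    using that integral_cbox_mollified_tendsto[OF u econt e(2,5,3) C r0] by auto
  have "(\<lambda>n. (\<Sum>k\<in>I. \<alpha> k * integral (A k) (?w n)) - (\<Sum>l\<in>J. \<beta> l * integral (B l) (?w n))) \<longlonglongrightarrow>
    (\<Sum>k\<in>I. \<alpha> k * (LINT x|lborel. indicator (A k) x * u x)) -
      (\<Sum>l\<in>J. \<beta> l * (LINT x|lborel. indicator (B l) x * u x))"
    using A B by (intro tendsto_intros lim) (auto simp: box_family_def)
  then show ?thesis
  proof (rule LIMSEQ_le_const2, intro exI allI impI)
    fix n
    have cb: "cball x (r n) \<subseteq> \<Omega>" if "x \<in> K" for x
      using \<epsilon>(2) r(2)[of n] that subset_cball[of "r n" \<epsilon> x] by blast
    have subK: "A k \<subseteq> K" if "k \<in> I" for k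
      unfolding K_def using that by (intro hull_subset[THEN subset_trans[rotated]]) auto
    have subK': "B l \<subseteq> K" if "l \<in> J" for l
      unfolding K_def using that by (intro hull_subset[THEN subset_trans[rotated]]) auto
    show "(\<Sum>k\<in>I. \<alpha> k * integral (A k) (?w n)) - (\<Sum>l\<in>J. \<beta> l * integral (B l) (?w n)) \<le>
    diameter \<Omega> powr p * (LINT x|lborel. norm (G x) powr p) / p +
    ((\<Sum>k\<in>I. \<alpha> k powr q * measure lborel (A k)) + (\<Sum>l\<in>J. \<beta> l powr q * measure lborel (B l))) / (2 * q)"
      by (rule mollified_transport_inequality[OF e r(1) C K cb A B pos subK subK' mass])
  qed
qed

end

section \<open>Approximation by step functions on boxes\<close>

text \<open>Mass, integral against \<open>u\<close> and q-th moment are the only data of a density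
  in the transport inequality, so just these three numbers are approximated. Each of them passes to
  dominated limits. Indices have type \<open>'a\<close> because a grid cell is named by its lower
  corner.\<close>

definition box_approximable ::
  "'a::euclidean_space set \<Rightarrow> ('a \<Rightarrow> real) \<Rightarrow> real \<Rightarrow> ('a \<Rightarrow> real) \<Rightarrow> bool" where
  "box_approximable \<Omega> u q f \<longleftrightarrow> (\<forall>\<epsilon>>0. \<exists>(I::'a set) A \<alpha>. box_family I A \<and>
     (\<forall>k\<in>I. 0 < \<alpha> k \<and> A k \<subseteq> \<Omega>) \<and>
     \<bar>(\<Sum>k\<in>I. \<alpha> k * measure lborel (A k)) - (LINT x|lborel. f x)\<bar> < \<epsilon> \<and>
     \<bar>(\<Sum>k\<in>I. \<alpha> k * (LINT x|lborel. indicator (A k) x * u x)) - (LINT x|lborel. f x * u x)\<bar> < \<epsilon> \<and>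
     \<bar>(\<Sum>k\<in>I. \<alpha> k powr q * measure lborel (A k)) - (LINT x|lborel. f x powr q)\<bar> < \<epsilon>)"

lemma box_approximable_limit:
  fixes F :: "nat \<Rightarrow> 'a::euclidean_space \<Rightarrow> real"
  assumes approx: "\<forall>\<^sub>F n in sequentially. box_approximable \<Omega> u q (F n)"
    and meas [measurable]: "\<And>n. F n \<in> borel_measurable lborel" "f \<in> borel_measurable lborel" "u \<in> borel_measurable lborel"
    and le: "\<And>n x. 0 \<le> F n x" "\<And>n x. F n x \<le> M x"
    and lim: "AE x in lborel. (\<lambda>n. F n x) \<longlonglongrightarrow> f x"
    and M: "integrable lborel M" "integrable lborel (\<lambda>x. M x * \<bar>u x\<bar>)" "integrable lborel (\<lambda>x. M x powr q)"
    and q: "0 < q"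
  shows "box_approximable \<Omega> u q f"
  unfolding box_approximable_def
proof (intro allI impI)
  fix \<epsilon> :: real assume \<epsilon>: "0 < \<epsilon>"
  have "(\<lambda>n. LINT x|lborel. F n x) \<longlonglongrightarrow> (LINT x|lborel. f x)"
    by (rule integral_dominated_convergence[OF _ _ M(1) lim]) (use le in auto)
  moreover have "(\<lambda>n. LINT x|lborel. F n x * u x) \<longlonglongrightarrow> (LINT x|lborel. f x * u x)"
  proof (rule integral_dominated_convergence[OF _ _ M(2)])
    show "AE x in lborel. (\<lambda>n. F n x * u x) \<longlonglongrightarrow> f x * u x"
      using lim by (rule eventually_mono) (intro tendsto_intros)
    show "AE x in lborel. norm (F n x * u x) \<le> M x * \<bar>u x\<bar>" for n
      using le[of n] by (auto simp: abs_mult intro!: mult_right_mono)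
  qed measurable
  moreover have "(\<lambda>n. LINT x|lborel. F n x powr q) \<longlonglongrightarrow> (LINT x|lborel. f x powr q)"
  proof (rule integral_dominated_convergence[OF _ _ M(3)])
    show "AE x in lborel. (\<lambda>n. F n x powr q) \<longlonglongrightarrow> f x powr q"
      using lim by (rule eventually_mono) (intro tendsto_powr' tendsto_const, use q le in auto)
    show "AE x in lborel. norm (F n x powr q) \<le> M x powr q" for n
      using le[of n] q by (auto intro!: powr_mono2)
  qed measurable
  moreover have \<epsilon>2: "0 < \<epsilon> / 2" using \<epsilon> by simp
  moreover have "\<forall>\<^sub>F n in sequentially. \<bar>X n - L\<bar> < \<epsilon> / 2" if "X \<longlonglongrightarrow> L" for X :: "nat \<Rightarrow> real" and L
    using tendstoD[OF that \<epsilon>2] by (simp add: dist_real_def)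
  ultimately have "\<forall>\<^sub>F n in sequentially. box_approximable \<Omega> u q (F n) \<and>
      \<bar>(LINT x|lborel. F n x) - (LINT x|lborel. f x)\<bar> < \<epsilon> / 2 \<and>
      \<bar>(LINT x|lborel. F n x * u x) - (LINT x|lborel. f x * u x)\<bar> < \<epsilon> / 2 \<and>
      \<bar>(LINT x|lborel. F n x powr q) - (LINT x|lborel. f x powr q)\<bar> < \<epsilon> / 2"
    using approx by (intro eventually_conj) blast+
  then obtain n where n: "box_approximable \<Omega> u q (F n)"
      "\<bar>(LINT x|lborel. F n x) - (LINT x|lborel. f x)\<bar> < \<epsilon> / 2"
      "\<bar>(LINT x|lborel. F n x * u x) - (LINT x|lborel. f x * u x)\<bar> < \<epsilon> / 2"
      "\<bar>(LINT x|lborel. F n x powr q) - (LINT x|lborel. f x powr q)\<bar> < \<epsilon> / 2"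
    using eventually_happens'[OF sequentially_bot] by blast
  obtain I A \<alpha> where I: "box_family (I :: 'a set) A" "\<forall>k\<in>I. 0 < \<alpha> k \<and> A k \<subseteq> \<Omega>"
     "\<bar>(\<Sum>k\<in>I. \<alpha> k * measure lborel (A k)) - (LINT x|lborel. F n x)\<bar> < \<epsilon> / 2"
     "\<bar>(\<Sum>k\<in>I. \<alpha> k * (LINT x|lborel. indicator (A k) x * u x)) - (LINT x|lborel. F n x * u x)\<bar> < \<epsilon> / 2"
     "\<bar>(\<Sum>k\<in>I. \<alpha> k powr q * measure lborel (A k)) - (LINT x|lborel. F n x powr q)\<bar> < \<epsilon> / 2"
    using n(1)[unfolded box_approximable_def, rule_format, OF \<epsilon>2] by blast
  show "\<exists>(I::'a set) A \<alpha>. box_family I A \<and>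
     (\<forall>k\<in>I. 0 < \<alpha> k \<and> A k \<subseteq> \<Omega>) \<and>
     \<bar>(\<Sum>k\<in>I. \<alpha> k * measure lborel (A k)) - (LINT x|lborel. f x)\<bar> < \<epsilon> \<and>
     \<bar>(\<Sum>k\<in>I. \<alpha> k * (LINT x|lborel. indicator (A k) x * u x)) - (LINT x|lborel. f x * u x)\<bar> < \<epsilon> \<and>
     \<bar>(\<Sum>k\<in>I. \<alpha> k powr q * measure lborel (A k)) - (LINT x|lborel. f x powr q)\<bar> < \<epsilon>"
    using n(2-4) I(3-5) by (intro exI[of _ I] exI[of _ A] exI[of _ \<alpha>] conjI I(1,2)) linarith+
qed

section \<open>Cubical grids\<close>

definition grid :: "real \<Rightarrow> 'a::euclidean_space set" where
  "grid m = {v. \<forall>i\<in>Basis. m * (v \<bullet> i) \<in> \<int>}"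

definition grid_corner :: "real \<Rightarrow> 'a::euclidean_space \<Rightarrow> 'a" where
  "grid_corner m x = (\<Sum>i\<in>Basis. (of_int \<lfloor>m * (x \<bullet> i)\<rfloor> / m) *\<^sub>R i)"

definition grid_cell :: "real \<Rightarrow> 'a::euclidean_space \<Rightarrow> 'a set" where
  "grid_cell m v = cbox v (v + (1 / m) *\<^sub>R One)"

lemma grid_corner_inner: "i \<in> Basis \<Longrightarrow> grid_corner m x \<bullet> i = of_int \<lfloor>m * (x \<bullet> i)\<rfloor> / m"
  by (simp add: grid_corner_def)

lemma grid_corner_bounds:
  assumes "0 < m" "i \<in> Basis"
  shows "grid_corner m x \<bullet> i \<le> x \<bullet> i" "x \<bullet> i < grid_corner m x \<bullet> i + 1 / m"
proof -
  have "of_int \<lfloor>m * (x \<bullet> i)\<rfloor> \<le> m * (x \<bullet> i)" "m * (x \<bullet> i) < of_int \<lfloor>m * (x \<bullet> i)\<rfloor> + 1"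
    by linarith+
  then show "grid_corner m x \<bullet> i \<le> x \<bullet> i" "x \<bullet> i < grid_corner m x \<bullet> i + 1 / m"
    using assms by (auto simp: grid_corner_inner field_simps)
qed

lemma grid_corner_in_grid: "0 < m \<Longrightarrow> grid_corner m x \<in> grid m"
  by (auto simp: grid_def grid_corner_inner)

lemma mem_grid_cell_corner: "0 < m \<Longrightarrow> x \<in> grid_cell m (grid_corner m x)"
  using grid_corner_bounds[of m _ x] by (auto simp: grid_cell_def mem_box inner_add_left less_imp_le)

lemma grid_corner_eqI:
  assumes m: "0 < m" and v: "v \<in> grid m" and x: "x \<in> box v (v + (1 / m) *\<^sub>R One)"
  shows "grid_corner m x = v"
proof (rule euclidean_eqI)
  fix i :: 'a assume i: "i \<in> Basis"
  obtain k where k: "m * (v \<bullet> i) = of_int k"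
    using v i by (auto simp: grid_def elim: Ints_cases)
  have "v \<bullet> i < x \<bullet> i" "x \<bullet> i < v \<bullet> i + 1 / m"
    using x i by (auto simp: mem_box inner_add_left)
  then have "m * (v \<bullet> i) < m * (x \<bullet> i)" "m * (x \<bullet> i) < m * (v \<bullet> i) + 1"
    using m by (auto simp: field_simps)
  then have "\<lfloor>m * (x \<bullet> i)\<rfloor> = k"
    unfolding k by linarith
  then show "grid_corner m x \<bullet> i = v \<bullet> i"
    using i m k by (simp add: grid_corner_inner field_simps)
qed

lemma finite_grid_bounded:
  assumes m: "0 < m"
  shows "finite (grid m \<inter> cball (0::'a::euclidean_space) R)"
proof -
  define N where "N = \<lceil>m * R\<rceil>"
  define f where "f v = restrict (\<lambda>i. \<lfloor>m * (v \<bullet> i)\<rfloor>) Basis" for v :: 'a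
  have "inj_on f (grid m \<inter> cball 0 R)"
  proof (rule inj_onI, rule euclidean_eqI)
    fix v w i :: 'a assume *: "v \<in> grid m \<inter> cball 0 R" "w \<in> grid m \<inter> cball 0 R" "f v = f w" "i \<in> Basis"
    then have "f v i = f w i" by simp
    then have "\<lfloor>m * (v \<bullet> i)\<rfloor> = \<lfloor>m * (w \<bullet> i)\<rfloor>"
      using *(4) by (simp add: f_def)
    moreover have "m * (v \<bullet> i) \<in> \<int>" "m * (w \<bullet> i) \<in> \<int>" using * by (auto simp: grid_def)
    ultimately have "m * (v \<bullet> i) = m * (w \<bullet> i)" by (metis of_int_floor)
    then show "v \<bullet> i = w \<bullet> i" using m by simp
  qed
  moreover have "f ` (grid m \<inter> cball 0 R) \<subseteq> PiE Basis (\<lambda>_. {-N..N})"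
  proof (rule image_subsetI)
    fix v :: 'a assume v: "v \<in> grid m \<inter> cball 0 R"
    have "- N \<le> \<lfloor>m * (v \<bullet> i)\<rfloor> \<and> \<lfloor>m * (v \<bullet> i)\<rfloor> \<le> N" if "i \<in> Basis" for i
    proof -
      have "\<bar>v \<bullet> i\<bar> \<le> R" using Basis_le_norm[OF that, of v] v by auto
      then have "\<bar>m * (v \<bullet> i)\<bar> \<le> m * R" using m by (simp add: abs_mult)
      then show ?thesis unfolding N_def by linarith
    qed
    then show "f v \<in> PiE Basis (\<lambda>_. {-N..N})" by (auto simp: f_def PiE_iff)
  qed
  moreover have "finite (PiE Basis (\<lambda>_::'a. {-N..N}))" by (intro finite_PiE) auto
  ultimately show ?thesis by (metis inj_on_finite)
qed

lemma dist_grid_cell: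
  fixes v :: "'a::euclidean_space"
  assumes m: "0 < m" and x: "x \<in> grid_cell m v"
  shows "dist v x \<le> DIM('a) / m"
proof -
  have "norm (x - v) \<le> (\<Sum>i\<in>Basis. \<bar>(x - v) \<bullet> i\<bar>)" by (rule norm_le_l1)
  also have "\<dots> \<le> (\<Sum>i\<in>(Basis::'a set). 1 / m)"
    using x by (intro sum_mono) (auto simp: grid_cell_def mem_box inner_add_left inner_diff_left)
  finally show ?thesis by (simp add: dist_norm norm_minus_commute)
qed

text \<open>Sampling \<open>f\<close> at the lower corner of the cell gives a step function almost
  everywhere, so the three numbers agree exactly, without error. Cells with a positive value have
  their corner in \<open>K\<close> and are small enough to lie in \<Omega>.\<close>

lemma grid_step_approximable:
  fixes f u :: "'a::euclidean_space \<Rightarrow> real"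
  assumes m: "0 < m" and f0: "\<And>x. 0 \<le> f x" and K: "bounded K" "\<And>x. x \<notin> K \<Longrightarrow> f x = 0"
    and \<Omega>: "\<And>x. x \<in> K \<Longrightarrow> cball x (DIM('a) / m) \<subseteq> \<Omega>" and u: "integrable lborel u" and q: "0 < q"
    and [measurable]: "f \<in> borel_measurable borel"
  shows "box_approximable \<Omega> u q (\<lambda>x. f (grid_corner m x))"
proof -
  define I where "I = {v \<in> grid m. 0 < f v}"
  let ?A = "grid_cell m :: 'a \<Rightarrow> 'a set"
  have less: "\<forall>j\<in>Basis. v \<bullet> j < (v + (1 / m) *\<^sub>R One) \<bullet> j" for v :: 'a
    using m by (simp add: inner_add_left)
  have IK: "v \<in> K" if "v \<in> I" for v
    using K(2)[of v] that by (auto simp: I_def)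
  obtain R where "\<And>x. x \<in> K \<Longrightarrow> norm x \<le> R"
    using K(1) by (auto simp: bounded_iff)
  then have "I \<subseteq> grid m \<inter> cball 0 R"
    using IK by (auto simp: I_def)
  then have fin: "finite I"
    using finite_grid_bounded[OF m] finite_subset by blast
  have disj: "interior (?A v) \<inter> interior (?A w) = {}" if "v \<in> I" "w \<in> I" "v \<noteq> w" for v w
  proof -
    have "x \<in> interior (?A v) \<Longrightarrow> x \<in> interior (?A w) \<Longrightarrow> False" for x
      using grid_corner_eqI[OF m, of v x] grid_corner_eqI[OF m, of w x] that
      by (auto simp: I_def grid_cell_def)
    then show ?thesis by blast
  qed
  have fam: "box_family I ?A"
    using fin disj less by (auto simp: box_family_def pairwise_def grid_cell_def content_pos_lt_eq)
  have sub: "?A v \<subseteq> \<Omega>" if "v \<in> I" for v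
    using \<Omega>[OF IK[OF that]] dist_grid_cell[OF m, of _ v] by (auto simp: subset_iff)
  \<comment> \<open>One identity for all three numbers: \<Phi> is the identity or the power
    \<open>q\<close>, and \<open>g\<close> is 1 or \<open>u\<close>. Points on faces of cells form a
    null set.\<close>
  have eq: "(\<Sum>v\<in>I. \<Phi> (f v) * (LINT x|lborel. indicator (?A v) x * g x)) =
      (LINT x|lborel. \<Phi> (f (grid_corner m x)) * g x)"
    if \<Phi>: "\<Phi> 0 = 0" and g: "\<And>v. integrable lborel (\<lambda>x. indicator (?A v) x * g x)"
      and [measurable]: "g \<in> borel_measurable lborel" "\<Phi> \<in> borel_measurable borel" for \<Phi> :: "real \<Rightarrow> real" and g
  proof -
    have "(\<Sum>v\<in>I. \<Phi> (f v) * (LINT x|lborel. indicator (?A v) x * g x)) =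
      (LINT x|lborel. (\<Sum>v\<in>I. \<Phi> (f v) * (indicator (?A v) x * g x)))"
      using g by (subst Bochner_Integration.integral_sum) auto
    also have "\<dots> = (LINT x|lborel. \<Phi> (f (grid_corner m x)) * g x)"
    proof (rule integral_cong_AE)
      have "AE x in lborel. \<forall>v\<in>I. x \<in> box v (v + (1 / m) *\<^sub>R One) \<or> x \<notin> ?A v"
        unfolding AE_finite_all[OF fin] grid_cell_def by (intro ballI AE_lborel_box_or_not_cbox)
      then show "AE x in lborel. (\<Sum>v\<in>I. \<Phi> (f v) * (indicator (?A v) x * g x)) = \<Phi> (f (grid_corner m x)) * g x"
      proof (rule eventually_mono)
        fix x assume x: "\<forall>v\<in>I. x \<in> box v (v + (1 / m) *\<^sub>R One) \<or> x \<notin> ?A v"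
        let ?v = "grid_corner m x"
        have "\<Phi> (f v) * (indicator (?A v) x * g x) = (if v = ?v then \<Phi> (f ?v) * g x else 0)" if v: "v \<in> I" for v
        proof (cases "x \<in> ?A v")
          case True
          then have "?v = v"
            using x v by (intro grid_corner_eqI[OF m]) (auto simp: I_def)
          then show ?thesis using True by simp
        next
          case False
          then have "v \<noteq> ?v" using mem_grid_cell_corner[OF m, of x] by metis
          then show ?thesis using False by simp
        qed
        then have "(\<Sum>v\<in>I. \<Phi> (f v) * (indicator (?A v) x * g x)) = (\<Sum>v\<in>I. if v = ?v then \<Phi> (f ?v) * g x else 0)"
          by (intro sum.cong) auto
        also have "\<dots> = \<Phi> (f ?v) * g x"
        proof (cases "?v \<in> I")
          case False
          then have "f ?v = 0" using f0[of ?v] grid_corner_in_grid[OF m, of x] by (auto simp: I_def)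
          then show ?thesis using \<Phi> False fin by simp
        qed (use fin in simp)
        finally show "(\<Sum>v\<in>I. \<Phi> (f v) * (indicator (?A v) x * g x)) = \<Phi> (f ?v) * g x" .
      qed
      have "?A v \<in> sets borel" for v by (simp add: grid_cell_def)
      then show "(\<lambda>x. \<Sum>v\<in>I. \<Phi> (f v) * (indicator (?A v) x * g x)) \<in> borel_measurable lborel"
        by measurable
      have [measurable]: "grid_corner m \<in> borel_measurable borel"
        unfolding grid_corner_def by measurable
      show "(\<lambda>x. \<Phi> (f (grid_corner m x)) * g x) \<in> borel_measurable lborel"
        by measurable
    qed
    finally show ?thesis .
  qed
  have cell: "integrable lborel (\<lambda>x. indicator (?A v) x * 1 :: real)" for v
    using emeasure_lborel_cbox_finite[of v "v + (1 / m) *\<^sub>R One"]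
    by (simp add: grid_cell_def integrable_real_indicator)
  have cell_u: "integrable lborel (\<lambda>x. indicator (?A v) x * u x)" for v
    using integrable_mult_indicator[OF _ u, of "?A v"] by (simp add: grid_cell_def)
  have vol: "(LINT x|lborel. indicator (?A v) x * 1) = measure lborel (?A v)" for v
    by (simp add: grid_cell_def)
  have "(\<Sum>v\<in>I. f v * (LINT x|lborel. indicator (?A v) x * 1)) = (LINT x|lborel. f (grid_corner m x) * 1)"
    by (rule eq[of "\<lambda>s. s"]) (use cell in auto)
  then have e1: "(\<Sum>v\<in>I. f v * measure lborel (?A v)) = (LINT x|lborel. f (grid_corner m x))"
    unfolding vol by simp
  have e2: "(\<Sum>v\<in>I. f v * (LINT x|lborel. indicator (?A v) x * u x)) = (LINT x|lborel. f (grid_corner m x) * u x)"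
    by (rule eq[of "\<lambda>s. s"]) (use cell_u u in auto)
  have "(\<Sum>v\<in>I. f v powr q * (LINT x|lborel. indicator (?A v) x * 1)) = (LINT x|lborel. f (grid_corner m x) powr q * 1)"
    by (rule eq[of "\<lambda>s. s powr q"]) (use cell in auto)
  then have e3: "(\<Sum>v\<in>I. f v powr q * measure lborel (?A v)) = (LINT x|lborel. f (grid_corner m x) powr q)"
    unfolding vol by simp
  show ?thesis
    unfolding box_approximable_def
    using fam sub e1 e2 e3
    by (intro allI impI exI[of _ I] exI[of _ ?A] exI[of _ f]) (auto simp: I_def)
qed

lemma grid_corner_tendsto: "(\<lambda>n. grid_corner (real (Suc n)) x) \<longlonglongrightarrow> (x :: 'a::euclidean_space)"
proof -
  have "(\<lambda>n. dist (grid_corner (real (Suc n)) x) x) \<longlonglongrightarrow> 0"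
  proof (rule tendsto_sandwich[OF _ _ tendsto_const])
    show "(\<lambda>n. DIM('a) / real (Suc n)) \<longlonglongrightarrow> 0"
      by (rule LIMSEQ_Suc[OF lim_const_over_n])
    show "\<forall>\<^sub>F n in sequentially. dist (grid_corner (real (Suc n)) x) x \<le> DIM('a) / real (Suc n)"
      by (intro always_eventually allI dist_grid_cell mem_grid_cell_corner) auto
  qed auto
  then show ?thesis by (rule tendsto_dist_iff[THEN iffD2])
qed

lemma box_approximable_continuous:
  fixes f u :: "'a::euclidean_space \<Rightarrow> real"
  assumes f: "continuous_on UNIV f" "\<And>x. 0 \<le> f x" "\<And>x. f x \<le> c"
    and K: "compact K" "K \<subseteq> \<Omega>" "\<And>x. x \<notin> K \<Longrightarrow> f x = 0" and \<Omega>: "open \<Omega>"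
    and u: "integrable lborel u" and q: "0 < q"
  shows "box_approximable \<Omega> u q f"
proof -
  obtain d where d: "0 < d" "(\<Union>x\<in>K. cball x d) \<subseteq> \<Omega>"
    using compact_subset_open_imp_cball_epsilon_subset[OF K(1) \<Omega> K(2)] by metis
  obtain R where R: "\<And>x. x \<in> K \<Longrightarrow> norm x \<le> R"
    using compact_imp_bounded[OF K(1)] by (auto simp: bounded_iff)
  let ?B = "cball (0::'a) (R + DIM('a))"
  \<comment> \<open>The mesh size is at most 1, so a point is within \<open>DIM('a)\<close> of its
    grid corner; the sampled functions vanish outside the ball \<open>?B\<close>.\<close>
  define M where "M x = c * indicator ?B x" for x
  have c: "0 \<le> c" using f(2,3) order_trans by blast
  have fB [measurable]: "f \<in> borel_measurable borel" using f(1) by (rule borel_measurable_continuous_onI)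
  have B: "emeasure lborel ?B < \<infinity>" by (rule emeasure_bounded_finite) auto
  show ?thesis
  proof (rule box_approximable_limit)
    show "\<forall>\<^sub>F n in sequentially. box_approximable \<Omega> u q (\<lambda>x. f (grid_corner (real (Suc n)) x))"
    proof -
      have "(\<lambda>n. DIM('a) / real (Suc n)) \<longlonglongrightarrow> 0"
        by (rule LIMSEQ_Suc[OF lim_const_over_n])
      then have "\<forall>\<^sub>F n in sequentially. DIM('a) / real (Suc n) < d"
        using d(1) by (rule order_tendstoD)
      then show ?thesis
      proof (rule eventually_mono)
        fix n assume n: "DIM('a) / real (Suc n) < d"
        have "cball x (DIM('a) / real (Suc n)) \<subseteq> \<Omega>" if "x \<in> K" for x
          using d(2) that subset_cball[OF less_imp_le[OF n], of x] by blast
        then show "box_approximable \<Omega> u q (\<lambda>x. f (grid_corner (real (Suc n)) x))"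
          by (intro grid_step_approximable[OF _ f(2) compact_imp_bounded[OF K(1)] K(3)] u q fB) auto
      qed
    qed
    have [measurable]: "grid_corner m \<in> borel_measurable borel" for m :: real
      unfolding grid_corner_def by measurable
    show "(\<lambda>x. f (grid_corner (real (Suc n)) x)) \<in> borel_measurable lborel" for n
      by measurable
    show "f (grid_corner (real (Suc n)) x) \<le> M x" for n x
    proof (cases "grid_corner (real (Suc n)) x \<in> K")
      case True
      have "dist (grid_corner (real (Suc n)) x) x \<le> DIM('a) / real (Suc n)"
        by (intro dist_grid_cell mem_grid_cell_corner) auto
      also have "\<dots> \<le> DIM('a)" by (simp add: field_simps)
      finally have "norm x \<le> R + DIM('a)"
        using R[OF True] norm_triangle_sub[of x "grid_corner (real (Suc n)) x"]
        by (simp add: dist_norm norm_minus_commute)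
      then show ?thesis using f(3) by (simp add: M_def)
    qed (use K(3) c in \<open>auto simp: M_def\<close>)
    have "isCont f x" for x using f(1) by (simp add: continuous_on_eq_continuous_at)
    then have "(\<lambda>n. f (grid_corner (real (Suc n)) x)) \<longlonglongrightarrow> f x" for x
      by (rule isCont_tendsto_compose[OF _ grid_corner_tendsto])
    then show "AE x in lborel. (\<lambda>n. f (grid_corner (real (Suc n)) x)) \<longlonglongrightarrow> f x" by simp
    show "integrable lborel M" using B by (simp add: M_def[abs_def])
    have "integrable lborel (\<lambda>x. c * (indicator ?B x *\<^sub>R \<bar>u x\<bar>))"
      using u by (intro integrable_mult_right integrable_mult_indicator) auto
    then show "integrable lborel (\<lambda>x. M x * \<bar>u x\<bar>)" by (simp add: M_def mult.assoc)
    have "(\<lambda>x. M x powr q) = (\<lambda>x. c powr q * indicator ?B x)"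
      using q by (auto simp: M_def indicator_def)
    then show "integrable lborel (\<lambda>x. M x powr q)" using B by simp
  qed (use f u q fB in auto)
qed

text \<open>A measurable function is an almost everywhere limit of continuous ones. Clipping these
  to the range from 0 to \<open>c\<close> supplies a majorant, and a Urysohn cutoff equal to 1 on
  \<open>K\<close> keeps their supports in a fixed compact subset of \<Omega>.\<close>

lemma box_approximable_bounded:
  fixes f u :: "'a::euclidean_space \<Rightarrow> real"
  assumes f: "f \<in> borel_measurable borel" "\<And>x. 0 \<le> f x" "\<And>x. f x \<le> c"
    and K: "compact K" "K \<subseteq> \<Omega>" "\<And>x. x \<notin> K \<Longrightarrow> f x = 0" and \<Omega>: "open \<Omega>"
    and u: "integrable lborel u" and q: "0 < q"
  shows "box_approximable \<Omega> u q f"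
proof -
  obtain d where d: "0 < d" "(\<Union>x\<in>K. cball x d) \<subseteq> \<Omega>"
    using compact_subset_open_imp_cball_epsilon_subset[OF K(1) \<Omega> K(2)] by metis
  define U where "U = (\<Union>x\<in>K. ball x d)"
  \<comment> \<open>The closed d-neighbourhood of \<open>K\<close>, written as a sum of two compact
    sets to make its compactness evident.\<close>
  define L where "L = (\<Union>x\<in>K. \<Union>y\<in>cball 0 d. {x + y})"
  have L: "compact L" unfolding L_def by (intro compact_sums' K(1)) auto
  have eqL: "L = (\<Union>x\<in>K. cball x d)"
  proof (intro equalityI subsetI)
    fix z assume "z \<in> (\<Union>x\<in>K. cball x d)"
    then obtain x where "x \<in> K" "dist x z \<le> d" by auto
    then show "z \<in> L"
      unfolding L_def by (intro UN_I[of x] UN_I[of "z - x"]) (auto simp: dist_norm norm_minus_commute)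
  next
    fix z assume "z \<in> L"
    then obtain x y where "x \<in> K" "norm y \<le> d" "z = x + y" by (auto simp: L_def)
    then show "z \<in> (\<Union>x\<in>K. cball x d)"
      by (intro UN_I[of x]) (auto simp: dist_norm)
  qed
  have L\<Omega>: "L \<subseteq> \<Omega>" using d(2) eqL by simp
  have U: "open U" "K \<subseteq> U" "U \<subseteq> L" using d(1) unfolding U_def eqL by auto
  obtain \<zeta> :: "'a \<Rightarrow> real" where \<zeta>: "continuous_on UNIV \<zeta>" "\<And>x. \<zeta> x \<in> closed_segment 1 0"
    "\<And>x. x \<in> K \<Longrightarrow> \<zeta> x = 1" "\<And>x. x \<in> - U \<Longrightarrow> \<zeta> x = 0"
    using Urysohn[of K "- U" 1 0] K(1) U by (auto simp: compact_imp_closed closed_Compl)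
  have \<zeta>01: "0 \<le> \<zeta> x" "\<zeta> x \<le> 1" for x
    using \<zeta>(2)[of x] by (auto simp: closed_segment_eq_real_ivl split: if_splits)
  have c: "0 \<le> c" using f(2,3) order_trans by blast
  have "f \<in> borel_measurable lebesgue" using f(1) by (auto intro: measurable_completion)
  then have "f measurable_on UNIV" by (rule lebesgue_measurable_imp_measurable_on_real) auto
  then obtain N g where N: "negligible N" and g: "\<And>n. continuous_on UNIV (g n)"
    "\<And>x. x \<notin> N \<Longrightarrow> (\<lambda>n. g n x) \<longlonglongrightarrow> f x"
    unfolding measurable_on_def by auto
  define F where "F n x = \<zeta> x * max 0 (min c (g n x))" for n x
  have contF: "continuous_on UNIV (F n)" for n
    unfolding F_def by (intro continuous_intros \<zeta>(1) g(1))
  have F0: "0 \<le> F n x" for n x using \<zeta>01 by (simp add: F_def)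
  have Fc: "F n x \<le> c" for n x
    using mult_mono[of "\<zeta> x" 1 "max 0 (min c (g n x))" c] \<zeta>01 c by (simp add: F_def)
  have FL: "F n x = 0" if "x \<notin> L" for n x using \<zeta>(4)[of x] that U by (auto simp: F_def)
  have L': "emeasure lborel L < \<infinity>" "L \<in> sets borel"
    using emeasure_bounded_finite[OF compact_imp_bounded[OF L]] L by (auto simp: compact_imp_closed borel_closed)
  show ?thesis
  proof (rule box_approximable_limit)
    show "\<forall>\<^sub>F n in sequentially. box_approximable \<Omega> u q (F n)"
      using box_approximable_continuous[OF contF F0 Fc L L\<Omega> FL \<Omega> u q] by simp
    show "F n x \<le> c * indicator L x" for n x
      using Fc FL by (auto simp: indicator_def)
    show "F n \<in> borel_measurable lborel" for n
      using borel_measurable_continuous_onI[OF contF] by simp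
    have "AE x in lebesgue. x \<notin> N"
      using N unfolding negligible_iff_null_sets by (rule AE_not_in)
    then have "AE x in lborel. x \<notin> N"
      unfolding AE_completion_iff .
    then show "AE x in lborel. (\<lambda>n. F n x) \<longlonglongrightarrow> f x"
    proof (rule eventually_mono)
      fix x assume "x \<notin> N"
      then have "(\<lambda>n. F n x) \<longlonglongrightarrow> \<zeta> x * max 0 (min c (f x))"
        unfolding F_def by (intro tendsto_intros g(2))
      moreover have "\<zeta> x * max 0 (min c (f x)) = f x"
        using f(2)[of x] f(3)[of x] K(3)[of x] \<zeta>(3)[of x] c by (cases "x \<in> K") (auto simp: max_def min_def)
      ultimately show "(\<lambda>n. F n x) \<longlonglongrightarrow> f x" by simp
    qed
    show "integrable lborel (\<lambda>x. c * indicator L x)" using L' by simp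
    have "integrable lborel (\<lambda>x. c * (indicator L x *\<^sub>R \<bar>u x\<bar>))"
      using u L' by (intro integrable_mult_right integrable_mult_indicator) auto
    then show "integrable lborel (\<lambda>x. c * indicator L x * \<bar>u x\<bar>)" by (simp add: mult.assoc)
    have "(\<lambda>x. (c * indicator L x) powr q) = (\<lambda>x. c powr q * indicator L x)"
      using q by (auto simp: indicator_def)
    then show "integrable lborel (\<lambda>x. (c * indicator L x) powr q)" using L' by simp
  qed (use f u q F0 in auto)
qed

text \<open>Truncate at height \<open>n\<close> and restrict to the n-th set of a compact exhaustion
  of \<Omega>; the function itself is the majorant.\<close>

lemma box_approximable_nonneg:
  fixes f u :: "'a::euclidean_space \<Rightarrow> real"
  assumes f: "f \<in> borel_measurable borel" "\<And>x. 0 \<le> f x" "\<And>x. x \<notin> \<Omega> \<Longrightarrow> f x = 0"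
    and \<Omega>: "open \<Omega>" and u: "integrable lborel u" and q: "0 < q"
    and int: "integrable lborel f" "integrable lborel (\<lambda>x. f x * \<bar>u x\<bar>)" "integrable lborel (\<lambda>x. f x powr q)"
  shows "box_approximable \<Omega> u q f"
proof -
  obtain C :: "nat \<Rightarrow> 'a set" where C: "\<And>n. compact (C n)" "\<And>n. C n \<subseteq> \<Omega>"
    "\<And>K. compact K \<Longrightarrow> K \<subseteq> \<Omega> \<Longrightarrow> \<exists>N. \<forall>n\<ge>N. K \<subseteq> C n"
    using open_Union_compact_subsets[OF \<Omega>] by metis
  define F where "F n x = indicator (C n) x * min (real n) (f x)" for n x
  have Cb [measurable]: "C n \<in> sets borel" for n
    using C(1) by (simp add: compact_imp_closed borel_closed)
  have [measurable]: "f \<in> borel_measurable borel" by (rule f)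
  have Fm: "F n \<in> borel_measurable borel" for n unfolding F_def by measurable
  have F0: "0 \<le> F n x" for n x using f(2) by (simp add: F_def)
  show ?thesis
  proof (rule box_approximable_limit[where F = F and M = f])
    show "\<forall>\<^sub>F n in sequentially. box_approximable \<Omega> u q (F n)"
    proof (intro always_eventually allI)
      fix n
      show "box_approximable \<Omega> u q (F n)"
        by (rule box_approximable_bounded[OF Fm F0 _ C(1,2) _ \<Omega> u q, of n "real n" n])
           (auto simp: F_def indicator_def)
    qed
    show "F n x \<le> f x" for n x using f(2) by (auto simp: F_def indicator_def)
    have "(\<lambda>n. F n x) \<longlonglongrightarrow> f x" for x
    proof (cases "x \<in> \<Omega>")
      case True
      then obtain N where N: "\<And>n. n \<ge> N \<Longrightarrow> x \<in> C n" using C(3)[of "{x}"] by auto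
      have "\<forall>\<^sub>F n in sequentially. f x = F n x"
        using eventually_ge_at_top[of "max N (nat \<lceil>f x\<rceil>)"]
      proof (rule eventually_mono)
        fix n assume n: "max N (nat \<lceil>f x\<rceil>) \<le> n"
        then have "f x \<le> real n" by linarith
        then show "f x = F n x" using N[of n] n by (simp add: F_def)
      qed
      then show ?thesis by (rule Lim_transform_eventually[OF tendsto_const])
    next
      case False
      then have "F n x = f x" for n using f(3)[of x] by (simp add: F_def)
      then show ?thesis by simp
    qed
    then show "AE x in lborel. (\<lambda>n. F n x) \<longlonglongrightarrow> f x" by simp
  qed (use f u q F0 Fm int in auto)
qed

section \<open>The Poincare inequality\<close>

text \<open>Hiding the family behind an existential leaves a relation between three reals, so that
  approximating sequences can be chosen as sequences of numbers.\<close>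

definition box_moments ::
  "'a::euclidean_space set \<Rightarrow> ('a \<Rightarrow> real) \<Rightarrow> real \<Rightarrow> real \<Rightarrow> real \<Rightarrow> real \<Rightarrow> bool" where
  "box_moments \<Omega> u q a X S \<longleftrightarrow> (\<exists>(I::'a set) A \<alpha>. box_family I A \<and>
     (\<forall>k\<in>I. 0 < \<alpha> k \<and> A k \<subseteq> \<Omega>) \<and> a = (\<Sum>k\<in>I. \<alpha> k * measure lborel (A k)) \<and>
     X = (\<Sum>k\<in>I. \<alpha> k * (LINT x|lborel. indicator (A k) x * u x)) \<and>
     S = (\<Sum>k\<in>I. \<alpha> k powr q * measure lborel (A k)))"

text \<open>For restoring equal masses: approximants of two densities of the same mass have only
  nearly the same mass.\<close>

lemma box_moments_scale:
  assumes "box_moments \<Omega> u q a X S" "0 < s"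
  shows "box_moments \<Omega> u q (s * a) (s * X) (s powr q * S)"
proof -
  obtain I A \<alpha> where "box_family (I::'a set) A" "\<forall>k\<in>I. 0 < \<alpha> k \<and> A k \<subseteq> \<Omega>"
    "a = (\<Sum>k\<in>I. \<alpha> k * measure lborel (A k))"
    "X = (\<Sum>k\<in>I. \<alpha> k * (LINT x|lborel. indicator (A k) x * u x))"
    "S = (\<Sum>k\<in>I. \<alpha> k powr q * measure lborel (A k))"
    using assms(1) unfolding box_moments_def by blast
  then show ?thesis
    unfolding box_moments_def using assms(2)
    by (intro exI[of _ I] exI[of _ A] exI[of _ "\<lambda>k. s * \<alpha> k"])
       (auto simp: sum_distrib_left mult.assoc powr_mult intro!: sum.cong)
qed

lemma box_approximable_imp_moments:
  assumes "box_approximable \<Omega> u q f"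
  obtains a X S where "\<And>n. box_moments \<Omega> u q (a n) (X n) (S n)"
    "a \<longlonglongrightarrow> (LINT x|lborel. f x)" "X \<longlonglongrightarrow> (LINT x|lborel. f x * u x)" "S \<longlonglongrightarrow> (LINT x|lborel. f x powr q)"
proof -
  define P where "P n a X S \<longleftrightarrow> box_moments \<Omega> u q a X S \<and> \<bar>a - (LINT x|lborel. f x)\<bar> < 1 / real (Suc n) \<and>
    \<bar>X - (LINT x|lborel. f x * u x)\<bar> < 1 / real (Suc n) \<and>
    \<bar>S - (LINT x|lborel. f x powr q)\<bar> < 1 / real (Suc n)" for n a X S
  have "\<exists>a X S. P n a X S" for n
  proof -
    have "0 < 1 / real (Suc n)" by simp
    from assms[unfolded box_approximable_def, rule_format, OF this]
    show ?thesis unfolding P_def box_moments_def by blast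
  qed
  then obtain a X S where "\<And>n. P n (a n) (X n) (S n)" by metis
  then have *: "\<And>n. box_moments \<Omega> u q (a n) (X n) (S n)"
    "\<And>n. \<bar>a n - (LINT x|lborel. f x)\<bar> < 1 / real (Suc n)"
    "\<And>n. \<bar>X n - (LINT x|lborel. f x * u x)\<bar> < 1 / real (Suc n)"
    "\<And>n. \<bar>S n - (LINT x|lborel. f x powr q)\<bar> < 1 / real (Suc n)"
    unfolding P_def by blast+
  have lim: "Y \<longlonglongrightarrow> L" if "\<And>n. \<bar>Y n - L\<bar> < 1 / real (Suc n)" for Y :: "nat \<Rightarrow> real" and L
  proof -
    have "(\<lambda>n. Y n - L) \<longlonglongrightarrow> 0"
    proof (rule Lim_null_comparison)
      show "(\<lambda>n. 1 / real (Suc n)) \<longlonglongrightarrow> 0" by (rule LIMSEQ_Suc[OF lim_const_over_n])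
      show "\<forall>\<^sub>F n in sequentially. norm (Y n - L) \<le> 1 / real (Suc n)"
        using that by (intro always_eventually allI) (auto intro: less_imp_le)
    qed
    then show ?thesis by (rule LIM_zero_cancel)
  qed
  show thesis by (rule that[OF *(1) lim[OF *(2)] lim[OF *(3)] lim[OF *(4)]])
qed

context lborel_weak_gradient
begin

lemma box_moments_inequality:
  assumes "box_moments \<Omega> u q a X S" "box_moments \<Omega> u q a Y R"
  shows "X - Y \<le> diameter \<Omega> powr p * (LINT x|lborel. norm (G x) powr p) / p + (S + R) / (2 * q)"
proof -
  obtain I A \<alpha> where I: "box_family (I::'a set) A" "\<forall>k\<in>I. 0 < \<alpha> k \<and> A k \<subseteq> \<Omega>"
    "a = (\<Sum>k\<in>I. \<alpha> k * measure lborel (A k))"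
    "X = (\<Sum>k\<in>I. \<alpha> k * (LINT x|lborel. indicator (A k) x * u x))"
    "S = (\<Sum>k\<in>I. \<alpha> k powr q * measure lborel (A k))"
    using assms(1) unfolding box_moments_def by blast
  obtain J B \<beta> where J: "box_family (J::'a set) B" "\<forall>k\<in>J. 0 < \<beta> k \<and> B k \<subseteq> \<Omega>"
    "a = (\<Sum>k\<in>J. \<beta> k * measure lborel (B k))"
    "Y = (\<Sum>k\<in>J. \<beta> k * (LINT x|lborel. indicator (B k) x * u x))"
    "R = (\<Sum>k\<in>J. \<beta> k powr q * measure lborel (B k))"
    using assms(2) unfolding box_moments_def by blast
  show ?thesis
    unfolding I(4,5) J(4,5)
    using I(1,2,3) J(1,2,3) by (intro box_transport_inequality) auto
qed

text \<open>The approximants of \<open>g\<close> are multiplied by the ratio \<open>s n\<close> of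
  the masses. As the common limit of the masses is positive, the ratio tends to 1 and disappears in
  the limit.\<close>

lemma transport_inequality_nonneg:
  assumes f: "box_approximable \<Omega> u q f" and g: "box_approximable \<Omega> u q g"
    and eq: "(LINT x|lborel. f x) = (LINT x|lborel. g x)" and pos: "0 < (LINT x|lborel. f x)"
  shows "(LINT x|lborel. f x * u x) - (LINT x|lborel. g x * u x) \<le>
    diameter \<Omega> powr p * (LINT x|lborel. norm (G x) powr p) / p +
    ((LINT x|lborel. f x powr q) + (LINT x|lborel. g x powr q)) / (2 * q)"
proof -
  obtain a X S where a: "\<And>n. box_moments \<Omega> u q (a n) (X n) (S n)"
    "a \<longlonglongrightarrow> (LINT x|lborel. f x)" "X \<longlonglongrightarrow> (LINT x|lborel. f x * u x)" "S \<longlonglongrightarrow> (LINT x|lborel. f x powr q)"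
    using box_approximable_imp_moments[OF f] by blast
  obtain b Y R where b: "\<And>n. box_moments \<Omega> u q (b n) (Y n) (R n)"
    "b \<longlonglongrightarrow> (LINT x|lborel. g x)" "Y \<longlonglongrightarrow> (LINT x|lborel. g x * u x)" "R \<longlonglongrightarrow> (LINT x|lborel. g x powr q)"
    using box_approximable_imp_moments[OF g] by blast
  define s where "s n = a n / b n" for n
  have "s \<longlonglongrightarrow> (LINT x|lborel. f x) / (LINT x|lborel. g x)"
    unfolding s_def using pos eq by (intro tendsto_divide a b) auto
  then have s: "s \<longlonglongrightarrow> 1" using pos eq by simp
  have sq: "(\<lambda>n. s n powr q) \<longlonglongrightarrow> 1"
    using tendsto_powr[OF s tendsto_const, of q] by simp
  have lim: "(\<lambda>n. X n - s n * Y n) \<longlonglongrightarrow> (LINT x|lborel. f x * u x) - 1 * (LINT x|lborel. g x * u x)"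
    by (intro tendsto_intros a b s)
  have lim': "(\<lambda>n. diameter \<Omega> powr p * (LINT x|lborel. norm (G x) powr p) / p + (S n + s n powr q * R n) / (2 * q))
     \<longlonglongrightarrow> diameter \<Omega> powr p * (LINT x|lborel. norm (G x) powr p) / p +
       ((LINT x|lborel. f x powr q) + 1 * (LINT x|lborel. g x powr q)) / (2 * q)"
    using pq by (intro tendsto_intros a b sq) auto
  have "\<forall>\<^sub>F n in sequentially. 0 < a n" "\<forall>\<^sub>F n in sequentially. 0 < b n"
    using order_tendstoD(1)[OF a(2) pos] order_tendstoD(1)[OF b(2), of 0] pos eq by auto
  then have "\<forall>\<^sub>F n in sequentially. X n - s n * Y n \<le>
      diameter \<Omega> powr p * (LINT x|lborel. norm (G x) powr p) / p + (S n + s n powr q * R n) / (2 * q)"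
  proof eventually_elim
    case (elim n)
    then have "box_moments \<Omega> u q (a n) (s n * Y n) (s n powr q * R n)"
      using box_moments_scale[OF b(1), of "s n" n] by (simp add: s_def)
    then show ?case by (rule box_moments_inequality[OF a(1)])
  qed
  from tendsto_le[OF sequentially_bot lim' lim this] show ?thesis by simp
qed

text \<open>The optimal scaling of \<open>\<bar>u\<bar>\<^sup>p\<^sup>-\<^sup>2u\<close> in Young's inequality is by the factor \<open>2\<^sup>p\<^sup>-\<^sup>1\<close>.\<close>

lemma poincare_inequality:
  assumes up: "integrable lborel (\<lambda>x. \<bar>u x\<bar> powr p)" and u0: "\<And>x. x \<notin> \<Omega> \<Longrightarrow> u x = 0"
    and nz: "\<not> (AE x in lborel. u x = 0)"
    and mean: "(LINT x|lborel. \<bar>u x\<bar> powr (p - 2) * u x) = 0"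
    and um: "integrable lborel (\<lambda>x. \<bar>u x\<bar> powr (p - 1))"
  shows "2 powr (p - 1) * (LINT x|lborel. \<bar>u x\<bar> powr p) \<le> diameter \<Omega> powr p * (LINT x|lborel. norm (G x) powr p)"
proof -
  have [measurable]: "u \<in> borel_measurable borel" using u by auto
  have q: "q = p / (p - 1)" and qp: "(p - 1) * q = p" using pq by (auto simp: field_simps)
  \<comment> \<open>The inequality to come is
    \<open>l * X \<le> E / p + l powr q * X / (2 * q)\<close>. The gain
    \<open>l - l powr q / (2 * q)\<close> is largest where \<open>l powr (q - 1) = 2\<close>, that
    is at this \<open>l\<close>, because \<open>(p - 1) * (q - 1) = 1\<close>. There
    \<open>l powr q = 2 * l\<close>, and the gain is \<open>l / p\<close>.\<close>
  define l where "l = 2 powr (p - 1)"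
  have l: "0 < l" by (simp add: l_def)
  have "l powr q = 2 powr p" by (simp add: l_def powr_powr qp)
  moreover have "2 * l = 2 powr p" by (simp add: l_def powr_diff)
  ultimately have lq: "l powr q = 2 * l" by simp
  \<comment> \<open>The sign \<sigma> treats both densities at once: 1 selects the positive part of
    \<open>u\<close> and -1 the negative part.\<close>
  define f where "f \<sigma> x = l * max 0 (\<sigma> * u x) powr (p - 1)" for \<sigma> x
  have fm [measurable]: "f \<sigma> \<in> borel_measurable borel" for \<sigma> unfolding f_def by measurable
  have f0: "0 \<le> f \<sigma> x" for \<sigma> x using l by (simp add: f_def)
  have f1: "f \<sigma> x = 0" if "x \<notin> \<Omega>" for \<sigma> x using u0[OF that] by (simp add: f_def)
  have fle: "f \<sigma> x \<le> l * \<bar>u x\<bar> powr (p - 1)" if "\<bar>\<sigma>\<bar> = 1" for \<sigma> x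
    using l pq that unfolding f_def by (intro mult_left_mono powr_mono2) (auto simp: abs_if split: if_splits)
  have int1: "integrable lborel (f \<sigma>)" if "\<bar>\<sigma>\<bar> = 1" for \<sigma>
    by (rule Bochner_Integration.integrable_bound[OF integrable_mult_right[OF um, of l]])
       (use fle[OF that] f0 l in auto)
  have fu: "f \<sigma> x * \<bar>u x\<bar> = \<sigma> * (f \<sigma> x * u x)" and fpw: "f \<sigma> x * \<bar>u x\<bar> = l * max 0 (\<sigma> * u x) powr p" if "\<bar>\<sigma>\<bar> = 1" for \<sigma> x
  proof -
    have s: "\<sigma> = 1 \<or> \<sigma> = -1" using that by auto
    then show "f \<sigma> x * \<bar>u x\<bar> = \<sigma> * (f \<sigma> x * u x)"
      by (auto simp: f_def max_def abs_if)
    show "f \<sigma> x * \<bar>u x\<bar> = l * max 0 (\<sigma> * u x) powr p"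
      using s by (auto simp: f_def max_def powr_diff abs_if)
  qed
  have max_le: "max 0 (\<sigma> * u x) powr p \<le> \<bar>u x\<bar> powr p" if "\<bar>\<sigma>\<bar> = 1" for \<sigma> x
    using pq that by (intro powr_mono2) (auto simp: abs_if split: if_splits)
  have intp: "integrable lborel (\<lambda>x. max 0 (\<sigma> * u x) powr p)" if "\<bar>\<sigma>\<bar> = 1" for \<sigma>
    by (rule Bochner_Integration.integrable_bound[OF up]) (use max_le[OF that] in auto)
  have int2: "integrable lborel (\<lambda>x. f \<sigma> x * \<bar>u x\<bar>)" if "\<bar>\<sigma>\<bar> = 1" for \<sigma>
    using intp[OF that] by (simp add: fpw[OF that])
  have fq: "f \<sigma> x powr q = 2 * l * max 0 (\<sigma> * u x) powr p" for \<sigma> x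
    using l by (simp add: f_def powr_mult powr_powr qp lq)
  have int3: "integrable lborel (\<lambda>x. f \<sigma> x powr q)" if "\<bar>\<sigma>\<bar> = 1" for \<sigma>
    using intp[OF that] by (simp add: fq)
  have approx: "box_approximable \<Omega> u q (f \<sigma>)" if "\<bar>\<sigma>\<bar> = 1" for \<sigma>
    using pq by (intro box_approximable_nonneg fm f0 f1 \<Omega> u int1 int2 int3 that) auto
  \<comment> \<open>This makes the constraint of the eigenvalue problem the equality of the two
    masses.\<close>
  have diff: "f 1 x - f (-1) x = l * (\<bar>u x\<bar> powr (p - 2) * u x)" for x
    by (auto simp: f_def max_def abs_if powr_diff power2_eq_square powr_numeral)
  have "(LINT x|lborel. f 1 x) - (LINT x|lborel. f (-1) x) = (LINT x|lborel. f 1 x - f (-1) x)"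
    using int1 by simp
  also have "\<dots> = 0" using mean by (simp add: diff)
  finally have eq: "(LINT x|lborel. f 1 x) = (LINT x|lborel. f (-1) x)" by simp
  have "(LINT x|lborel. f 1 x) \<noteq> 0"
  proof
    assume z: "(LINT x|lborel. f 1 x) = 0"
    then have "(LINT x|lborel. f (-1) x) = 0" using eq by simp
    with z have "AE x in lborel. f 1 x = 0" "AE x in lborel. f (-1) x = 0"
      using integral_nonneg_eq_0_iff_AE[OF int1] f0 by auto
    then have "AE x in lborel. u x = 0"
    proof eventually_elim
      case (elim x)
      then show ?case using l by (auto simp: f_def max_def split: if_splits)
    qed
    then show False using nz by simp
  qed
  moreover have "0 \<le> (LINT x|lborel. f 1 x)" using f0 by simp
  ultimately have pos: "0 < (LINT x|lborel. f 1 x)" by simp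
  define X where "X = (LINT x|lborel. \<bar>u x\<bar> powr p)"
  define E where "E = diameter \<Omega> powr p * (LINT x|lborel. norm (G x) powr p)"
  have sum: "max 0 (1 * u x) powr p + max 0 ((-1) * u x) powr p = \<bar>u x\<bar> powr p" for x
    by (auto simp: max_def abs_if)
  have sumX: "(LINT x|lborel. max 0 (1 * u x) powr p) + (LINT x|lborel. max 0 ((-1) * u x) powr p) = X"
    unfolding X_def sum[symmetric] by (rule Bochner_Integration.integral_add[symmetric]) (intro intp; simp)+
  have e1: "f 1 x * u x = l * max 0 (1 * u x) powr p" "f (-1) x * u x = - (l * max 0 ((-1) * u x) powr p)" for x
    using fu[of 1 x] fpw[of 1 x] fu[of "-1" x] fpw[of "-1" x] by auto
  have "l * X = (LINT x|lborel. f 1 x * u x) - (LINT x|lborel. f (-1) x * u x)"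
    unfolding e1 sumX[symmetric] by (simp add: distrib_left)
  also have "\<dots> \<le> E / p + ((LINT x|lborel. f 1 x powr q) + (LINT x|lborel. f (-1) x powr q)) / (2 * q)"
    unfolding E_def by (rule transport_inequality_nonneg[OF approx approx eq pos]) auto
  also have "(LINT x|lborel. f 1 x powr q) + (LINT x|lborel. f (-1) x powr q) = 2 * l * X"
    unfolding fq sumX[symmetric] by (simp add: distrib_left)
  finally have "l * X * (1 - 1 / q) \<le> E / p"
    using pq by (simp add: field_simps)
  moreover have "1 - 1 / q = 1 / p" using pq by simp
  ultimately have "l * X \<le> E" using pq by (simp add: divide_le_cancel)
  then show ?thesis by (simp add: l_def X_def E_def)
qed

end

section \<open>From the Lebesgue measure on \<Omega> to Borel functions on the whole space\<close>

lemma borel_representative: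
  fixes f :: "'a::euclidean_space \<Rightarrow> 'b::euclidean_space"
  assumes S [measurable]: "S \<in> sets borel" and f: "f \<in> borel_measurable (lebesgue_on S)"
  shows "\<exists>f'\<in>borel_measurable borel. (\<forall>x. x \<notin> S \<longrightarrow> f' x = 0) \<and> (AE x in lborel. x \<in> S \<longrightarrow> f x = f' x)"
proof -
  let ?F = "\<lambda>x. indicator S x *\<^sub>R f x"
  have F: "?F \<in> borel_measurable lebesgue"
    using f S by (subst (asm) borel_measurable_restrict_space_iff) auto
  \<comment> \<open>A Borel version is chosen for each coordinate separately, since the completion
    result is about real functions; finitely many exceptional null sets are then united.\<close>
  define Q where "Q i h \<longleftrightarrow> h \<in> borel_measurable borel \<and> (AE x in lborel. ?F x \<bullet> i = h x)" for i h
  have "\<exists>h. Q i h" for i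
  proof -
    have "(\<lambda>x. ?F x \<bullet> i) \<in> borel_measurable lebesgue"
      using F by (rule borel_measurable_inner) simp
    from completion_ex_borel_measurable_real[OF this] show ?thesis
      unfolding Q_def by auto
  qed
  then obtain h where "\<And>i. Q i (h i)" by metis
  then have h [measurable]: "\<And>i. h i \<in> borel_measurable borel"
      and ae: "\<And>i. AE x in lborel. ?F x \<bullet> i = h i x"
    unfolding Q_def by blast+
  define f' where "f' x = indicator S x *\<^sub>R (\<Sum>i\<in>Basis. h i x *\<^sub>R i)" for x
  have "f' \<in> borel_measurable borel" unfolding f'_def by measurable
  moreover have "f' x = 0" if "x \<notin> S" for x using that by (simp add: f'_def)
  moreover have "AE x in lborel. x \<in> S \<longrightarrow> f x = f' x"
  proof -
    have "AE x in lborel. \<forall>i\<in>Basis. ?F x \<bullet> i = h i x"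
      unfolding AE_finite_all[OF finite_Basis] by (intro ballI ae)
    then show ?thesis
    proof (rule eventually_mono)
      fix x assume *: "\<forall>i\<in>Basis. ?F x \<bullet> i = h i x"
      have "f x = (\<Sum>i\<in>Basis. h i x *\<^sub>R i)" if "x \<in> S"
      proof -
        have "(\<Sum>i\<in>Basis. h i x *\<^sub>R i) = (\<Sum>i\<in>Basis. (f x \<bullet> i) *\<^sub>R i)"
          using * that by (intro sum.cong) auto
        then show ?thesis by (simp only: euclidean_representation)
      qed
      then show "x \<in> S \<longrightarrow> f x = f' x" by (simp add: f'_def)
    qed
  qed
  ultimately show ?thesis by blast
qed

lemma lebesgue_on_eq_lborel:
  fixes f f' :: "'a::euclidean_space \<Rightarrow> 'b::euclidean_space"
  assumes S: "S \<in> sets borel" and f: "f \<in> borel_measurable (lebesgue_on S)"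
    and f': "f' \<in> borel_measurable borel" "\<And>x. x \<notin> S \<Longrightarrow> f' x = 0"
    and ae: "AE x in lborel. x \<in> S \<longrightarrow> f x = f' x"
  shows "integral\<^sup>L (lebesgue_on S) f = integral\<^sup>L lborel f'"
    and "integrable (lebesgue_on S) f \<longleftrightarrow> integrable lborel f'"
proof -
  let ?F = "\<lambda>x. indicator S x *\<^sub>R f x"
  have S': "S \<inter> space lebesgue \<in> sets lebesgue" using S by auto
  have F: "?F \<in> borel_measurable lebesgue"
    using f S' by (subst (asm) borel_measurable_restrict_space_iff) auto
  have f'': "f' \<in> borel_measurable lebesgue" using f' by (auto intro: measurable_completion)
  have "AE x in lborel. ?F x = f' x"
    using ae by (rule eventually_mono) (use f'(2) in \<open>auto simp: indicator_def\<close>)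
  then have eq: "AE x in lebesgue. ?F x = f' x" by (rule AE_completion)
  show "integral\<^sup>L (lebesgue_on S) f = integral\<^sup>L lborel f'"
    using integral_restrict_space[OF S', of f] integral_cong_AE[OF F f'' eq] integral_completion[of f' lborel] f'
    by simp
  show "integrable (lebesgue_on S) f \<longleftrightarrow> integrable lborel f'"
    using integrable_restrict_space[OF S', of f] integrable_cong_AE[OF F f'' eq] integrable_completion[of f' lborel] f'
    by simp
qed

text \<open>From \<open>t powr s \<le> 1 + t powr p\<close>, with the 1 needed only on the bounded
  set \<open>S\<close>. The case \<open>s = 1\<close> makes \<open>u\<close> and \<open>G\<close>
  integrable for the convolutions, and \<open>s = p - 1\<close> gives finite masses.\<close>

lemma integrable_norm_powr_le:
  fixes f :: "'a::euclidean_space \<Rightarrow> 'b::euclidean_space"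
  assumes S: "S \<in> sets borel" "bounded S" and f [measurable]: "f \<in> borel_measurable borel"
    and f0: "\<And>x. x \<notin> S \<Longrightarrow> f x = 0" and int: "integrable lborel (\<lambda>x. norm (f x) powr p)"
    and s: "0 < s" "s \<le> p"
  shows "integrable lborel (\<lambda>x. norm (f x) powr s)"
proof (rule Bochner_Integration.integrable_bound)
  have "integrable lborel (indicator S :: 'a \<Rightarrow> real)"
    using S emeasure_bounded_finite[of S] by (intro integrable_real_indicator) auto
  then show "integrable lborel (\<lambda>x. indicator S x + norm (f x) powr p)"
    using int by simp
  have "norm (f x) powr s \<le> indicator S x + norm (f x) powr p" for x
  proof (cases "norm (f x) \<le> 1")
    case True
    then have "norm (f x) powr s \<le> indicator S x"
      using f0[of x] s powr_mono2[of s "norm (f x)" 1] by (auto simp: indicator_def)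
    then show ?thesis using powr_ge_zero[of "norm (f x)" p] by linarith
  next
    case False
    then have "norm (f x) powr s \<le> norm (f x) powr p"
      using s by (intro powr_mono) auto
    then show ?thesis by (simp add: indicator_def)
  qed
  then show "AE x in lborel. norm (norm (f x) powr s) \<le> norm (indicator S x + norm (f x) powr p)"
    by (auto simp: indicator_def)
qed measurable

lemma test_function_regular:
  assumes "\<psi> \<in> test_functions \<Omega>"
  shows "continuous_on UNIV \<psi>" "i \<in> Basis \<Longrightarrow> continuous_on UNIV (\<lambda>x. frechet_derivative \<psi> (at x) i)"
    "x \<notin> \<Omega> \<Longrightarrow> \<psi> x = 0"
proof -
  have "C_k k \<psi>" for k using assms by (simp add: test_functions_def)
  from this[of 0] this[of "Suc 0"] show "continuous_on UNIV \<psi>"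
    "i \<in> Basis \<Longrightarrow> continuous_on UNIV (\<lambda>x. frechet_derivative \<psi> (at x) i)"
    by auto
  show "x \<notin> \<Omega> \<Longrightarrow> \<psi> x = 0"
    using assms closure_subset[of "{x. \<psi> x \<noteq> 0}"] by (auto simp: test_functions_def)
qed

text \<open>The Poincare inequality for Borel representatives, read back on \<Omega>. Positivity of
  the denominator comes along, to allow the passage from the product form to the quotient.\<close>

lemma neumann_quotient_ge:
  fixes \<Omega> :: "'a::euclidean_space set" and \<phi> :: "'a \<Rightarrow> real" and g :: "'a \<Rightarrow> 'a"
  assumes p: "1 < p" and \<Omega>: "open \<Omega>" "bounded \<Omega>" "convex \<Omega>"
    and \<phi>: "\<phi> \<in> Lp p \<Omega>" and g: "g \<in> Lp p \<Omega>" and weak: "has_weak_gradient_on \<phi> g \<Omega>"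
    and nz: "\<not> (AE x in lebesgue_on \<Omega>. \<phi> x = 0)"
    and mean: "(LINT x|lebesgue_on \<Omega>. \<bar>\<phi> x\<bar> powr (p - 2) * \<phi> x) = 0"
  shows "2 powr (p - 1) * (LINT x|lebesgue_on \<Omega>. \<bar>\<phi> x\<bar> powr p) \<le>
      diameter \<Omega> powr p * (LINT x|lebesgue_on \<Omega>. norm (g x) powr p)"
    and "0 < (LINT x|lebesgue_on \<Omega>. \<bar>\<phi> x\<bar> powr p)"
proof -
  have \<Omega>b [measurable]: "\<Omega> \<in> sets borel" using \<Omega>(1) by simp
  have \<phi>m [measurable]: "\<phi> \<in> borel_measurable (lebesgue_on \<Omega>)"
    and gm [measurable]: "g \<in> borel_measurable (lebesgue_on \<Omega>)"
    using \<phi> g by (auto simp: Lp_def)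
  obtain u where um [measurable]: "u \<in> borel_measurable borel" and u0: "\<And>x. x \<notin> \<Omega> \<Longrightarrow> u x = 0"
    and u: "AE x in lborel. x \<in> \<Omega> \<longrightarrow> \<phi> x = u x"
    using borel_representative[OF \<Omega>b \<phi>m] by auto
  obtain G where Gm [measurable]: "G \<in> borel_measurable borel" and G0: "\<And>x. x \<notin> \<Omega> \<Longrightarrow> G x = 0"
    and G: "AE x in lborel. x \<in> \<Omega> \<longrightarrow> g x = G x"
    using borel_representative[OF \<Omega>b gm] by auto
  have up: "(LINT x|lebesgue_on \<Omega>. \<bar>\<phi> x\<bar> powr p) = (LINT x|lborel. \<bar>u x\<bar> powr p)"
      "integrable lborel (\<lambda>x. \<bar>u x\<bar> powr p)"
  proof -
    have ae: "AE x in lborel. x \<in> \<Omega> \<longrightarrow> \<bar>\<phi> x\<bar> powr p = \<bar>u x\<bar> powr p"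
      using u by (rule eventually_mono) simp
    note t = lebesgue_on_eq_lborel[OF \<Omega>b _ _ _ ae]
    show "(LINT x|lebesgue_on \<Omega>. \<bar>\<phi> x\<bar> powr p) = (LINT x|lborel. \<bar>u x\<bar> powr p)"
      by (rule t(1)) (simp_all add: u0)
    have "integrable (lebesgue_on \<Omega>) (\<lambda>x. \<bar>\<phi> x\<bar> powr p) \<longleftrightarrow> integrable lborel (\<lambda>x. \<bar>u x\<bar> powr p)"
      by (rule t(2)) (simp_all add: u0)
    then show "integrable lborel (\<lambda>x. \<bar>u x\<bar> powr p)" using \<phi> by (simp add: Lp_def)
  qed
  have Gp: "(LINT x|lebesgue_on \<Omega>. norm (g x) powr p) = (LINT x|lborel. norm (G x) powr p)"
      "integrable lborel (\<lambda>x. norm (G x) powr p)"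
  proof -
    have ae: "AE x in lborel. x \<in> \<Omega> \<longrightarrow> norm (g x) powr p = norm (G x) powr p"
      using G by (rule eventually_mono) simp
    note t = lebesgue_on_eq_lborel[OF \<Omega>b _ _ _ ae]
    show "(LINT x|lebesgue_on \<Omega>. norm (g x) powr p) = (LINT x|lborel. norm (G x) powr p)"
      by (rule t(1)) (simp_all add: G0)
    have "integrable (lebesgue_on \<Omega>) (\<lambda>x. norm (g x) powr p) \<longleftrightarrow> integrable lborel (\<lambda>x. norm (G x) powr p)"
      by (rule t(2)) (simp_all add: G0)
    then show "integrable lborel (\<lambda>x. norm (G x) powr p)" using g by (simp add: Lp_def)
  qed
  have "(LINT x|lebesgue_on \<Omega>. \<bar>\<phi> x\<bar> powr (p - 2) * \<phi> x) = (LINT x|lborel. \<bar>u x\<bar> powr (p - 2) * u x)"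
    by (rule lebesgue_on_eq_lborel(1)[OF \<Omega>b]) (use u in \<open>auto simp: u0 elim!: eventually_mono\<close>)
  then have mean': "(LINT x|lborel. \<bar>u x\<bar> powr (p - 2) * u x) = 0" using mean by simp
  have nz': "\<not> (AE x in lborel. u x = 0)"
  proof
    assume "AE x in lborel. u x = 0"
    with u have "AE x in lborel. x \<in> \<Omega> \<longrightarrow> \<phi> x = 0" by eventually_elim simp
    then have "AE x in lebesgue. x \<in> \<Omega> \<longrightarrow> \<phi> x = 0" by (rule AE_completion)
    then show False using nz by (subst (asm) AE_restrict_space_iff) auto
  qed
  have um1: "integrable lborel (\<lambda>x. \<bar>u x\<bar> powr (p - 1))"
    using integrable_norm_powr_le[OF \<Omega>b \<Omega>(2) um u0, of p "p - 1"] up(2) p by simp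
  have ui: "integrable lborel u"
    using integrable_norm_powr_le[OF \<Omega>b \<Omega>(2) um u0, of p 1] up(2) p
    by (intro integrable_norm_cancel[of _ u]) auto
  have Gi: "integrable lborel G"
    using integrable_norm_powr_le[OF \<Omega>b \<Omega>(2) Gm G0, of p 1] Gp(2) p
    by (intro integrable_norm_cancel[of _ G]) auto
  interpret pw: lborel_weak_gradient \<Omega> u G p "p / (p - 1)"
  proof
    show "1 < p / (p - 1)" "1 / p + 1 / (p / (p - 1)) = 1" using p by (auto simp: field_simps)
    fix \<psi> :: "'a \<Rightarrow> real" and i :: 'a assume \<psi>: "\<psi> \<in> test_functions \<Omega>" and i: "i \<in> Basis"
    have m1 [measurable]: "\<psi> \<in> borel_measurable borel" "(\<lambda>x. frechet_derivative \<psi> (at x) i) \<in> borel_measurable borel"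
      using test_function_regular[OF \<psi>] i by (auto intro: borel_measurable_continuous_onI)
    have m2 [measurable]: "\<psi> \<in> borel_measurable (lebesgue_on \<Omega>)"
      "(\<lambda>x. frechet_derivative \<psi> (at x) i) \<in> borel_measurable (lebesgue_on \<Omega>)"
      using m1 by (auto intro!: measurable_restrict_space1 measurable_completion)
    have "(LINT x|lebesgue_on \<Omega>. \<phi> x * frechet_derivative \<psi> (at x) i) =
        (LINT x|lborel. u x * frechet_derivative \<psi> (at x) i)"
      by (rule lebesgue_on_eq_lborel(1)[OF \<Omega>b]) (use u in \<open>auto simp: u0 elim!: eventually_mono\<close>)
    moreover have "(LINT x|lebesgue_on \<Omega>. (g x \<bullet> i) * \<psi> x) = (LINT x|lborel. (G x \<bullet> i) * \<psi> x)"
      by (rule lebesgue_on_eq_lborel(1)[OF \<Omega>b]) (use G in \<open>auto simp: G0 elim!: eventually_mono\<close>)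
    ultimately show "(LINT x|lborel. u x * frechet_derivative \<psi> (at x) i) = - (LINT x|lborel. (G x \<bullet> i) * \<psi> x)"
      using weak \<psi> i by (simp add: has_weak_gradient_on_def)
  qed (use p \<Omega> ui Gi Gp in auto)
  show "2 powr (p - 1) * (LINT x|lebesgue_on \<Omega>. \<bar>\<phi> x\<bar> powr p) \<le>
      diameter \<Omega> powr p * (LINT x|lebesgue_on \<Omega>. norm (g x) powr p)"
    unfolding up(1) Gp(1) by (rule pw.poincare_inequality[OF up(2) u0 nz' mean' um1])
  have "(LINT x|lborel. \<bar>u x\<bar> powr p) \<noteq> 0"
  proof
    assume "(LINT x|lborel. \<bar>u x\<bar> powr p) = 0"
    then have "AE x in lborel. \<bar>u x\<bar> powr p = 0"
      using integral_nonneg_eq_0_iff_AE[OF up(2)] by auto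
    then have "AE x in lborel. u x = 0" by (rule eventually_mono) auto
    then show False using nz' by simp
  qed
  moreover have "0 \<le> (LINT x|lborel. \<bar>u x\<bar> powr p)" by simp
  ultimately show "0 < (LINT x|lebesgue_on \<Omega>. \<bar>\<phi> x\<bar> powr p)"
    unfolding up(1) by linarith
qed

theorem corollary4p5:
  fixes \<Omega> :: "'a::euclidean_space set" and p :: real
  assumes "1 < p" and "open \<Omega>" and "bounded \<Omega>" and "convex \<Omega>" and "\<Omega> \<noteq> {}"
  shows "ereal ((2 powr ((p - 1) / p) / diameter \<Omega>) powr p) \<le> neumann_eigenvalue \<Omega> p"
proof -
  obtain x where "x \<in> \<Omega>" using assms(5) by auto
  then obtain r where r: "0 < r" "cball x r \<subseteq> \<Omega>"
    using assms(2) open_contains_cball by blast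
  \<comment> \<open>A nonempty open set contains a ball, so the diameter is positive and the
    division by it is genuine.\<close>
  have "0 < diameter (cball x r)" using r(1) by (simp add: diameter_cball)
  also have "\<dots> \<le> diameter \<Omega>" by (rule diameter_subset[OF r(2) assms(3)])
  finally have D: "0 < diameter \<Omega>" .
  have eq: "(2 powr ((p - 1) / p) / diameter \<Omega>) powr p = 2 powr (p - 1) / diameter \<Omega> powr p"
    using assms(1) D by (simp add: powr_divide powr_powr)
  show ?thesis
    unfolding neumann_eigenvalue_def
  proof (rule Inf_greatest, clarsimp simp only: mem_Collect_eq ereal_less_eq)
    fix \<phi> :: "'a \<Rightarrow> real" and g :: "'a \<Rightarrow> 'a"
    assume "\<phi> \<in> W1p p \<Omega>" and g: "g \<in> Lp p \<Omega>" "has_weak_gradient_on \<phi> g \<Omega>"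
      and *: "\<not> (AE x in lebesgue_on \<Omega>. \<phi> x = 0)" "(LINT x|lebesgue_on \<Omega>. \<bar>\<phi> x\<bar> powr (p - 2) * \<phi> x) = 0"
    then have "\<phi> \<in> Lp p \<Omega>" by (simp add: W1p_def)
    note ineq = neumann_quotient_ge[OF assms(1-4) this g *]
    show "(2 powr ((p - 1) / p) / diameter \<Omega>) powr p \<le>
      (LINT x|lebesgue_on \<Omega>. norm (g x) powr p) / (LINT x|lebesgue_on \<Omega>. \<bar>\<phi> x\<bar> powr p)"
      unfolding eq using ineq D by (simp add: field_simps)
  qed
qed

end
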